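(* Let $p\ge 3$ be a prime, let $\bar\alpha=(\alpha_1,\dots,\alpha_{p-1})\in\mathbb{GF}(p)^{p-1}$ be a nonsymmetric vector with $\sum_{i=1}^{p-1}\alpha_i=0$, and let $\sigma:\hat\Gamma_{\bar\alpha}\to\bar\Gamma_{\bar\alpha}$ be the natural homomorphism from the profinite completion of the $EGS$-group $\Gamma_{\bar\alpha}$ to its closure in $\mathrm{Aut}\,T$. Then $\mathrm{Ker}\,\sigma$ is isomorphic to the projective limit $\tilde{\mathbb{Z}}_p^{(\infty)}$ of the inverse system $$1\xleftarrow{\ \theta_1\ }\tilde{\mathbb{Z}}_p^{(1)}\xleftarrow{\ \theta_2\ }\tilde{\mathbb{Z}}_p^{(2)}\xleftarrow{\ \theta_3\ }\cdots\xleftarrow{\ \theta_n\ }\tilde{\mathbb{Z}}_p^{(n)}\xleftarrow{\ \theta_{n+1}\ }\cdots.$$ In particular, $\mathrm{Ker}\,\sigma$ is a profinite abelian group of (prime) exponent $p$.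
   Context: Let $A=\{0,1,\dots,p-1\}$ and let $T$ be the regular rooted $p$-tree whose vertices are the finite words over $A$ (root = empty word, $w$ joined to $wx$ for $x\in A$); $|v|$ is the length of the word $v$; $v\ge u$ means that $v$ lies in the subtree below $u$, i.e. $u$ is a prefix of $v$. Automorphisms of $T$ (fixing the root) act on the right. If $g\in\mathrm{Aut}\,T$ fixes a vertex $v$, then $g_v\in\mathrm{Aut}\,T$ is defined by $(vw)^g=v(w^{g_v})$ for all words $w$. For $H\le\mathrm{Aut}\,T$, $\mathrm{Stab}_H(n)$ is the subgroup of elements of $H$ fixing all vertices of length $n$. Let $a,b,c\in\mathrm{Aut}\,T$ be given by: $(jw)^a=(j+1 \bmod p)\,w$ for $j\in A$; $(jw)^b=j\,(w^{a^{\alpha_{j+1}}})$ for $0\le j\le p-2$ and $((p-1)w)^b=(p-1)(w^b)$; $(0w)^c=0(w^c)$ and $(jw)^c=j\,(w^{a^{\alpha_j}})$ for $1\le j\le p-1$. The $EGS$-group is $\Gamma=\Gamma_{\bar\alpha}=\langle a,b,c\rangle$. The vector $\bar\alpha$ is symmetric if $\alpha_i=\alpha_{p-i}$ for all $i=1,\dots,\frac{p-1}{2}$, and nonsymmetric otherwise. For $n\ge 1$, $\mathcal{H}_n$ is the subgroup of all $h\in\mathrm{Aut}\,T$ fixing every vertex of length $n$ with $h_v\in[\Gamma,\Gamma]$ for all $|v|=n$; it is a normal subgroup of finite index in $\Gamma$, contained in $\mathrm{Stab}_\Gamma(n)$. The profinite completion $\hat\Gamma$ is the projective limit of the groups $\Gamma/\mathcal{H}_n$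 (with natural projections), and the closure $\bar\Gamma$ of $\Gamma$ in $\mathrm{Aut}\,T$ (with its profinite topology, in which the level stabilizers form a base of neighbourhoods of the identity) is the projective limit of the groups $\Gamma/\mathrm{Stab}_\Gamma(n)$. The homomorphism $\sigma:\hat\Gamma\to\bar\Gamma$ is the unique one compatible with the natural projections $\Gamma/\mathcal{H}_n\to\Gamma/\mathrm{Stab}_\Gamma(n)$ for all $n$; that is, it sends $(g_n\mathcal{H}_n)_n$ to $(g_n\mathrm{Stab}_\Gamma(n))_n$. For $n\ge1$ let $\tilde{\mathbb{Z}}_p^{(n)}=\bigoplus_{|v|=n}\mathbb{Z}_p^{(v)}$, a direct sum of $p^n$ copies of the cyclic group $\mathbb{Z}_p$ of order $p$ indexed by the vertices of length $n$, with projections $\pi_v:\tilde{\mathbb{Z}}_p^{(n)}\to\mathbb{Z}_p^{(v)}=\mathbb{Z}_p$; $\tilde{\mathbb{Z}}_p^{(0)}$ is the trivial group. For $n\ge 2$, $\theta_n:\tilde{\mathbb{Z}}_p^{(n)}\to\tilde{\mathbb{Z}}_p^{(n-1)}$ is defined by $\pi_u(\theta_n(x))=\sum_{v\ge u,\,|v|=n}\pi_v(x)$ for every vertex $u$ of length $n-1$; $\theta_1$ is the trivial map $\tilde{\mathbb{Z}}_p^{(1)}\to\{0\}$. *)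

theory Defs
  imports
    "HOL-Algebra.Product_Groups"
    "HOL-Algebra.Generated_Groups"
    "HOL-Algebra.Bij"
    "HOL-Analysis.Function_Topology"
    "HOL-Analysis.T1_Spaces"
    "HOL-Computational_Algebra.Primes"
    "HOL-Library.Sublist"
begin

section \<open>The rooted tree and its automorphism group\<close>

definition words :: "nat \<Rightarrow> nat list set" where
  "words p = lists {..<p}"

definition level :: "nat \<Rightarrow> nat \<Rightarrow> nat list set" where
  "level p n = {v \<in> words p. length v = n}"

definition adjacent :: "nat list \<Rightarrow> nat list \<Rightarrow> bool" where
  "adjacent u v \<longleftrightarrow> (\<exists>x. v = u @ [x] \<or> u = v @ [x])"

text \<open>Automorphisms are extensional functions (undefined outside the tree). They act on the
  right, so the product of \<open>f\<close> and \<open>g\<close> is ``first \<open>f\<close>, then \<open>g\<close>''.\<close>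

definition AutT :: "nat \<Rightarrow> (nat list \<Rightarrow> nat list) monoid" where
  "AutT p =
    \<lparr>carrier = {f \<in> Bij (words p). f [] = [] \<and>
        (\<forall>u\<in>words p. \<forall>v\<in>words p. adjacent (f u) (f v) \<longleftrightarrow> adjacent u v)},
     monoid.mult = (\<lambda>f g. compose (words p) g f),
     one = (\<lambda>v\<in>words p. v)\<rparr>"

text \<open>The element \<open>h\<^sub>v\<close> with \<open>(vw)\<^sup>h = v(w\<^bsup>h\<^sub>v\<^esup>)\<close>; meaningful only if \<open>h\<close> fixes \<open>v\<close>.\<close>

definition section_at :: "nat \<Rightarrow> (nat list \<Rightarrow> nat list) \<Rightarrow> nat list \<Rightarrow> nat list \<Rightarrow> nat list" where
  "section_at p h v = (\<lambda>w\<in>words p. drop (length v) (h (v @ w)))"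

definition level_stab :: "nat \<Rightarrow> (nat list \<Rightarrow> nat list) set \<Rightarrow> nat \<Rightarrow> (nat list \<Rightarrow> nat list) set" where
  "level_stab p H n = {h \<in> H. \<forall>v\<in>level p n. h v = v}"


section \<open>EGS-groups\<close>

text \<open>A vector \<open>(\<alpha>\<^sub>1, \<dots>, \<alpha>\<^bsub>p-1\<^esub>)\<close> over \<open>GF(p)\<close> is given by representatives
  \<open>\<alpha> i \<in> {0, \<dots>, p - 1}\<close>; only the values at \<open>i = 1, \<dots>, p - 1\<close> are ever used.\<close>

definition GF_vector :: "nat \<Rightarrow> (nat \<Rightarrow> nat) \<Rightarrow> bool" where
  "GF_vector p \<alpha> \<longleftrightarrow> (\<forall>i\<in>{1..p-1}. \<alpha> i < p)"

definition symmetric_vector :: "nat \<Rightarrow> (nat \<Rightarrow> nat) \<Rightarrow> bool" where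
  "symmetric_vector p \<alpha> \<longleftrightarrow> (\<forall>i\<in>{1..(p-1) div 2}. \<alpha> i = \<alpha> (p - i))"

fun a_map :: "nat \<Rightarrow> nat list \<Rightarrow> nat list" where
  "a_map p [] = []"
| "a_map p (j # w) = ((j + 1) mod p) # w"

fun b_map :: "nat \<Rightarrow> (nat \<Rightarrow> nat) \<Rightarrow> nat list \<Rightarrow> nat list" where
  "b_map p \<alpha> [] = []"
| "b_map p \<alpha> (j # w) = j # (if j = p - 1 then b_map p \<alpha> w else (a_map p ^^ \<alpha> (j + 1)) w)"

fun c_map :: "nat \<Rightarrow> (nat \<Rightarrow> nat) \<Rightarrow> nat list \<Rightarrow> nat list" where
  "c_map p \<alpha> [] = []"
| "c_map p \<alpha> (j # w) = j # (if j = 0 then c_map p \<alpha> w else (a_map p ^^ \<alpha> j) w)"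

definition EGS :: "nat \<Rightarrow> (nat \<Rightarrow> nat) \<Rightarrow> (nat list \<Rightarrow> nat list) set" where
  "EGS p \<alpha> = generate (AutT p)
     {restrict (a_map p) (words p), restrict (b_map p \<alpha>) (words p), restrict (c_map p \<alpha>) (words p)}"

definition EGS_group :: "nat \<Rightarrow> (nat \<Rightarrow> nat) \<Rightarrow> (nat list \<Rightarrow> nat list) monoid" where
  "EGS_group p \<alpha> = (AutT p)\<lparr>carrier := EGS p \<alpha>\<rparr>"

definition H_sub :: "nat \<Rightarrow> (nat \<Rightarrow> nat) \<Rightarrow> nat \<Rightarrow> (nat list \<Rightarrow> nat list) set" where
  "H_sub p \<alpha> n = {h \<in> carrier (AutT p).
     \<forall>v\<in>level p n. h v = v \<and> section_at p h v \<in> derived (AutT p) (EGS p \<alpha>)}"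


section \<open>Projective limits of sequences of groups\<close>

text \<open>The limit of \<open>G m \<leftarrow> G (m+1) \<leftarrow> \<dots>\<close>, where \<open>\<phi> n : G n \<rightarrow> G (n - 1)\<close>.\<close>

definition proj_lim ::
  "nat \<Rightarrow> (nat \<Rightarrow> 'a monoid) \<Rightarrow> (nat \<Rightarrow> 'a \<Rightarrow> 'a) \<Rightarrow> (nat \<Rightarrow> 'a) monoid" where
  "proj_lim m G \<phi> = (product_group {m..} G)
     \<lparr>carrier := {x \<in> carrier (product_group {m..} G). \<forall>n\<ge>m. \<phi> (Suc n) (x (Suc n)) = x n}\<rparr>"

text \<open>The limit topology, for discrete \<open>G n\<close>.\<close>

definition proj_lim_topology ::
  "nat \<Rightarrow> (nat \<Rightarrow> 'a monoid) \<Rightarrow> (nat \<Rightarrow> 'a \<Rightarrow> 'a) \<Rightarrow> (nat \<Rightarrow> 'a) topology" where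
  "proj_lim_topology m G \<phi> =
     subtopology (product_topology (\<lambda>n. discrete_topology (carrier (G n))) {m..})
       (carrier (proj_lim m G \<phi>))"

text \<open>For normal subgroups \<open>M \<subseteq> N\<close> of \<open>G\<close>, the map \<open>coset_proj G N\<close> is the natural projection from
  \<open>G Mod M\<close> to \<open>G Mod N\<close>: the product set of \<open>N\<close> and the coset \<open>M g\<close> is the coset \<open>N g\<close>.\<close>

definition coset_proj :: "'a monoid \<Rightarrow> 'a set \<Rightarrow> 'a set \<Rightarrow> 'a set" where
  "coset_proj G N X = N <#>\<^bsub>G\<^esub> X"


section \<open>The profinite completion, the closure and the homomorphism between them\<close>

definition Gamma_hat :: "nat \<Rightarrow> (nat \<Rightarrow> nat) \<Rightarrow> (nat \<Rightarrow> (nat list \<Rightarrow> nat list) set) monoid" where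
  "Gamma_hat p \<alpha> = proj_lim 1 (\<lambda>n. EGS_group p \<alpha> Mod H_sub p \<alpha> n)
     (\<lambda>n. coset_proj (EGS_group p \<alpha>) (H_sub p \<alpha> (n - 1)))"

definition Gamma_hat_topology ::
  "nat \<Rightarrow> (nat \<Rightarrow> nat) \<Rightarrow> (nat \<Rightarrow> (nat list \<Rightarrow> nat list) set) topology" where
  "Gamma_hat_topology p \<alpha> = proj_lim_topology 1 (\<lambda>n. EGS_group p \<alpha> Mod H_sub p \<alpha> n)
     (\<lambda>n. coset_proj (EGS_group p \<alpha>) (H_sub p \<alpha> (n - 1)))"

definition Gamma_bar :: "nat \<Rightarrow> (nat \<Rightarrow> nat) \<Rightarrow> (nat \<Rightarrow> (nat list \<Rightarrow> nat list) set) monoid" where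
  "Gamma_bar p \<alpha> = proj_lim 1 (\<lambda>n. EGS_group p \<alpha> Mod level_stab p (EGS p \<alpha>) n)
     (\<lambda>n. coset_proj (EGS_group p \<alpha>) (level_stab p (EGS p \<alpha>) (n - 1)))"

definition sigma :: "nat \<Rightarrow> (nat \<Rightarrow> nat) \<Rightarrow>
    (nat \<Rightarrow> (nat list \<Rightarrow> nat list) set) \<Rightarrow> (nat \<Rightarrow> (nat list \<Rightarrow> nat list) set)" where
  "sigma p \<alpha> x = (\<lambda>n\<in>{1..}. coset_proj (EGS_group p \<alpha>) (level_stab p (EGS p \<alpha>) n) (x n))"

definition Ker_sigma :: "nat \<Rightarrow> (nat \<Rightarrow> nat) \<Rightarrow> (nat \<Rightarrow> (nat list \<Rightarrow> nat list) set) monoid" where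
  "Ker_sigma p \<alpha> = (Gamma_hat p \<alpha>)
     \<lparr>carrier := kernel (Gamma_hat p \<alpha>) (Gamma_bar p \<alpha>) (sigma p \<alpha>)\<rparr>"

definition Ker_sigma_topology ::
  "nat \<Rightarrow> (nat \<Rightarrow> nat) \<Rightarrow> (nat \<Rightarrow> (nat list \<Rightarrow> nat list) set) topology" where
  "Ker_sigma_topology p \<alpha> = subtopology (Gamma_hat_topology p \<alpha>) (carrier (Ker_sigma p \<alpha>))"


section \<open>The inverse system of direct sums\<close>

text \<open>For \<open>n = 0\<close> the index set of the direct sum is empty rather than \<open>{[]}\<close>, making the group trivial.\<close>

definition Ztilde :: "nat \<Rightarrow> nat \<Rightarrow> (nat list \<Rightarrow> int) monoid" where
  "Ztilde p n = sum_group (if n = 0 then {} else level p n) (\<lambda>v. integer_mod_group p)"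

text \<open>\<open>theta p n\<close> maps \<open>Ztilde p n\<close> to \<open>Ztilde p (n - 1)\<close>.\<close>

definition theta :: "nat \<Rightarrow> nat \<Rightarrow> (nat list \<Rightarrow> int) \<Rightarrow> (nat list \<Rightarrow> int)" where
  "theta p n x =
     (if n \<le> 1 then \<one>\<^bsub>Ztilde p 0\<^esub>
      else (\<lambda>u\<in>level p (n - 1). (\<Sum>v\<in>{v \<in> level p n. prefix u v}. x v) mod int p))"

definition Ztilde_inf :: "nat \<Rightarrow> (nat \<Rightarrow> nat list \<Rightarrow> int) monoid" where
  "Ztilde_inf p = proj_lim 0 (Ztilde p) (theta p)"

definition Ztilde_inf_topology :: "nat \<Rightarrow> (nat \<Rightarrow> nat list \<Rightarrow> int) topology" where
  "Ztilde_inf_topology p = proj_lim_topology 0 (Ztilde p) (theta p)"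


section \<open>Profinite groups and exponents\<close>

definition topological_group :: "('a, 'b) monoid_scheme \<Rightarrow> 'a topology \<Rightarrow> bool" where
  "topological_group G X \<longleftrightarrow> group G \<and> topspace X = carrier G \<and>
     continuous_map (prod_topology X X) X (\<lambda>(x, y). x \<otimes>\<^bsub>G\<^esub> y) \<and>
     continuous_map X X (\<lambda>x. inv\<^bsub>G\<^esub> x)"

definition totally_disconnected :: "'a topology \<Rightarrow> bool" where
  "totally_disconnected X \<longleftrightarrow> (\<forall>S. connectedin X S \<longrightarrow> (\<exists>a. S \<subseteq> {a}))"

definition profinite_group :: "('a, 'b) monoid_scheme \<Rightarrow> 'a topology \<Rightarrow> bool" where
  "profinite_group G X \<longleftrightarrow> topological_group G X \<and>
     compact_space X \<and> Hausdorff_space X \<and> totally_disconnected X"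

definition topological_group_iso ::
  "('a, 'c) monoid_scheme \<Rightarrow> 'a topology \<Rightarrow> ('b, 'd) monoid_scheme \<Rightarrow> 'b topology \<Rightarrow> ('a \<Rightarrow> 'b) \<Rightarrow> bool" where
  "topological_group_iso G X H Y f \<longleftrightarrow> f \<in> iso G H \<and> homeomorphic_map X Y f"

definition has_exponent :: "('a, 'b) monoid_scheme \<Rightarrow> nat \<Rightarrow> bool" where
  "has_exponent G k \<longleftrightarrow> 0 < k \<and> (\<forall>x\<in>carrier G. x [^]\<^bsub>G\<^esub> k = \<one>\<^bsub>G\<^esub>) \<and>
     (\<forall>m. 0 < m \<and> (\<forall>x\<in>carrier G. x [^]\<^bsub>G\<^esub> m = \<one>\<^bsub>G\<^esub>) \<longrightarrow> k \<le> m)"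

end

theory Submission
  imports Defs "HOL-Number_Theory.Residues"
begin

text \<open>
Write \<open>\<Gamma>\<close> for the group and \<open>St(n)\<close> for the stabilizer of level \<open>n\<close>. A point of the kernel of \<open>\<sigma>\<close> is a
  coherent sequence of cosets \<open>H\<^sub>n g\<^sub>n\<close> with \<open>g\<^sub>n \<in> St(n)\<close>, and such a coset is determined by the classes of
  the sections of \<open>g\<^sub>n\<close> at the vertices of level \<open>n\<close> in \<open>\<Gamma>/[\<Gamma>,\<Gamma>]\<close>. So the theorem is a statement about
  these classes.

  The abelianization is \<open>(\<int>/p)\<^sup>3\<close>, with the exponents of \<open>a\<close>, \<open>b\<close>, \<open>c\<close> as coordinates
  (\<open>trivial_word_dvd\<close>, \<open>derived_eq\<close>). Passing to the next level adds up the \<open>b\<close>-exponents and the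
  \<open>c\<close>-exponents, while the \<open>a\<close>-exponents of the new sections are the convolution of the vector
  \<open>(0, \<alpha>\<^sub>1, \<dots>, \<alpha>\<^bsub>p-1\<^esub>)\<close> with the sums of \<open>b\<close>- and \<open>c\<close>-exponents. An element of \<open>St(n+2)\<close> therefore has,
  at each vertex of level \<open>n\<close>, a section with \<open>a\<close>-exponent \<open>0\<close> whose children have \<open>a\<close>-exponent \<open>0\<close>
  as well; a vector killed by convolution with a nonzero vector has coordinate sum \<open>0\<close>
  (\<open>circulant_kernel_sum_zero\<close>), so the section also has opposite \<open>b\<close>- and \<open>c\<close>-exponents: it is
  balanced (\<open>balanced_of_two_levels\<close>). Every coset of a coherent sequence has representatives in
  arbitrarily deep stabilizers, so only the \<open>b\<close>-exponents \<open>y\<^sub>v\<close> survive in the limit, and the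
  additivity \<open>y\<^sub>u = \<Sum> y\<^bsub>uj\<^esub>\<close> is the compatibility condition imposed by \<open>\<theta>\<close>.

  Conversely every compatible family \<open>y\<close> must be realized in \<open>\<Gamma>\<close>. It is enough that
  \<open>(g, 1, \<dots>, 1) \<in> \<Gamma>\<close> for every balanced \<open>g\<close>; call the \<open>g \<in> \<Gamma>\<close> with this property rigid. They form a
  normal subgroup that contains \<open>b c\<^sup>-\<^sup>1\<close>, because \<open>b\<^sup>a c\<^sup>-\<^sup>1 = (b c\<^sup>-\<^sup>1, 1, \<dots>, 1)\<close>. What is left is
  \<open>[\<Gamma>,\<Gamma>]\<close>, and here the asymmetry of \<open>\<alpha>\<close> enters. In the quotient \<open>Q\<close> of \<open>\<Gamma>\<close> by the rigid elements the
  tuples of sections of \<open>St(1)\<close> form a shift-invariant group in which no nontrivial tuple is supported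
  at a single place; if \<open>\<alpha>\<^sub>i \<noteq> \<alpha>\<^bsub>p-i\<^esub>\<close>, this rigidity forces the images of \<open>a\<close> and \<open>b\<close> to commute
  (\<open>generators_commute\<close>), so that \<open>Q\<close> is abelian.

  The resulting bijection from the limit of the direct sums to the kernel (\<open>thread\<close>) and its inverse act
  coordinate by coordinate on discrete spaces. Hence it is a homeomorphism, and it carries over the
  group structure, compactness, commutativity and the exponent.
\<close>

section \<open>Congruences modulo a prime\<close>

lemma diff_funpow_expansion:
  fixes f :: "int \<Rightarrow> int"
  shows "((\<lambda>f x. f (x + 1) - f x) ^^ n) f x
    = (\<Sum>k\<le>n. (-1) ^ (n + k) * int (n choose k) * f (x + int k))"
proof (induction n arbitrary: x)
  case 0
  show ?case by simp
next
  case (Suc n)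
  have shifted: "(\<Sum>k\<le>n. (-1) ^ (n + k) * int (n choose k) * f (x + 1 + int k))
      = (\<Sum>k\<le>n. (-1) ^ (n + k) * int (n choose k) * f (x + int (Suc k)))"
    by (simp add: algebra_simps)
  have "(\<Sum>k\<le>Suc n. (-1) ^ (n + k) * int (n choose k) * f (x + int k))
      = (-1) ^ n * f x + (\<Sum>k\<le>n. (-1) ^ (n + Suc k) * int (n choose Suc k) * f (x + int (Suc k)))"
    by (subst sum.atMost_Suc_shift) simp
  then have low: "(\<Sum>k\<le>n. (-1) ^ (n + k) * int (n choose k) * f (x + int k))
      = (-1) ^ n * f x + (\<Sum>k\<le>n. (-1) ^ (n + Suc k) * int (n choose Suc k) * f (x + int (Suc k)))"
    by (simp add: binomial_eq_0)
  have "(\<Sum>k\<le>Suc n. (-1) ^ (Suc n + k) * int (Suc n choose k) * f (x + int k))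
      = (-1) ^ Suc n * f x
        + (\<Sum>k\<le>n. (-1) ^ (Suc n + Suc k) * int (Suc n choose Suc k) * f (x + int (Suc k)))"
    by (subst sum.atMost_Suc_shift) simp
  also have "(\<Sum>k\<le>n. (-1) ^ (Suc n + Suc k) * int (Suc n choose Suc k) * f (x + int (Suc k)))
      = (\<Sum>k\<le>n. (-1) ^ (n + k) * int (n choose k) * f (x + int (Suc k)))
        - (\<Sum>k\<le>n. (-1) ^ (n + Suc k) * int (n choose Suc k) * f (x + int (Suc k)))"
    unfolding sum_subtractf[symmetric] by (rule sum.cong) (simp_all add: algebra_simps)
  finally show ?case
    using Suc.IH[of "x + 1"] Suc.IH[of x] shifted low by simp
qed

text \<open>Vectors that a nonzero circulant matrix over \<open>\<int>/p\<close> kills have coordinate sum zero. On functions of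
  period \<open>p\<close> the difference operator is nilpotent modulo \<open>p\<close>, so some iterated difference of \<open>f\<close> is a nonzero
  constant; applying the same iterate to the convolution turns it into that constant times the sum.\<close>

lemma circulant_kernel_sum_zero:
  fixes f :: "int \<Rightarrow> int" and w :: "'i \<Rightarrow> int" and g :: "'i \<Rightarrow> int"
  assumes p: "prime p"
    and per: "\<And>x. f (x + int p) = f x"
    and nz: "\<not> int p dvd f x0"
    and conv: "\<And>j. int p dvd (\<Sum>i\<in>I. w i * f (j - g i))"
  shows "int p dvd (\<Sum>i\<in>I. w i)"
proof -
  define D where "D = (\<lambda>(f::int \<Rightarrow> int) x. f (x + 1) - f x)"
  have expand: "(D ^^ n) f x = (\<Sum>k\<le>n. (-1) ^ (n + k) * int (n choose k) * f (x + int k))"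
    for n x unfolding D_def by (rule diff_funpow_expansion)
  have Dp: "int p dvd (D ^^ p) f x" for x
  proof -
    have "(D ^^ p) f x = (\<Sum>k\<in>{..p} - {0, p}. (-1) ^ (p + k) * int (p choose k) * f (x + int k))
        + (\<Sum>k\<in>{0, p}. (-1) ^ (p + k) * int (p choose k) * f (x + int k))"
      unfolding expand by (rule sum.subset_diff) auto
    moreover have "int p dvd (\<Sum>k\<in>{..p} - {0, p}. (-1) ^ (p + k) * int (p choose k) * f (x + int k))"
    proof (rule dvd_sum)
      fix k assume k: "k \<in> {..p} - {0, p}"
      then have "p dvd (p choose k)"
        using p by (intro dvd_choose_prime) auto
      then show "int p dvd (-1) ^ (p + k) * int (p choose k) * f (x + int k)"
        by (simp add: dvd_mult dvd_mult2)
    qed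
    moreover have "int p dvd (\<Sum>k\<in>{0, p}. (-1) ^ (p + k) * int (p choose k) * f (x + int k))"
    proof -
      have "0 \<noteq> p" using p by auto
      then have eq: "(\<Sum>k\<in>{0, p}. (-1) ^ (p + k) * int (p choose k) * f (x + int k))
          = ((-1) ^ p + 1) * f x"
        by (simp add: per algebra_simps flip: power_add mult_2)
      show ?thesis
      proof (cases "p = 2")
        case True
        then show ?thesis unfolding eq by simp
      next
        case False
        then have "odd p" using p primes_dvd_imp_eq two_is_prime_nat by blast
        then show ?thesis unfolding eq by simp
      qed
    qed
    ultimately show ?thesis by simp
  qed
  define t where "t = (LEAST n. \<forall>x. int p dvd (D ^^ n) f x)"
  have t: "\<forall>x. int p dvd (D ^^ t) f x"
    unfolding t_def by (rule LeastI[of _ p]) (use Dp in blast)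
  have "t \<noteq> 0"
    using t nz by (cases "t = 0") auto
  then obtain s where s: "t = Suc s" by (cases t) auto
  \<comment> \<open>The last nonvanishing difference of \<open>f\<close> is a nonzero constant modulo \<open>p\<close>.\<close>
  define h where "h = (D ^^ s) f"
  have "\<not> (\<forall>x. int p dvd h x)"
    unfolding h_def using not_less_Least[of s "\<lambda>n. \<forall>x. int p dvd (D ^^ n) f x"] s t_def by auto
  then obtain y where y: "\<not> int p dvd h y" by blast
  have step: "[h (x + 1) = h x] (mod int p)" for x
    using t s unfolding cong_iff_dvd_diff h_def by (simp add: D_def)
  have up: "[h (x + int n) = h x] (mod int p)" for x n
  proof (induction n)
    case 0 show ?case by simp
  next
    case (Suc n)
    have "[h (x + int n + 1) = h x] (mod int p)"
      using step Suc.IH by (rule cong_trans)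
    then show ?case by (simp add: algebra_simps)
  qed
  have const: "[h x = h y] (mod int p)" for x
  proof (cases "x \<le> y")
    case True
    then have "[h (x + int (nat (y - x))) = h x] (mod int p)" by (intro up)
    then show ?thesis using True by (simp add: cong_sym_eq)
  next
    case False
    then have "[h (y + int (nat (x - y))) = h y] (mod int p)" by (intro up)
    then show ?thesis using False by simp
  qed
  have lin: "int p dvd (\<Sum>i\<in>I. w i * (D ^^ n) f (j - g i))" for n j
  proof (induction n arbitrary: j)
    case 0 show ?case using conv by simp
  next
    case (Suc n)
    have "(\<Sum>i\<in>I. w i * (D ^^ Suc n) f (j - g i))
        = (\<Sum>i\<in>I. w i * (D ^^ n) f (j + 1 - g i)) - (\<Sum>i\<in>I. w i * (D ^^ n) f (j - g i))"
      unfolding sum_subtractf[symmetric]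
      by (rule sum.cong) (simp_all add: D_def algebra_simps)
    then show ?case using Suc.IH by simp
  qed
  have "[(\<Sum>i\<in>I. w i * h (0 - g i)) = (\<Sum>i\<in>I. w i * h y)] (mod int p)"
    by (intro cong_sum cong_mult cong_refl const)
  then have "int p dvd (\<Sum>i\<in>I. w i) * h y"
    using lin[where n = s and j = 0] cong_dvd_iff unfolding h_def[symmetric] sum_distrib_right by blast
  moreover have "prime (int p)" using p by simp
  ultimately show ?thesis using y prime_dvd_mult_iff by blast
qed

lemma fermat_int:
  fixes x :: int
  assumes "prime p"
  shows "[x ^ p = x] (mod int p)"
proof (cases "int p dvd x")
  case True
  then have "int p dvd x ^ p" using assms prime_gt_0_nat[OF assms] dvd_power_le[of "int p" x 1 p]
    by (metis dvd_power dvd_trans)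
  then show ?thesis using True by (simp add: cong_iff_dvd_diff)
next
  case False
  have "coprime x (int p)"
    using False assms by (metis coprime_commute prime_imp_coprime prime_nat_int_transfer)
  then have "[x ^ totient p = 1] (mod int p)"
    using residues.euler_theorem[of "int p" x] prime_gt_1_nat[OF assms] by (simp add: residues_def)
  then have "[x * x ^ (p - 1) = x * 1] (mod int p)"
    using assms by (intro cong_mult cong_refl) (simp add: totient_prime)
  then show ?thesis
    using prime_gt_0_nat[OF assms] by (metis mult.right_neutral power_eq_if less_irrefl)
qed

section \<open>Commutators and generators\<close>

abbreviation comm_of :: "('a, 'b) monoid_scheme \<Rightarrow> 'a \<Rightarrow> 'a \<Rightarrow> 'a" where
  "comm_of G x y \<equiv> x \<otimes>\<^bsub>G\<^esub> y \<otimes>\<^bsub>G\<^esub> inv\<^bsub>G\<^esub> x \<otimes>\<^bsub>G\<^esub> inv\<^bsub>G\<^esub> y"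

context group
begin

lemma comm_of_eq_one_iff:
  assumes "x \<in> carrier G" "y \<in> carrier G"
  shows "comm_of G x y = \<one> \<longleftrightarrow> x \<otimes> y = y \<otimes> x"
proof -
  have "comm_of G x y = \<one> \<longleftrightarrow> x \<otimes> y \<otimes> inv x = \<one> \<otimes> y"
    using assms inv_solve_right[of \<one> "x \<otimes> y \<otimes> inv x" y] by auto
  also have "\<dots> \<longleftrightarrow> x \<otimes> y = y \<otimes> x"
    using assms inv_solve_right[of y "x \<otimes> y" x] by auto
  finally show ?thesis .
qed

lemma centralizer_subgroup:
  assumes "A \<subseteq> carrier G"
  shows "subgroup {x \<in> carrier G. \<forall>y\<in>A. x \<otimes> y = y \<otimes> x} G"
proof (rule subgroupI)
  show "{x \<in> carrier G. \<forall>y\<in>A. x \<otimes> y = y \<otimes> x} \<noteq> {}"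
    using assms by (auto intro!: exI[of _ \<one>])
next
  fix x assume x: "x \<in> {x \<in> carrier G. \<forall>y\<in>A. x \<otimes> y = y \<otimes> x}"
  have "inv x \<otimes> y = y \<otimes> inv x" if "y \<in> A" for y
  proof -
    have xy: "x \<in> carrier G" "y \<in> carrier G" "x \<otimes> y = y \<otimes> x" using x that assms by auto
    then have "y = inv x \<otimes> (y \<otimes> x)" using inv_solve_left[of y x "y \<otimes> x"] by auto
    then show ?thesis using xy inv_solve_right[of "inv x \<otimes> y" y x] by (simp add: m_assoc)
  qed
  then show "inv x \<in> {x \<in> carrier G. \<forall>y\<in>A. x \<otimes> y = y \<otimes> x}" using x by auto
next
  fix x z assume xz: "x \<in> {x \<in> carrier G. \<forall>y\<in>A. x \<otimes> y = y \<otimes> x}"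
    "z \<in> {x \<in> carrier G. \<forall>y\<in>A. x \<otimes> y = y \<otimes> x}"
  have "x \<otimes> z \<otimes> y = y \<otimes> (x \<otimes> z)" if "y \<in> A" for y
  proof -
    have "y \<in> carrier G" using that assms by auto
    then show ?thesis using xz that by simp (metis m_assoc)
  qed
  then show "x \<otimes> z \<in> {x \<in> carrier G. \<forall>y\<in>A. x \<otimes> y = y \<otimes> x}" using xz by auto
qed auto

lemma generators_commute_imp_commute:
  assumes "generate G {a, b} = carrier G" "a \<in> carrier G" "b \<in> carrier G" "a \<otimes> b = b \<otimes> a"
    and "x \<in> carrier G" "y \<in> carrier G"
  shows "x \<otimes> y = y \<otimes> x"
proof -
  have 1: "carrier G \<subseteq> {x \<in> carrier G. \<forall>y\<in>{a, b}. x \<otimes> y = y \<otimes> x}"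
    unfolding assms(1)[symmetric]
    by (rule generate_subgroup_incl)
      (use assms centralizer_subgroup[of "{a, b}"] in auto)
  have "carrier G \<subseteq> {x \<in> carrier G. \<forall>y\<in>carrier G. x \<otimes> y = y \<otimes> x}"
    using generate_subgroup_incl[of "{a, b}" "{x \<in> carrier G. \<forall>y\<in>carrier G. x \<otimes> y = y \<otimes> x}"]
      centralizer_subgroup[of "carrier G"] assms(1-3) 1 by fastforce
  then show ?thesis using assms(5,6) by auto
qed

text \<open>Membership of a commutator in a normal subgroup expresses commutation in the quotient; this moves
  between generators of the quotient and the derived subgroup.\<close>

lemma comm_of_mem_normal_iff:
  assumes K: "K \<lhd> G" and xy: "x \<in> carrier G" "y \<in> carrier G"
  shows "comm_of G x y \<in> K \<longleftrightarrow> (K #> x) \<otimes>\<^bsub>G Mod K\<^esub> (K #> y) = (K #> y) \<otimes>\<^bsub>G Mod K\<^esub> (K #> x)"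
proof -
  interpret K: normal K G by fact
  interpret Q: group "G Mod K" by (rule K.factorgroup_is_group)
  interpret h: group_hom G "G Mod K" "(#>) K"
    by (simp add: group_hom_def group_hom_axioms_def is_group Q.is_group K.r_coset_hom_Mod)
  have cl: "comm_of G x y \<in> carrier G" using xy by simp
  have "comm_of G x y \<in> K \<longleftrightarrow> K #> comm_of G x y = K"
  proof
    show "comm_of G x y \<in> K \<Longrightarrow> K #> comm_of G x y = K" by (rule K.rcos_const[OF is_group])
    show "K #> comm_of G x y = K \<Longrightarrow> comm_of G x y \<in> K"
      by (rule coset_join1[OF _ cl K.is_subgroup])
  qed
  also have "\<dots> \<longleftrightarrow> comm_of (G Mod K) (K #> x) (K #> y) = \<one>\<^bsub>G Mod K\<^esub>"
    using xy by (simp only: h.hom_mult[symmetric] h.hom_inv[symmetric] m_closed inv_closed one_FactGroup)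
  also have "\<dots> \<longleftrightarrow> (K #> x) \<otimes>\<^bsub>G Mod K\<^esub> (K #> y) = (K #> y) \<otimes>\<^bsub>G Mod K\<^esub> (K #> x)"
    using xy by (intro Q.comm_of_eq_one_iff) auto
  finally show ?thesis .
qed

lemma derived_subset_of_quotient_commute:
  assumes K: "K \<lhd> G"
    and comm: "\<And>x y. x \<in> carrier G \<Longrightarrow> y \<in> carrier G \<Longrightarrow>
      (K #> x) \<otimes>\<^bsub>G Mod K\<^esub> (K #> y) = (K #> y) \<otimes>\<^bsub>G Mod K\<^esub> (K #> x)"
  shows "derived G (carrier G) \<subseteq> K"
proof -
  have "derived_set G (carrier G) \<subseteq> K"
    using comm comm_of_mem_normal_iff[OF K] by blast
  then show ?thesis
    unfolding derived_def by (rule generate_subgroup_incl) (rule normal_imp_subgroup[OF K])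
qed

lemma derived_subset_normal:
  assumes K: "K \<lhd> G" and gen: "generate G {a, b} = carrier G"
    and ab: "a \<in> carrier G" "b \<in> carrier G" and c: "comm_of G a b \<in> K"
  shows "derived G (carrier G) \<subseteq> K"
proof (rule derived_subset_of_quotient_commute[OF K])
  interpret K: normal K G by fact
  interpret Q: group "G Mod K" by (rule K.factorgroup_is_group)
  interpret h: group_hom G "G Mod K" "(#>) K"
    by (simp add: group_hom_def group_hom_axioms_def is_group Q.is_group K.r_coset_hom_Mod)
  have surj: "carrier (G Mod K) = (#>) K ` carrier G"
    unfolding FactGroup_def RCOSETS_def by auto
  have gen': "generate (G Mod K) {K #> a, K #> b} = carrier (G Mod K)"
    using h.generate_img[of "{a, b}"] ab unfolding surj gen by simp
  fix x y assume "x \<in> carrier G" "y \<in> carrier G"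
  then show "(K #> x) \<otimes>\<^bsub>G Mod K\<^esub> (K #> y) = (K #> y) \<otimes>\<^bsub>G Mod K\<^esub> (K #> x)"
    by (intro Q.generators_commute_imp_commute[OF gen' _ _ iffD1[OF comm_of_mem_normal_iff[OF K ab] c]]
      h.hom_closed ab)
qed

lemma int_pow_cong:
  assumes "x \<in> carrier G" "x [^] n = \<one>" "[i = j] (mod int n)"
  shows "x [^] i = x [^] j"
proof -
  obtain k where "i = j + int n * k" using assms(3) by (metis cong_iff_lin cong_sym)
  then show ?thesis
    using assms(1,2) by (simp add: int_pow_mult flip: int_pow_pow) (simp add: int_pow_int)
qed

lemma mem_of_power_mem:
  assumes "subgroup H G" "x \<in> carrier G" "x [^] p = \<one>" "prime p" "x [^] (i::int) \<in> H" "\<not> int p dvd i"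
  shows "x \<in> H"
proof -
  have "coprime i (int p)"
    using assms(4,6) by (metis coprime_commute prime_imp_coprime prime_nat_int_transfer)
  then obtain j where j: "[i * j = 1] (mod int p)" using cong_solve_coprime_int by blast
  have "(x [^] i) [^] j \<in> H"
    using subgroup_int_pow_closed[OF assms(1,5)] .
  then have "x [^] (i * j) \<in> H" by (simp only: int_pow_pow[OF assms(2)])
  then show ?thesis using int_pow_cong[OF assms(2,3) j] int_pow_1[OF assms(2)] by (simp only:)
qed

end

section \<open>Shift-invariant families of tuples\<close>

text \<open>The setting abstracts the quotient of the group by its rigid elements. The tuples are indexed by the
  integers and \<open>p\<close>-periodic rather than indexed by \<open>\<int>/p\<close>, so that rotation is translation of the argument.\<close>

locale shift_invariant_tuples = group G for G (structure) +
  fixes p :: nat and S :: "(int \<Rightarrow> 'a) set" and a b :: 'a and al :: "int \<Rightarrow> int"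
  assumes p: "prime p" "3 \<le> p"
    and a [simp]: "a \<in> carrier G" and b [simp]: "b \<in> carrier G"
    and gen: "generate G {a, b} = carrier G"
    and a_pow_p: "a [^] p = \<one>"
    and S_carrier [simp]: "\<And>t k. t \<in> S \<Longrightarrow> t k \<in> carrier G"
    and S_periodic: "\<And>t k l. t \<in> S \<Longrightarrow> [k = l] (mod int p) \<Longrightarrow> t k = t l"
    and S_mult: "\<And>s t. s \<in> S \<Longrightarrow> t \<in> S \<Longrightarrow> (\<lambda>k. s k \<otimes> t k) \<in> S"
    and S_inv: "\<And>t. t \<in> S \<Longrightarrow> (\<lambda>k. inv (t k)) \<in> S"
    and S_shift: "\<And>t m. t \<in> S \<Longrightarrow> (\<lambda>k. t (k + m)) \<in> S"
    and base: "(\<lambda>k. if int p dvd k then b else a [^] al k) \<in> S"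
    and isolated: "\<And>t. t \<in> S \<Longrightarrow> (\<And>k. \<not> int p dvd k \<Longrightarrow> t k = \<one>) \<Longrightarrow> t 0 = \<one>"
    and nonsym: "\<not> [al 1 = al (-1)] (mod int p)"
begin

lemma not_dvd_small: "0 < k \<Longrightarrow> k < int p \<Longrightarrow> \<not> int p dvd k"
  using zdvd_not_zless by blast

lemma p_not_dvd_small [simp]: "\<not> int p dvd 1" "\<not> int p dvd -1" "\<not> int p dvd 2" "\<not> int p dvd -2"
  using not_dvd_small[of 1] not_dvd_small[of 2] p(2) by auto

lemma p_neq_one [simp]: "p \<noteq> Suc 0"
  using p by auto

lemma prime_int [simp]: "prime (int p)"
  using p by simp

lemmas p_dvd_mult_iff = prime_dvd_mult_iff[OF prime_int]

lemma S_one: "(\<lambda>k. \<one>) \<in> S"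
  using S_mult[OF base S_inv[OF base]] by (auto simp: fun_eq_iff cong: if_cong elim!: back_subst[of "\<lambda>t. t \<in> S"])

lemma S_nat_pow: "t \<in> S \<Longrightarrow> (\<lambda>k. t k [^] (n::nat)) \<in> S"
proof (induction n)
  case 0 then show ?case using S_one by simp
next
  case (Suc n) then show ?case using S_mult[of "\<lambda>k. t k [^] n" t] by simp
qed

lemma S_int_pow:
  assumes "t \<in> S" shows "(\<lambda>k. t k [^] (n::int)) \<in> S"
proof (cases "n \<ge> 0")
  case True
  then obtain m where "n = int m" using nonneg_int_cases by blast
  then show ?thesis using S_nat_pow[OF assms] by (simp add: int_pow_int)
next
  case False
  then have "n = - int (nat (- n))" by simp
  then obtain m where "n = - int m" by blast
  then show ?thesis using S_inv[OF S_nat_pow[OF assms]] assms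
    by (simp add: int_pow_neg int_pow_int)
qed

definition gen_tuple :: "int \<Rightarrow> int \<Rightarrow> 'a" where
  "gen_tuple m = (\<lambda>k. if int p dvd k - m then b else a [^] al (k - m))"

lemma gen_tuple_in_S: "gen_tuple m \<in> S"
  using S_shift[OF base, of "- m"] unfolding gen_tuple_def by (simp only: add_uminus_conv_diff)

lemma gen_tuple_values:
  "gen_tuple m m = b"
  "\<not> int p dvd k - m \<Longrightarrow> gen_tuple m k = a [^] al (k - m)"
  by (simp_all add: gen_tuple_def)

text \<open>As no tuple is supported at a single place, this relation is the graph of an injective partial
  homomorphism.\<close>

definition joined :: "'a \<Rightarrow> 'a \<Rightarrow> bool" where
  "joined g h \<longleftrightarrow> g \<in> carrier G \<and> h \<in> carrier G \<and>
     (\<lambda>k. if int p dvd k then g else if int p dvd k - 1 then h else \<one>) \<in> S"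

lemma dvd_distinct: "int p dvd k \<Longrightarrow> \<not> int p dvd k - 1"
  using dvd_diff[of "int p" k "k - 1"] p_not_dvd_small(1) by auto

lemma joinedI:
  assumes "t \<in> S" "\<And>k. \<not> int p dvd k \<Longrightarrow> \<not> int p dvd k - 1 \<Longrightarrow> t k = \<one>"
  shows "joined (t 0) (t 1)"
proof -
  have "(\<lambda>k. if int p dvd k then t 0 else if int p dvd k - 1 then t 1 else \<one>) = t"
  proof
    fix k
    show "(if int p dvd k then t 0 else if int p dvd k - 1 then t 1 else \<one>) = t k"
      using assms(2) S_periodic[OF assms(1), of k 0] S_periodic[OF assms(1), of k 1]
      by (auto simp: cong_iff_dvd_diff)
  qed
  then show ?thesis using assms unfolding joined_def by simp
qed

lemma joinedE:
  assumes "joined g h"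
  obtains t where "t \<in> S" "t 0 = g" "t 1 = h"
    "\<And>k. int p dvd k \<Longrightarrow> t k = g" "\<And>k. int p dvd k - 1 \<Longrightarrow> t k = h"
    "\<And>k. \<not> int p dvd k \<Longrightarrow> \<not> int p dvd k - 1 \<Longrightarrow> t k = \<one>"
    "g \<in> carrier G" "h \<in> carrier G"
proof (rule that)
  show "(\<lambda>k. if int p dvd k then g else if int p dvd k - 1 then h else \<one>) \<in> S"
    using assms unfolding joined_def by blast
qed (use assms dvd_distinct in \<open>auto simp: joined_def\<close>)

lemma joined_one: "joined \<one> \<one>"
  using joinedI[OF S_one] by simp

lemma joined_mult:
  assumes "joined g h" "joined g' h'" shows "joined (g \<otimes> g') (h \<otimes> h')"
proof -
  obtain t where t: "t \<in> S" "t 0 = g" "t 1 = h"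
    "\<And>k. \<not> int p dvd k \<Longrightarrow> \<not> int p dvd k - 1 \<Longrightarrow> t k = \<one>" using joinedE[OF assms(1)] by metis
  obtain s where s: "s \<in> S" "s 0 = g'" "s 1 = h'"
    "\<And>k. \<not> int p dvd k \<Longrightarrow> \<not> int p dvd k - 1 \<Longrightarrow> s k = \<one>" using joinedE[OF assms(2)] by metis
  show ?thesis using joinedI[OF S_mult[OF t(1) s(1)]] t s by simp
qed

lemma joined_inv:
  assumes "joined g h" shows "joined (inv g) (inv h)"
proof -
  obtain t where t: "t \<in> S" "t 0 = g" "t 1 = h"
    "\<And>k. \<not> int p dvd k \<Longrightarrow> \<not> int p dvd k - 1 \<Longrightarrow> t k = \<one>" using joinedE[OF assms(1)] by metis
  show ?thesis using joinedI[OF S_inv[OF t(1)]] t by simp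
qed

lemma joined_conj:
  assumes "joined g h" "s \<in> S"
  shows "joined (s 0 \<otimes> g \<otimes> inv (s 0)) (s 1 \<otimes> h \<otimes> inv (s 1))"
proof -
  obtain t where t: "t \<in> S" "t 0 = g" "t 1 = h"
    "\<And>k. \<not> int p dvd k \<Longrightarrow> \<not> int p dvd k - 1 \<Longrightarrow> t k = \<one>" using joinedE[OF assms(1)] by metis
  have "(\<lambda>k. s k \<otimes> t k \<otimes> inv (s k)) \<in> S" using assms t by (intro S_mult S_inv)
  then show ?thesis using joinedI[of "\<lambda>k. s k \<otimes> t k \<otimes> inv (s k)"] t assms(2) by simp
qed

lemma joined_one_right: assumes "joined g \<one>" shows "g = \<one>"
proof -
  obtain t where t: "t \<in> S" "t 0 = g" "\<And>k. int p dvd k - 1 \<Longrightarrow> t k = \<one>"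
    "\<And>k. \<not> int p dvd k \<Longrightarrow> \<not> int p dvd k - 1 \<Longrightarrow> t k = \<one>" using joinedE[OF assms] by metis
  show ?thesis using isolated[OF t(1)] t by blast
qed

lemma joined_one_left:
  assumes "joined \<one> h" shows "h = \<one>"
proof -
  obtain t where t: "t \<in> S" "t 1 = h" "\<And>k. int p dvd k \<Longrightarrow> t k = \<one>"
    "\<And>k. \<not> int p dvd k \<Longrightarrow> \<not> int p dvd k - 1 \<Longrightarrow> t k = \<one>" using joinedE[OF assms] by metis
  have "t (k + 1) = \<one>" if "\<not> int p dvd k" for k
    using t(3,4)[of "k + 1"] that by (cases "int p dvd k + 1") auto
  then show ?thesis using isolated[OF S_shift[OF t(1), of 1]] t(2) by simp
qed

lemma one_al_unit: "\<not> int p dvd al 1 \<or> \<not> int p dvd al (-1)"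
  using nonsym by (auto simp: cong_iff_dvd_diff)

text \<open>One of \<open>al 1\<close> and \<open>al (-1)\<close> is a unit modulo \<open>p\<close>, so some rotated generating tuple has a generator of \<open>\<langle>a\<rangle>\<close>
  at place \<open>0\<close>. Thus conjugation inside the family realizes conjugation by any group element at one place.\<close>

lemma coordinate_surj:
  assumes "q \<in> carrier G" obtains s where "s \<in> S" "s m = q"
proof -
  have "subgroup ((\<lambda>s. s 0) ` S) G"
  proof (rule subgroupI)
    show "(\<lambda>s. s 0) ` S \<noteq> {}" using base by auto
    show "inv x \<in> (\<lambda>s. s 0) ` S" if "x \<in> (\<lambda>s. s 0) ` S" for x
      using that S_inv by force
    show "x \<otimes> y \<in> (\<lambda>s. s 0) ` S" if "x \<in> (\<lambda>s. s 0) ` S" "y \<in> (\<lambda>s. s 0) ` S" for x y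
      using that S_mult by force
  qed auto
  moreover have "b \<in> (\<lambda>s. s 0) ` S"
    using gen_tuple_in_S[of 0] gen_tuple_values(1)[of 0] by (metis imageI)
  moreover have "a [^] al 1 \<in> (\<lambda>s. s 0) ` S"
    using gen_tuple_in_S[of "-1"] gen_tuple_values(2)[of 0 "-1"]
    by (intro image_eqI[of _ _ "gen_tuple (-1)"]) auto
  moreover have "a [^] al (-1) \<in> (\<lambda>s. s 0) ` S"
    using gen_tuple_in_S[of "1"] gen_tuple_values(2)[of 0 "1"]
    by (intro image_eqI[of _ _ "gen_tuple 1"]) auto
  ultimately have "a \<in> (\<lambda>s. s 0) ` S" "b \<in> (\<lambda>s. s 0) ` S" "subgroup ((\<lambda>s. s 0) ` S) G"
    using mem_of_power_mem[OF _ a a_pow_p p(1)] one_al_unit by blast+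
  then have "carrier G \<subseteq> (\<lambda>s. s 0) ` S"
    unfolding gen[symmetric] by (intro generate_subgroup_incl) auto
  then obtain s where s: "s \<in> S" "s 0 = q" using assms by auto
  then show thesis using that[OF S_shift[OF s(1), of "- m"]] by simp
qed

abbreviation "D \<equiv> derived G (carrier G)"

text \<open>Two rotations of the generating tuple have powers of \<open>a\<close> at all places other than their own, so their
  commutator lives on two places only.\<close>

lemma joined_commutators:
  "joined (comm_of G b (a [^] al (-1))) (comm_of G (a [^] al 1) b)"
proof -
  have "joined ((\<lambda>k. comm_of G (gen_tuple 0 k) (gen_tuple 1 k)) 0)
               ((\<lambda>k. comm_of G (gen_tuple 0 k) (gen_tuple 1 k)) 1)"
  proof (rule joinedI)
    show "(\<lambda>k. comm_of G (gen_tuple 0 k) (gen_tuple 1 k)) \<in> S"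
      by (intro S_mult S_inv gen_tuple_in_S)
    show "comm_of G (gen_tuple 0 k) (gen_tuple 1 k) = \<one>"
      if "\<not> int p dvd k" "\<not> int p dvd k - 1" for k
    proof -
      have "comm_of G (a [^] al k) (a [^] al (k - 1)) = \<one>"
        by (subst comm_of_eq_one_iff) (auto simp: int_pow_mult[symmetric] add.commute)
      then show ?thesis using that gen_tuple_values(2)[of k 0] gen_tuple_values(2)[of k 1] by simp
    qed
  qed
  then show ?thesis
    using gen_tuple_values(1)[of 0] gen_tuple_values(1)[of 1]
      gen_tuple_values(2)[of 1 0] gen_tuple_values(2)[of 0 1] by simp
qed

lemma D_normal: "D \<lhd> G" by (rule derived_self_is_normal)

lemma D_carrier: "x \<in> D \<Longrightarrow> x \<in> carrier G"
  using derived_in_carrier by blast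

lemma comm_in_D: "x \<in> carrier G \<Longrightarrow> y \<in> carrier G \<Longrightarrow> comm_of G x y \<in> D"
  unfolding derived_def by (rule generate.incl) blast

lemma generate_power:
  assumes "\<not> int p dvd i"
  shows "generate G {a [^] i, b} = carrier G" "generate G {b, a [^] i} = carrier G"
proof -
  have sub: "subgroup (generate G {a [^] i, b}) G" by (rule generate_is_subgroup) auto
  have "a \<in> generate G {a [^] i, b}"
    using mem_of_power_mem[OF sub a a_pow_p p(1) generate.incl assms] by blast
  then have "carrier G \<subseteq> generate G {a [^] i, b}"
    unfolding gen[symmetric] using sub by (intro generate_subgroup_incl) (auto intro: generate.incl)
  then show 1: "generate G {a [^] i, b} = carrier G"
    using sub subgroup.subset by blast
  then show "generate G {b, a [^] i} = carrier G" by (simp add: insert_commute)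
qed

lemma D_subset_of_power_comm:
  assumes "K \<lhd> G" "\<not> int p dvd i" "comm_of G b (a [^] i) \<in> K \<or> comm_of G (a [^] i) b \<in> K"
  shows "D \<subseteq> K"
  using assms(3)
proof
  assume "comm_of G b (a [^] i) \<in> K"
  then show ?thesis
    by (rule derived_subset_normal[OF assms(1) generate_power(2)[OF assms(2)] b int_pow_closed[OF a]])
next
  assume "comm_of G (a [^] i) b \<in> K"
  then show ?thesis
    by (rule derived_subset_normal[OF assms(1) generate_power(1)[OF assms(2)] int_pow_closed[OF a] b])
qed

lemma D_conj: "g \<in> D \<Longrightarrow> x \<in> carrier G \<Longrightarrow> x \<otimes> g \<otimes> inv x \<in> D"
  by (rule normal.inv_op_closed2[OF D_normal])

lemma D_subgroup: "subgroup D G"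
  by (rule normal_imp_subgroup[OF D_normal])

text \<open>The commutators that have a partner under \<open>R\<close> form a normal subgroup; as soon as it contains one
  commutator of \<open>b\<close> with a generator of \<open>\<langle>a\<rangle>\<close>, it is everything. The relation is kept abstract because the
  argument is needed for both directions of \<open>joined\<close>.\<close>

lemma D_subset_of_relation:
  assumes one: "R \<one> \<one>"
    and mult: "\<And>g h g' h'. R g h \<Longrightarrow> R g' h' \<Longrightarrow> R (g \<otimes> g') (h \<otimes> h')"
    and inv: "\<And>g h. R g h \<Longrightarrow> R (inv g) (inv h)"
    and conj: "\<And>g h x. R g h \<Longrightarrow> x \<in> carrier G \<Longrightarrow> \<exists>y\<in>carrier G. R (x \<otimes> g \<otimes> inv x) (y \<otimes> h \<otimes> inv y)"
    and i: "\<not> int p dvd i"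
    and h: "h \<in> D" "R (comm_of G b (a [^] i)) h \<or> R (comm_of G (a [^] i) b) h"
  shows "D \<subseteq> {g \<in> D. \<exists>h\<in>D. R g h}"
proof (rule D_subset_of_power_comm[OF _ i])
  let ?K = "{g \<in> D. \<exists>h\<in>D. R g h}"
  interpret D: subgroup D G by (rule D_subgroup)
  show "?K \<lhd> G"
  proof (rule normal_invI)
    show "subgroup ?K G"
    proof (rule subgroupI)
      show "?K \<subseteq> carrier G" using D_carrier by blast
      show "?K \<noteq> {}" using one D.one_closed by blast
      show "inv x \<in> ?K" if "x \<in> ?K" for x
        using that inv D.m_inv_closed by blast
      show "x \<otimes> y \<in> ?K" if "x \<in> ?K" "y \<in> ?K" for x y
        using that mult D.m_closed by blast
    qed
  next
    fix x g assume x: "x \<in> carrier G" and g: "g \<in> ?K"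
    from g obtain h where h: "h \<in> D" "R g h" "g \<in> D" by blast
    obtain y where y: "y \<in> carrier G" "R (x \<otimes> g \<otimes> inv x) (y \<otimes> h \<otimes> inv y)"
      using conj[OF h(2) x] by blast
    then show "x \<otimes> g \<otimes> inv x \<in> ?K"
      using D_conj[OF h(3) x] D_conj[OF h(1) y(1)] by blast
  qed
  show "comm_of G b (a [^] i) \<in> ?K \<or> comm_of G (a [^] i) b \<in> ?K"
    using h comm_in_D by auto
qed

lemma D_subset_left:
  assumes "\<not> int p dvd al (-1)"
  shows "D \<subseteq> {g \<in> D. \<exists>h\<in>D. joined g h}"
proof (rule D_subset_of_relation[where R = joined, OF joined_one joined_mult joined_inv _ assms])
  show "comm_of G (a [^] al 1) b \<in> D" by (rule comm_in_D) auto
  show "joined (comm_of G b (a [^] al (-1))) (comm_of G (a [^] al 1) b) \<or>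
      joined (comm_of G (a [^] al (-1)) b) (comm_of G (a [^] al 1) b)"
    by (rule disjI1) (rule joined_commutators)
  fix g h x assume gh: "joined g h" and x: "x \<in> carrier G"
  obtain s where s: "s \<in> S" "s 0 = x" using coordinate_surj[OF x] by blast
  show "\<exists>y\<in>carrier G. joined (x \<otimes> g \<otimes> inv x) (y \<otimes> h \<otimes> inv y)"
    by (rule bexI[of _ "s 1"]) (use joined_conj[OF gh s(1)] s in simp_all)
qed

lemma D_subset_right:
  assumes "\<not> int p dvd al 1"
  shows "D \<subseteq> {h \<in> D. \<exists>g\<in>D. joined g h}"
proof (rule D_subset_of_relation[where R = "\<lambda>h g. joined g h", OF joined_one joined_mult joined_inv _ assms])
  show "comm_of G b (a [^] al (-1)) \<in> D" by (rule comm_in_D) auto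
  show "joined (comm_of G b (a [^] al (-1))) (comm_of G b (a [^] al 1)) \<or>
      joined (comm_of G b (a [^] al (-1))) (comm_of G (a [^] al 1) b)"
    by (rule disjI2) (rule joined_commutators)
  fix h g x assume gh: "joined g h" and x: "x \<in> carrier G"
  obtain s where s: "s \<in> S" "s 1 = x" using coordinate_surj[OF x] by blast
  show "\<exists>y\<in>carrier G. joined (y \<otimes> g \<otimes> inv y) (x \<otimes> h \<otimes> inv x)"
    by (rule bexI[of _ "s 0"]) (use joined_conj[OF gh s(1)] s in simp_all)
qed

lemma commute_of_D_trivial: "D \<subseteq> {\<one>} \<Longrightarrow> a \<otimes> b = b \<otimes> a"
  using comm_in_D[of a b] comm_of_eq_one_iff[of a b] by auto

text \<open>The centralizer of the derived subgroup.\<close>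

definition Z :: "'a set" where
  "Z = {x \<in> carrier G. \<forall>y\<in>D. x \<otimes> y = y \<otimes> x}"

lemma Z_subgroup: "subgroup Z G"
  unfolding Z_def using derived_in_carrier by (intro centralizer_subgroup) auto

lemma Z_of_partner:
  assumes partner: "D \<subseteq> {g \<in> D. \<exists>h\<in>D. R g h}"
    and mult: "\<And>g h g' h'. R g h \<Longrightarrow> R g' h' \<Longrightarrow> R (g \<otimes> g') (h \<otimes> h')"
    and inv: "\<And>g h. R g h \<Longrightarrow> R (inv g) (inv h)"
    and conj: "\<And>g h. R g h \<Longrightarrow> R (x \<otimes> g \<otimes> inv x) (y \<otimes> h \<otimes> inv y)"
    and triv: "\<And>g. R g \<one> \<Longrightarrow> g = \<one>"
    and x: "x \<in> carrier G" and y: "y \<in> Z"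
  shows "x \<in> Z"
proof -
  have yc: "y \<in> carrier G" using y by (simp add: Z_def)
  have "x \<otimes> g = g \<otimes> x" if g: "g \<in> D" for g
  proof -
    obtain h where h: "h \<in> D" "R g h" using partner g by blast
    have "comm_of G y h = \<one>"
      using y h(1) comm_of_eq_one_iff[OF yc D_carrier[OF h(1)]] by (auto simp: Z_def)
    then have "R (comm_of G x g) \<one>"
      using mult[OF conj[OF h(2)] inv[OF h(2)]] by simp
    then have "comm_of G x g = \<one>" by (rule triv)
    then show ?thesis using comm_of_eq_one_iff[OF x D_carrier[OF g]] by blast
  qed
  then show ?thesis using x by (simp add: Z_def)
qed

text \<open>Conjugating a pair of joined commutators by a tuple \<open>s\<close>, and dividing by the original pair, leaves the
  commutator with \<open>s 0\<close> at one place and the commutator with \<open>s 1\<close> at the other. If one of them is trivial,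
  then so is the other.\<close>

lemma Z_transfer:
  assumes units: "\<not> int p dvd al 1" "\<not> int p dvd al (-1)" and s: "s \<in> S"
  shows "s 0 \<in> Z \<longleftrightarrow> s 1 \<in> Z"
proof
  show "s 0 \<in> Z" if "s 1 \<in> Z"
    by (rule Z_of_partner[where R = joined, OF D_subset_left[OF units(2)] joined_mult joined_inv
          joined_conj[OF _ s] joined_one_right S_carrier[OF s] that])
  show "s 1 \<in> Z" if "s 0 \<in> Z"
    by (rule Z_of_partner[where R = "\<lambda>h g. joined g h", OF D_subset_right[OF units(1)] joined_mult joined_inv
          joined_conj[OF _ s] joined_one_left S_carrier[OF s] that])
qed

text \<open>Otherwise \<open>a\<close> has order \<open>p\<close> modulo \<open>Z\<close>, and the transfer between places \<open>0\<close> and \<open>1\<close> is linear on exponents.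
  Products of rotated tuples with powers of \<open>a\<close> at both places then show that \<open>al 1, al 2, \<dots>, al (p - 1)\<close> is a
  geometric progression, while tuples involving \<open>b\<close> force its ratio to be \<open>1\<close>. That contradicts
  \<open>al 1 \<noteq> al (-1)\<close>.\<close>

lemma a_in_Z:
  assumes units: "\<not> int p dvd al 1" "\<not> int p dvd al (-1)"
    and al_per: "\<And>k l. [k = l] (mod int p) \<Longrightarrow> al k = al l"
  shows "a \<in> Z"
proof (rule ccontr)
  assume "a \<notin> Z"
  then have Z_dvd: "a [^] i \<in> Z \<Longrightarrow> int p dvd i" for i :: int
    using mem_of_power_mem[OF Z_subgroup a a_pow_p p(1)] by blast
  have Z_pow: "a [^] i \<in> Z" if "int p dvd i" for i :: int
    using int_pow_cong[OF a a_pow_p, of i 0] that subgroup.one_closed[OF Z_subgroup]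
    by (simp add: cong_iff_dvd_diff)
  define \<mu> where "\<mu> = al 2"
  have at: "gen_tuple m k [^] i = a [^] (al (k - m) * i)" if "\<not> int p dvd k - m" for m k i
    using that gen_tuple_values(2)[of k m] by (simp add: int_pow_pow)
  \<comment> \<open>The values of the vector follow the geometric pattern given by the first two.\<close>
  have step: "int p dvd al 1 * al (k + 1) - al k * \<mu>" if k: "1 \<le> k" "k + 1 < int p" for k
  proof -
    define s where "s = (\<lambda>j. gen_tuple (- k) j [^] al 1 \<otimes> gen_tuple (- 1) j [^] (- al k))"
    have s: "s \<in> S" unfolding s_def by (intro S_mult S_int_pow gen_tuple_in_S)
    have nd: "\<not> int p dvd k" "\<not> int p dvd 1 + k"
      using k not_dvd_small[of k] not_dvd_small[of "1 + k"] by auto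
    have "s 0 = a [^] (al k * al 1 + al 1 * (- al k))"
      using nd by (simp only: s_def at p_not_dvd_small int_pow_mult[OF a, symmetric] diff_0 minus_minus diff_minus_eq_add add_0 not_False_eq_True)
    then have "s 0 \<in> Z" by (simp only:) (rule Z_pow, simp)
    then have s1: "s 1 \<in> Z" using Z_transfer[OF units s] by simp
    have "s 1 = a [^] (al (1 + k) * al 1 + al 2 * (- al k))"
      using nd by (simp only: s_def at p_not_dvd_small int_pow_mult[OF a, symmetric] diff_minus_eq_add one_add_one not_False_eq_True)
    then have "int p dvd al (1 + k) * al 1 + al 2 * (- al k)" using s1 Z_dvd by metis
    then show ?thesis by (simp add: \<mu>_def algebra_simps)
  qed
  have geo: "[al 1 ^ k * al (int k + 1) = \<mu> ^ k * al 1] (mod int p)" if "k + 1 < p" for k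
    using that
  proof (induction k)
    case 0 then show ?case by simp
  next
    case (Suc k)
    have "[al 1 * al (int k + 1 + 1) = al (int k + 1) * \<mu>] (mod int p)"
      using step[of "int k + 1"] Suc.prems by (simp add: cong_iff_dvd_diff)
    then have "[al 1 ^ k * (al 1 * al (int k + 1 + 1)) = al 1 ^ k * (al (int k + 1) * \<mu>)] (mod int p)"
      by (rule cong_scalar_left)
    also have "al 1 ^ k * (al (int k + 1) * \<mu>) = (al 1 ^ k * al (int k + 1)) * \<mu>" by simp
    also have "[(al 1 ^ k * al (int k + 1)) * \<mu> = (\<mu> ^ k * al 1) * \<mu>] (mod int p)"
      using Suc by (intro cong_scalar_right) auto
    finally show ?case by (simp add: algebra_simps)
  qed
  have al_last: "al (int (p - 2) + 1) = al (-1)"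
    using p(2) by (intro al_per) (simp add: cong_iff_dvd_diff)
  have "[al 1 ^ (p - 2) * al (-1) = \<mu> ^ (p - 2) * al 1] (mod int p)"
    using geo[of "p - 2"] p(2) al_last by simp
  then have "[al 1 * al 1 * \<mu> * \<mu> * (al 1 ^ (p - 2) * al (-1))
      = al 1 * al 1 * \<mu> * \<mu> * (\<mu> ^ (p - 2) * al 1)] (mod int p)"
    by (rule cong_scalar_left)
  moreover have pow: "x ^ p = x * x * x ^ (p - 2)" for x :: int
  proof -
    have "2 + (p - 2) = p" using p(2) by simp
    then have "x ^ p = x ^ (2 + (p - 2))" by (simp only:)
    also have "\<dots> = x * x * x ^ (p - 2)" by (simp only: power_add power2_eq_square)
    finally show ?thesis .
  qed
  ultimately have c1: "[al 1 ^ p * (\<mu> * al (-1)) * \<mu> = \<mu> ^ p * (al 1 * al 1 * al 1)] (mod int p)"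
    unfolding pow by (simp add: mult_ac)
  have c2: "[al 1 ^ p * (\<mu> * al (-1)) * \<mu> = al 1 * (\<mu> * al (-1)) * \<mu>] (mod int p)"
    by (intro cong_scalar_right fermat_int p(1))
  have c3: "[\<mu> ^ p * (al 1 * al 1 * al 1) = \<mu> * (al 1 * al 1 * al 1)] (mod int p)"
    by (intro cong_scalar_right fermat_int p(1))
  have c4: "int p dvd al 1 * \<mu> * (al (-1) * \<mu> - al 1 * al 1)"
  proof -
    have "[al 1 * (\<mu> * al (-1)) * \<mu> = \<mu> * (al 1 * al 1 * al 1)] (mod int p)"
      by (rule cong_trans[OF cong_sym[OF c2] cong_trans[OF c1 c3]])
    moreover have "al 1 * (\<mu> * al (-1)) * \<mu> - \<mu> * (al 1 * al 1 * al 1)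
        = al 1 * \<mu> * (al (-1) * \<mu> - al 1 * al 1)" by (simp add: algebra_simps)
    ultimately show ?thesis by (simp only: cong_iff_dvd_diff)
  qed
  \<comment> \<open>A tuple that involves the entry \<open>b\<close> gives a second relation.\<close>
  have rel: "int p dvd al 1 * (al 1 * al 1) - al (-1) * (\<mu> * \<mu>)"
  proof -
    define s where "s = (\<lambda>j. gen_tuple 1 j [^] al 1 \<otimes> gen_tuple (- 1) j [^] (- al (-1)))"
    have s: "s \<in> S" unfolding s_def by (intro S_mult S_int_pow gen_tuple_in_S)
    have "s 0 = a [^] (al (-1) * al 1 + al 1 * (- al (-1)))"
      by (simp only: s_def at p_not_dvd_small int_pow_mult[OF a, symmetric] diff_0 minus_minus diff_minus_eq_add add_0 not_False_eq_True)
    then have "s 0 \<in> Z" by (simp only:) (rule Z_pow, simp)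
    then have s1: "s 1 \<in> Z" using Z_transfer[OF units s] by simp
    have s1_eq: "s 1 = b [^] al 1 \<otimes> a [^] (- \<mu> * al (-1))"
      by (simp add: s_def at gen_tuple_values(1) \<mu>_def)
    have "coprime (al 1) (int p)"
      using units(1) by (metis coprime_commute prime_imp_coprime prime_int)
    then obtain c where c: "[al 1 * c = 1] (mod int p)" using cong_solve_coprime_int by blast
    define r where "r = (\<lambda>j. gen_tuple 0 j [^] al 1 \<otimes> gen_tuple (- 1) j [^] (- \<mu> * al (-1) * c))"
    have r: "r \<in> S" unfolding r_def by (intro S_mult S_int_pow gen_tuple_in_S)
    have "[al 1 * (- \<mu> * al (-1) * c) = - \<mu> * al (-1)] (mod int p)"
      using cong_scalar_right[OF c, of "- \<mu> * al (-1)"] by (simp add: ac_simps)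
    then have "a [^] (al 1 * (- \<mu> * al (-1) * c)) = a [^] (- \<mu> * al (-1))"
      by (rule int_pow_cong[OF a a_pow_p])
    then have "r 0 = s 1"
      by (simp only: r_def s1_eq at gen_tuple_values(1) p_not_dvd_small diff_minus_eq_add add_0 not_False_eq_True)
    then have r1: "r 1 \<in> Z" using s1 Z_transfer[OF units r] by simp
    have "r 1 = a [^] (al 1 * al 1 + \<mu> * (- \<mu> * al (-1) * c))"
      by (simp only: r_def at p_not_dvd_small int_pow_mult[OF a, symmetric] diff_minus_eq_add one_add_one diff_zero \<mu>_def not_False_eq_True)
    then have "int p dvd al 1 * al 1 + \<mu> * (- \<mu> * al (-1) * c)" using r1 Z_dvd by metis
    then have "int p dvd al 1 * (al 1 * al 1 + \<mu> * (- \<mu> * al (-1) * c))" by (rule dvd_mult)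
    moreover have "int p dvd (al 1 * c - 1) * (\<mu> * \<mu> * al (-1))"
      using c unfolding cong_iff_dvd_diff by (rule dvd_mult2)
    ultimately have "int p dvd al 1 * (al 1 * al 1 + \<mu> * (- \<mu> * al (-1) * c)) + (al 1 * c - 1) * (\<mu> * \<mu> * al (-1))"
      by (rule dvd_add)
    then show ?thesis by (simp add: algebra_simps)
  qed
  have mu: "\<not> int p dvd \<mu>"
  proof
    assume "int p dvd \<mu>"
    then have "int p dvd al 1 * (al 1 * al 1) - al (-1) * (\<mu> * \<mu>) + al (-1) * (\<mu> * \<mu>)"
      using rel by (intro dvd_add) simp_all
    then have "int p dvd al 1 * (al 1 * al 1)" by simp
    then show False using units(1) by (simp add: p_dvd_mult_iff)
  qed
  then have "int p dvd al (-1) * \<mu> - al 1 * al 1"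
    using c4 units(1) by (simp add: p_dvd_mult_iff)
  then have c5: "int p dvd (al (-1) * \<mu> - al 1 * al 1) * \<mu>" by simp
  have "int p dvd (al 1 * (al 1 * al 1) - al (-1) * (\<mu> * \<mu>)) + (al (-1) * \<mu> - al 1 * al 1) * \<mu>"
    by (rule dvd_add[OF rel c5])
  then have "int p dvd al 1 * al 1 * (al 1 - \<mu>)" by (simp add: algebra_simps)
  then have c6: "int p dvd al 1 - \<mu>" using units(1) by (simp add: p_dvd_mult_iff)
  have "int p dvd (al (-1) * \<mu> - al 1 * al 1) + (al 1 - \<mu>) * al 1"
    using \<open>int p dvd al (-1) * \<mu> - al 1 * al 1\<close> c6 by simp
  moreover have "(al (-1) * \<mu> - al 1 * al 1) + (al 1 - \<mu>) * al 1 = - (\<mu> * (al 1 - al (-1)))"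
    by (simp add: algebra_simps)
  ultimately have "int p dvd \<mu> * (al 1 - al (-1))"
    by (metis dvd_minus_iff)
  then show False using mu nonsym by (simp add: p_dvd_mult_iff cong_iff_dvd_diff)
qed

text \<open>If \<open>al 1\<close> or \<open>al (-1)\<close> vanishes, one of the two commutators in \<open>joined_commutators\<close> is trivial and hence so is
  the other. In the remaining case the derived subgroup is central. Then it is generated by \<open>e = [b, a]\<close>,
  of order dividing \<open>p\<close>, and the tuple with \<open>e\<^sup>\<beta>\<close> at \<open>0\<close> and \<open>e\<^sup>-\<^sup>\<alpha>\<close> at \<open>1\<close> can be chained around the cycle of places: it
  closes up to \<open>e\<close> raised to \<open>\<beta>\<^sup>p - \<alpha>\<^sup>p\<close>, which is \<open>\<beta> - \<alpha>\<close> modulo \<open>p\<close>.\<close>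

lemma generators_commute:
  assumes al_per: "\<And>k l. [k = l] (mod int p) \<Longrightarrow> al k = al l"
  shows "a \<otimes> b = b \<otimes> a"
proof (cases "int p dvd al 1 \<or> int p dvd al (-1)")
  case True
  have pow_one: "a [^] i = \<one>" if "int p dvd i" for i :: int
    using int_pow_cong[OF a a_pow_p, of i 0] that by (simp add: cong_iff_dvd_diff)
  have triv: "{\<one>} \<lhd> G" by (rule one_is_normal)
  show ?thesis
  proof (cases "int p dvd al 1")
    case al1: True
    then have "comm_of G b (a [^] al (-1)) = \<one>"
      using joined_commutators pow_one[OF al1] by (intro joined_one_right) simp
    then have "D \<subseteq> {\<one>}"
      using D_subset_of_power_comm[OF triv, of "al (-1)"] one_al_unit al1 by blast
    then show ?thesis by (rule commute_of_D_trivial)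
  next
    case False
    then have "comm_of G (a [^] al 1) b = \<one>"
      using joined_commutators pow_one[of "al (-1)"] True by (intro joined_one_left) simp
    then have "D \<subseteq> {\<one>}"
      using D_subset_of_power_comm[OF triv False] by blast
    then show ?thesis by (rule commute_of_D_trivial)
  qed
next
  case False
  define \<alpha> \<beta> where "\<alpha> = al 1" and "\<beta> = al (-1)"
  have units: "\<not> int p dvd al 1" "\<not> int p dvd al (-1)" using False by auto
  have aZ: "a \<in> Z" by (rule a_in_Z[OF units al_per])
  have "gen_tuple 1 0 = a [^] al (-1)" using gen_tuple_values(2)[of 0 1] by simp
  then have "gen_tuple 1 0 \<in> Z" using subgroup_int_pow_closed[OF Z_subgroup aZ] by simp
  then have bZ: "b \<in> Z" using Z_transfer[OF units gen_tuple_in_S[of 1]] by (simp add: gen_tuple_values(1))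
  define e where "e = comm_of G b a"
  have e: "e \<in> carrier G" "e \<in> D" using comm_in_D[OF b a] by (auto simp: e_def)
  have e_comm: "e \<otimes> a = a \<otimes> e" "e \<otimes> b = b \<otimes> e"
    using aZ bZ e(2) by (auto simp: Z_def)
  have conj_a: "b \<otimes> a \<otimes> inv b = e \<otimes> a"
    by (simp add: e_def m_assoc)
  have conj_hom: "(\<lambda>y. b \<otimes> y \<otimes> inv b) \<in> hom G G"
    by (rule homI) (simp_all add: m_assoc inv_solve_left)
  have conj_pow: "b \<otimes> a [^] i \<otimes> inv b = e [^] i \<otimes> a [^] i" for i :: int
  proof -
    have "b \<otimes> a [^] i \<otimes> inv b = (b \<otimes> a \<otimes> inv b) [^] i"
      using hom_int_pow[OF conj_hom, of a i] by simp
    also have "\<dots> = e [^] i \<otimes> a [^] i"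
      unfolding conj_a by (rule int_pow_mult_distrib[OF e_comm(1) e(1) a])
    finally show ?thesis .
  qed
  have comm_pow: "comm_of G b (a [^] i) = e [^] i" for i :: int
    using e by (simp add: conj_pow m_assoc)
  have "e [^] p = \<one>"
    using comm_pow[of "int p"] a_pow_p by (simp add: int_pow_int)
  have comm_pow': "comm_of G (a [^] i) b = e [^] (- i)" for i :: int
  proof -
    have "comm_of G (a [^] i) b = inv (comm_of G b (a [^] i))"
      by (simp add: inv_mult_group m_assoc)
    then show ?thesis using comm_pow e by (simp add: int_pow_neg)
  qed
  define t where "t = (\<lambda>k. e [^] ((if int p dvd k then \<beta> else 0) - (if int p dvd k - 1 then \<alpha> else 0)))"
  have t: "t \<in> S"
  proof -
    have "joined (e [^] \<beta>) (e [^] (- \<alpha>))"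
      using joined_commutators unfolding comm_pow comm_pow' \<alpha>_def \<beta>_def .
    then obtain s where s: "s \<in> S"
      "\<And>k. int p dvd k \<Longrightarrow> s k = e [^] \<beta>" "\<And>k. int p dvd k - 1 \<Longrightarrow> s k = e [^] (- \<alpha>)"
      "\<And>k. \<not> int p dvd k \<Longrightarrow> \<not> int p dvd k - 1 \<Longrightarrow> s k = \<one>"
      by (rule joinedE) (rule that)
    have "t = s"
      unfolding t_def using s(2-4) dvd_distinct by (intro ext) auto
    then show ?thesis using s(1) by simp
  qed
  \<comment> \<open>Walking once around the cycle compares \<open>e [^] \<beta> ^ p\<close> with \<open>e [^] \<alpha> ^ p\<close> in the same place.\<close>
  have walk: "(\<lambda>k. e [^] ((if int p dvd k then \<beta> ^ n else 0) - (if int p dvd k - int n then \<alpha> ^ n else 0))) \<in> S"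
    for n
  proof (induction n)
    case 0
    then show ?case using S_one by (simp cong: if_cong)
  next
    case (Suc n)
    let ?f = "\<lambda>n k. (if int p dvd k then \<beta> ^ n else 0) - (if int p dvd k - int n then \<alpha> ^ n else 0)"
    have "(\<lambda>k. (e [^] ?f n k) [^] \<beta> \<otimes> t (k + (- int n)) [^] (\<alpha> ^ n)) \<in> S"
      by (intro S_mult S_int_pow S_shift Suc.IH t)
    also have "(\<lambda>k. (e [^] ?f n k) [^] \<beta> \<otimes> t (k + (- int n)) [^] (\<alpha> ^ n)) = (\<lambda>k. e [^] ?f (Suc n) k)"
    proof
      fix k
      define m where "m = - int n"
      have "k - int (Suc n) = k + m - 1" "k - int n = k + m" by (auto simp: m_def)
      then have "?f n k * \<beta> + ((if int p dvd k + m then \<beta> else 0) -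
          (if int p dvd k + m - 1 then \<alpha> else 0)) * \<alpha> ^ n = ?f (Suc n) k"
        by (simp only:) (auto simp: algebra_simps)
      then show "(e [^] ?f n k) [^] \<beta> \<otimes> t (k + (- int n)) [^] (\<alpha> ^ n) = e [^] ?f (Suc n) k"
        unfolding t_def int_pow_pow[OF e(1)] int_pow_mult[OF e(1), symmetric] m_def by (simp only:)
    qed
    finally show ?case .
  qed
  have "e [^] (\<beta> ^ p - \<alpha> ^ p) = \<one>"
  proof -
    have "int p dvd k - int p \<longleftrightarrow> int p dvd k" for k
      using dvd_add_triv_right_iff[of "int p" "k - int p"] by simp
    then show ?thesis using isolated[OF walk[of p]] by simp
  qed
  moreover have "\<not> int p dvd \<beta> ^ p - \<alpha> ^ p"
  proof
    assume "int p dvd \<beta> ^ p - \<alpha> ^ p"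
    then have "[\<beta> ^ p = \<alpha> ^ p] (mod int p)" by (simp add: cong_iff_dvd_diff)
    then have "[\<beta> = \<alpha>] (mod int p)"
      using fermat_int[OF p(1), of \<beta>] fermat_int[OF p(1), of \<alpha>] by (meson cong_sym cong_trans)
    then show False using nonsym by (simp add: \<alpha>_def \<beta>_def cong_sym_eq[of "al 1"])
  qed
  ultimately have "e \<in> {\<one>}"
    using mem_of_power_mem[OF triv_subgroup e(1) \<open>e [^] p = \<one>\<close> p(1)] by blast
  then have "comm_of G b a = \<one>" by (simp add: e_def)
  then show ?thesis using comm_of_eq_one_iff[OF b a] by simp
qed

end

section \<open>Tree automorphisms and their sections\<close>

lemma Nil_in_words [simp]: "[] \<in> words p"
  and Cons_in_words [simp]: "j # w \<in> words p \<longleftrightarrow> j < p \<and> w \<in> words p"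
  and append_in_words [simp]: "v @ w \<in> words p \<longleftrightarrow> v \<in> words p \<and> w \<in> words p"
  by (auto simp: words_def)

lemma AutT_carrierD:
  assumes "f \<in> carrier (AutT p)"
  shows "f \<in> Bij (words p)" "f \<in> extensional (words p)" "inj_on f (words p)" "f ` words p = words p"
    "f [] = []" "\<And>v. v \<in> words p \<Longrightarrow> f v \<in> words p"
  using assms by (auto simp: AutT_def Bij_def bij_betw_def)

text \<open>Preserving adjacency and the root means preserving the relation of parent and child: the image of a
  child cannot be the parent of the image, because the parent is already taken.\<close>

lemma AutT_extend:
  assumes f: "f \<in> carrier (AutT p)" and "v @ [x] \<in> words p"
  shows "\<exists>y<p. f (v @ [x]) = f v @ [y]"
  using assms(2)
proof (induction v arbitrary: x rule: length_induct)
  case (1 v)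
  note fD = AutT_carrierD[OF f]
  have "adjacent (f v) (f (v @ [x]))"
    using f 1(2) unfolding AutT_def by (auto simp: adjacent_def)
  then consider y where "f (v @ [x]) = f v @ [y]" | y where "f v = f (v @ [x]) @ [y]"
    by (auto simp: adjacent_def)
  then show ?case
  proof cases
    case (1 y)
    then show ?thesis using fD(6)[of "v @ [x]"] \<open>v @ [x] \<in> words p\<close> by auto
  next
    case (2 y)
    show ?thesis
    proof (cases v rule: rev_cases)
      case Nil
      then show ?thesis using 2 fD(5) by simp
    next
      case (snoc v' x')
      then obtain z where "f v = f v' @ [z]" using "1.IH" "1.prems" by fastforce
      then have "f (v @ [x]) = f v'" using 2 by simp
      then have "v @ [x] = v'"
        using fD(3) "1.prems" snoc by (auto dest: inj_onD)
      then show ?thesis using snoc by simp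
    qed
  qed
qed

lemma AutT_length:
  assumes f: "f \<in> carrier (AutT p)" and "v \<in> words p"
  shows "length (f v) = length v"
  using assms(2)
proof (induction v rule: rev_induct)
  case Nil then show ?case using AutT_carrierD(5)[OF f] by simp
next
  case (snoc x v)
  then show ?case using AutT_extend[OF f snoc.prems] by auto
qed

lemma AutT_append:
  assumes f: "f \<in> carrier (AutT p)" and "v @ w \<in> words p"
  shows "\<exists>w'\<in>words p. f (v @ w) = f v @ w' \<and> length w' = length w"
  using assms(2)
proof (induction w rule: rev_induct)
  case Nil then show ?case by simp
next
  case (snoc x w)
  then obtain w' where w': "f (v @ w) = f v @ w'" "w' \<in> words p" "length w' = length w" by auto
  obtain y where "y < p" "f ((v @ w) @ [x]) = f (v @ w) @ [y]"
    using AutT_extend[OF f, of "v @ w" x] snoc.prems by auto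
  then show ?case using w' by (intro bexI[of _ "w' @ [y]"]) auto
qed

lemma AutT_carrierI:
  assumes "f \<in> Bij (words p)" "f [] = []"
    and ext: "\<And>v x. v @ [x] \<in> words p \<Longrightarrow> \<exists>y. f (v @ [x]) = f v @ [y]"
  shows "f \<in> carrier (AutT p)"
proof -
  have inj: "inj_on f (words p)" and img: "f ` words p = words p"
    using assms(1) by (auto simp: Bij_def bij_betw_def)
  have fw: "\<exists>y. f v = f u @ [y]" if "v = u @ [x]" "v \<in> words p" for u v x
    using ext that by auto
  have bw: "\<exists>x. v = u @ [x]" if uv: "u \<in> words p" "v \<in> words p" "f v = f u @ [y]" for u v y
  proof (cases v rule: rev_cases)
    case Nil then show ?thesis using uv assms(2) by simp
  next
    case (snoc v' x)
    then obtain z where "f v = f v' @ [z]" using ext[of v' x] uv(2) by auto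
    then have "f v' = f u" using uv by simp
    then have "v' = u" using inj uv snoc by (auto dest: inj_onD)
    then show ?thesis using snoc by simp
  qed
  have "adjacent (f u) (f v) \<longleftrightarrow> adjacent u v" if "u \<in> words p" "v \<in> words p" for u v
    unfolding adjacent_def using fw bw that by metis
  then show ?thesis using assms by (simp add: AutT_def)
qed

lemma AutT_mult: "f \<otimes>\<^bsub>AutT p\<^esub> g = compose (words p) g f"
  and AutT_one: "\<one>\<^bsub>AutT p\<^esub> = (\<lambda>v\<in>words p. v)"
  by (simp_all add: AutT_def)

lemma AutT_mult_apply [simp]: "v \<in> words p \<Longrightarrow> (f \<otimes>\<^bsub>AutT p\<^esub> g) v = g (f v)"
  by (simp add: AutT_mult compose_def)

lemma AutT_one_apply [simp]: "v \<in> words p \<Longrightarrow> \<one>\<^bsub>AutT p\<^esub> v = v"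
  by (simp add: AutT_one)

lemma AutT_group: "group (AutT p)"
proof (rule groupI)
  fix f g assume fg: "f \<in> carrier (AutT p)" "g \<in> carrier (AutT p)"
  show "f \<otimes>\<^bsub>AutT p\<^esub> g \<in> carrier (AutT p)"
  proof (rule AutT_carrierI)
    show "f \<otimes>\<^bsub>AutT p\<^esub> g \<in> Bij (words p)"
      unfolding AutT_mult using fg by (intro compose_Bij AutT_carrierD(1))
    show "(f \<otimes>\<^bsub>AutT p\<^esub> g) [] = []" using fg by (simp add: AutT_carrierD(5))
    fix v x assume vx: "v @ [x] \<in> words p"
    obtain y where y: "y < p" "f (v @ [x]) = f v @ [y]" using AutT_extend[OF fg(1) vx] by blast
    have "f v @ [y] \<in> words p" using y vx AutT_carrierD(6)[OF fg(1)] by auto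
    then obtain z where "g (f v @ [y]) = g (f v) @ [z]" using AutT_extend[OF fg(2)] by blast
    then show "\<exists>y. (f \<otimes>\<^bsub>AutT p\<^esub> g) (v @ [x]) = (f \<otimes>\<^bsub>AutT p\<^esub> g) v @ [y]"
      using vx y by auto
  qed
next
  show "\<one>\<^bsub>AutT p\<^esub> \<in> carrier (AutT p)"
    by (rule AutT_carrierI) (auto simp: AutT_one Bij_def bij_betw_def inj_on_def)
next
  fix f g h assume "f \<in> carrier (AutT p)" "g \<in> carrier (AutT p)" "h \<in> carrier (AutT p)"
  then show "f \<otimes>\<^bsub>AutT p\<^esub> g \<otimes>\<^bsub>AutT p\<^esub> h = f \<otimes>\<^bsub>AutT p\<^esub> (g \<otimes>\<^bsub>AutT p\<^esub> h)"
    unfolding AutT_mult by (auto simp: compose_def fun_eq_iff AutT_carrierD(6))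
next
  fix f assume f: "f \<in> carrier (AutT p)"
  then show "\<one>\<^bsub>AutT p\<^esub> \<otimes>\<^bsub>AutT p\<^esub> f = f"
    using AutT_carrierD(2)[OF f] unfolding AutT_mult AutT_one
    by (auto simp: compose_def fun_eq_iff extensional_def)
  define g where "g = (\<lambda>v\<in>words p. inv_into (words p) f v)"
  note fD = AutT_carrierD[OF f]
  have g: "g \<in> Bij (words p)" unfolding g_def by (rule restrict_inv_into_Bij[OF fD(1)])
  then have gw: "g v \<in> words p" if "v \<in> words p" for v
    using that by (auto simp: Bij_def bij_betw_def)
  have fg: "f (g v) = v" if "v \<in> words p" for v
    using that fD(4) f_inv_into_f[of v f "words p"] by (simp add: g_def)
  have gI: "g v = u" if "u \<in> words p" "v \<in> words p" "f u = v" for u v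
    using fD(3) fg[OF that(2)] gw[OF that(2)] that by (auto dest: inj_onD)
  have "g \<in> carrier (AutT p)"
  proof (rule AutT_carrierI[OF g])
    show "g [] = []" using gI[of "[]" "[]"] fD(5) by simp
    fix v x assume vx: "v @ [x] \<in> words p"
    have "f (g (v @ [x])) = v @ [x]" using fg vx by blast
    moreover have "g (v @ [x]) \<noteq> []" using fD(5) fg[OF vx] by auto
    ultimately obtain u y where u: "g (v @ [x]) = u @ [y]"
      by (cases "g (v @ [x])" rule: rev_cases) auto
    have uy: "u @ [y] \<in> words p" using gw[OF vx] u by simp
    have "f (u @ [y]) = v @ [x]" using fg[OF vx] u by simp
    then have "f u = v" using AutT_extend[OF f uy] by auto
    then show "\<exists>y. g (v @ [x]) = g v @ [y]"
      using u gI[of u v] vx uy by auto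
  qed
  moreover have "g \<otimes>\<^bsub>AutT p\<^esub> f = \<one>\<^bsub>AutT p\<^esub>"
    unfolding AutT_mult AutT_one by (auto simp: compose_def fun_eq_iff fg)
  ultimately show "\<exists>g\<in>carrier (AutT p). g \<otimes>\<^bsub>AutT p\<^esub> f = \<one>\<^bsub>AutT p\<^esub>" by blast
qed

lemma AutT_eqI:
  assumes "f \<in> extensional (words p)" "g \<in> extensional (words p)"
    and "\<And>v. v \<in> words p \<Longrightarrow> f v = g v"
  shows "f = g"
  using assms by (rule extensionalityI)

lemma AutT_mult_extensional [simp]: "f \<otimes>\<^bsub>AutT p\<^esub> g \<in> extensional (words p)"
  by (simp add: AutT_mult compose_def)

text \<open>The automorphism that fixes the first level and has the sections \<open>t j\<close> there, in the usual notation
  \<open>(t 0, \<dots>, t (p - 1))\<close>.\<close>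

definition spread :: "nat \<Rightarrow> (nat \<Rightarrow> nat list \<Rightarrow> nat list) \<Rightarrow> nat list \<Rightarrow> nat list" where
  "spread p t = (\<lambda>v\<in>words p. case v of [] \<Rightarrow> [] | j # w \<Rightarrow> j # t j w)"

lemma spread_apply [simp]:
  "spread p t [] = []"
  "j < p \<Longrightarrow> w \<in> words p \<Longrightarrow> spread p t (j # w) = j # t j w"
  by (simp_all add: spread_def)

lemma spread_extensional [simp]: "spread p t \<in> extensional (words p)"
  by (simp add: spread_def)

lemma spread_eqI:
  assumes "f \<in> extensional (words p)" "f [] = []"
    "\<And>j w. j < p \<Longrightarrow> w \<in> words p \<Longrightarrow> f (j # w) = j # t j w"
  shows "f = spread p t"
proof (rule AutT_eqI[where p = p])
  fix v assume "v \<in> words p"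
  then show "f v = spread p t v" using assms by (cases v) auto
qed (use assms in auto)

lemma spread_cong: "(\<And>j. j < p \<Longrightarrow> s j = t j) \<Longrightarrow> spread p s = spread p t"
  by (rule spread_eqI) auto

lemma spread_inj:
  assumes "spread p s = spread p t" "j < p" "s j \<in> extensional (words p)" "t j \<in> extensional (words p)"
  shows "s j = t j"
proof (rule AutT_eqI[OF assms(3,4)])
  fix v assume "v \<in> words p"
  then show "s j v = t j v" using fun_cong[OF assms(1), of "j # v"] assms(2) by simp
qed

lemma spread_carrier:
  assumes t: "\<And>j. j < p \<Longrightarrow> t j \<in> carrier (AutT p)"
  shows "spread p t \<in> carrier (AutT p)"
proof (rule AutT_carrierI)
  note tD = AutT_carrierD[OF t]
  have "inj_on (spread p t) (words p)"
  proof (rule inj_onI)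
    fix v w assume "v \<in> words p" "w \<in> words p" "spread p t v = spread p t w"
    then show "v = w"
      by (cases v; cases w) (auto dest: inj_onD[OF tD(3)])
  qed
  moreover have "spread p t ` words p = words p"
  proof (intro equalityI subsetI)
    fix v assume "v \<in> spread p t ` words p"
    then obtain w where "w \<in> words p" "v = spread p t w" by blast
    then show "v \<in> words p" using tD(6) by (cases w) auto
  next
    fix v assume v: "v \<in> words p"
    show "v \<in> spread p t ` words p"
    proof (cases v)
      case Nil then show ?thesis by (intro image_eqI[of _ _ "[]"]) auto
    next
      case (Cons j w)
      then obtain u where "u \<in> words p" "t j u = w" using tD(4)[of j] v by force
      then show ?thesis using Cons v by (intro image_eqI[of _ _ "j # u"]) auto
    qed
  qed
  ultimately show "spread p t \<in> Bij (words p)" by (simp add: Bij_def bij_betw_def)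
  fix v x assume "v @ [x] \<in> words p"
  then show "\<exists>y. spread p t (v @ [x]) = spread p t v @ [y]"
  proof (cases v)
    case (Cons j w)
    then obtain y where "t j (w @ [x]) = t j w @ [y]"
      using AutT_extend[OF t, of j w x] \<open>v @ [x] \<in> words p\<close> by auto
    then show ?thesis using Cons \<open>v @ [x] \<in> words p\<close> by simp
  qed (use tD(5) in simp)
qed simp

lemma spread_mult:
  assumes "\<And>j. j < p \<Longrightarrow> s j \<in> carrier (AutT p)"
  shows "spread p s \<otimes>\<^bsub>AutT p\<^esub> spread p t = spread p (\<lambda>j. s j \<otimes>\<^bsub>AutT p\<^esub> t j)"
  by (rule spread_eqI) (use AutT_carrierD(6)[OF assms] in auto)

lemma spread_one: "spread p (\<lambda>j. \<one>\<^bsub>AutT p\<^esub>) = \<one>\<^bsub>AutT p\<^esub>"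
  by (rule sym, rule spread_eqI) (auto simp: AutT_one)

lemma spread_inv:
  assumes t: "\<And>j. j < p \<Longrightarrow> t j \<in> carrier (AutT p)"
  shows "inv\<^bsub>AutT p\<^esub> (spread p t) = spread p (\<lambda>j. inv\<^bsub>AutT p\<^esub> (t j))"
proof (rule group.inv_equality[OF AutT_group])
  interpret group "AutT p" by (rule AutT_group)
  show "spread p (\<lambda>j. inv\<^bsub>AutT p\<^esub> (t j)) \<otimes>\<^bsub>AutT p\<^esub> spread p t = \<one>\<^bsub>AutT p\<^esub>"
  proof -
    have "spread p (\<lambda>j. inv\<^bsub>AutT p\<^esub> (t j) \<otimes>\<^bsub>AutT p\<^esub> t j) = spread p (\<lambda>j. \<one>\<^bsub>AutT p\<^esub>)"
      by (rule spread_cong) (simp add: t)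
    then show ?thesis by (subst spread_mult) (simp_all add: t spread_one)
  qed
qed (auto intro!: spread_carrier simp: t group.inv_closed[OF AutT_group])

lemma section_at_apply [simp]:
  "w \<in> words p \<Longrightarrow> section_at p h v w = drop (length v) (h (v @ w))"
  by (simp add: section_at_def)

lemma section_at_extensional [simp]: "section_at p h v \<in> extensional (words p)"
  by (simp add: section_at_def)

lemma section_at_Nil:
  assumes "h \<in> extensional (words p)" shows "section_at p h [] = h"
  by (rule AutT_eqI[where p = p]) (auto simp: assms)

lemma section_at_append:
  assumes "u \<in> words p" shows "section_at p (section_at p h v) u = section_at p h (v @ u)"
  by (rule AutT_eqI[where p = p]) (use assms in \<open>auto simp: add.commute\<close>)

lemma section_at_spread:
  assumes "j < p" "v \<in> words p"
  shows "section_at p (spread p t) (j # v) = section_at p (t j) v"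
  by (rule AutT_eqI[where p = p]) (use assms in auto)

lemma section_fixed_apply:
  assumes "h \<in> carrier (AutT p)" "v \<in> words p" "h v = v" "w \<in> words p"
  shows "h (v @ w) = v @ section_at p h v w" "section_at p h v w \<in> words p"
  using AutT_append[OF assms(1), of v w] assms by auto

text \<open>Surjectivity is the point: a preimage of a word below \<open>v\<close> has a prefix that is mapped to \<open>v\<close>, and this
  prefix is \<open>v\<close> itself.\<close>

lemma section_carrier:
  assumes h: "h \<in> carrier (AutT p)" and v: "v \<in> words p" "h v = v"
  shows "section_at p h v \<in> carrier (AutT p)"
proof (rule AutT_carrierI)
  note s = section_fixed_apply[OF h v]
  note hD = AutT_carrierD[OF h]
  have "inj_on (section_at p h v) (words p)"
  proof (rule inj_onI)
    fix w w' assume w: "w \<in> words p" "w' \<in> words p" "section_at p h v w = section_at p h v w'"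
    then have "h (v @ w) = h (v @ w')" using s(1) by metis
    then show "w = w'" using hD(3) w v by (auto dest: inj_onD)
  qed
  moreover have "section_at p h v ` words p = words p"
  proof (intro equalityI subsetI)
    fix w assume "w \<in> section_at p h v ` words p"
    then show "w \<in> words p" using s(2) by blast
  next
    fix w assume w: "w \<in> words p"
    then have "v @ w \<in> h ` words p" unfolding hD(4) using v by simp
    then obtain x where x: "x \<in> words p" "h x = v @ w" by auto
    have len: "length x = length v + length w" using AutT_length[OF h x(1)] x by simp
    define x1 x2 where "x1 = take (length v) x" and "x2 = drop (length v) x"
    have x12: "x1 @ x2 = x" by (simp add: x1_def x2_def)
    then have xw: "x1 \<in> words p" "x2 \<in> words p" using x(1) append_in_words by metis+
    obtain x' where "h (x1 @ x2) = h x1 @ x'" using AutT_append[OF h, of x1 x2] xw by auto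
    moreover have "length (h x1) = length v" using AutT_length[OF h xw(1)] len by (simp add: x1_def)
    ultimately have "h x1 = v" using x(2) x12 by simp
    then have "x1 = v" using inj_onD[OF hD(3), of x1 v] v xw by simp
    then have "v @ section_at p h v x2 = v @ w"
      unfolding s(1)[OF xw(2), symmetric] using x12 x(2) by simp
    then have "w = section_at p h v x2" by (simp only: same_append_eq)
    then show "w \<in> section_at p h v ` words p" using xw by blast
  qed
  ultimately show "section_at p h v \<in> Bij (words p)" by (simp add: Bij_def bij_betw_def)
  show "section_at p h v [] = []" using v by simp
  fix w x assume wx: "w @ [x] \<in> words p"
  then obtain y where "h (v @ w @ [x]) = h (v @ w) @ [y]" using AutT_extend[OF h, of "v @ w" x] v by auto
  then show "\<exists>y. section_at p h v (w @ [x]) = section_at p h v w @ [y]"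
    using AutT_length[OF h, of "v @ w"] v wx by simp
qed

lemma section_mult:
  assumes "g \<in> carrier (AutT p)" "v \<in> words p" "g v = v"
  shows "section_at p (g \<otimes>\<^bsub>AutT p\<^esub> h) v = section_at p g v \<otimes>\<^bsub>AutT p\<^esub> section_at p h v"
proof (rule AutT_eqI[where p = p])
  fix w assume w: "w \<in> words p"
  have "section_at p (g \<otimes>\<^bsub>AutT p\<^esub> h) v w = drop (length v) (h (v @ section_at p g v w))"
    using assms w section_fixed_apply(1)[OF assms w] by (simp del: section_at_apply add: section_at_apply[of w p "g \<otimes>\<^bsub>AutT p\<^esub> h"])
  also have "\<dots> = (section_at p g v \<otimes>\<^bsub>AutT p\<^esub> section_at p h v) w"
    using w section_fixed_apply(2)[OF assms w] by (simp del: section_at_apply add: section_at_apply[of _ p h])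
  finally show "section_at p (g \<otimes>\<^bsub>AutT p\<^esub> h) v w = (section_at p g v \<otimes>\<^bsub>AutT p\<^esub> section_at p h v) w" .
qed auto

lemma eq_spread_sections:
  assumes h: "h \<in> carrier (AutT p)" and fix1: "\<And>j. j < p \<Longrightarrow> h [j] = [j]"
  shows "h = spread p (\<lambda>j. section_at p h [j])"
proof (rule spread_eqI)
  fix j w assume "j < p" "w \<in> words p"
  then show "h (j # w) = j # section_at p h [j] w"
    using section_fixed_apply(1)[OF h, of "[j]" w] fix1 by (simp del: section_at_apply)
qed (use AutT_carrierD[OF h] in auto)

section \<open>Words in the generators\<close>

lemma count_list_replicate: "count_list (replicate n x) y = (if x = y then n else 0)"
  by (induction n) auto

text \<open>Positive words are enough, because the three generators have order \<open>p\<close>. Working with words gives access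
  to the exponents of the letters, which are invisible in the action on any finite level.\<close>

datatype letter = La | Lb | Lc

locale nonsymmetric_EGS =
  fixes p :: nat and \<alpha> :: "nat \<Rightarrow> nat"
  assumes prime_p: "prime p" and p_ge_3: "3 \<le> p"
    and GF: "GF_vector p \<alpha>" and nonsymmetric: "\<not> symmetric_vector p \<alpha>"
begin

abbreviation mult_T (infixl "\<cdot>" 70) where "g \<cdot> h \<equiv> g \<otimes>\<^bsub>AutT p\<^esub> h"
abbreviation inv_T ("inv\<^sub>T _" [81] 80) where "inv\<^sub>T g \<equiv> inv\<^bsub>AutT p\<^esub> g"
abbreviation one_T ("\<one>\<^sub>T") where "\<one>\<^sub>T \<equiv> \<one>\<^bsub>AutT p\<^esub>"

lemma p_pos [simp]: "0 < p" and p_gt_1 [simp]: "Suc 0 < p"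
  using p_ge_3 by auto

fun letter_map :: "letter \<Rightarrow> nat list \<Rightarrow> nat list" where
  "letter_map La = a_map p"
| "letter_map Lb = b_map p \<alpha>"
| "letter_map Lc = c_map p \<alpha>"

fun letter_act :: "letter \<Rightarrow> nat \<Rightarrow> nat" where
  "letter_act La j = (j + 1) mod p"
| "letter_act Lb j = j"
| "letter_act Lc j = j"

fun letter_sec :: "letter \<Rightarrow> nat \<Rightarrow> letter list" where
  "letter_sec La j = []"
| "letter_sec Lb j = (if j = p - 1 then [Lb] else replicate (\<alpha> (j + 1)) La)"
| "letter_sec Lc j = (if j = 0 then [Lc] else replicate (\<alpha> j) La)"

definition ev :: "letter list \<Rightarrow> nat list \<Rightarrow> nat list" where
  "ev W = fold letter_map W"

fun act :: "letter list \<Rightarrow> nat \<Rightarrow> nat" where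
  "act [] j = j"
| "act (l # W) j = act W (letter_act l j)"

fun sec :: "letter list \<Rightarrow> nat \<Rightarrow> letter list" where
  "sec [] j = []"
| "sec (l # W) j = letter_sec l j @ sec W (letter_act l j)"

lemma ev_simps [simp]: "ev [] v = v" "ev (l # W) v = ev W (letter_map l v)"
  "ev (U @ W) v = ev W (ev U v)"
  by (simp_all add: ev_def)

lemma ev_replicate: "ev (replicate n l) = letter_map l ^^ n"
  by (induction n) (auto simp: fun_eq_iff funpow_swap1)

lemma letter_map_Cons: "letter_map l (j # w) = letter_act l j # ev (letter_sec l j) w"
  by (cases l) (simp_all add: ev_replicate)

lemma ev_Nil [simp]: "ev W [] = []"
proof (induction W)
  case (Cons l W) then show ?case by (cases l) auto
qed simp

lemma ev_Cons [simp]: "ev W (j # w) = act W j # ev (sec W j) w"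
proof (induction W arbitrary: j w)
  case (Cons l W) then show ?case by (simp add: letter_map_Cons del: letter_map.simps)
qed simp

lemma letter_act_bij: "bij_betw (letter_act l) {..<p} {..<p}"
proof (cases "l = La")
  case True
  have "inj_on (letter_act La) {..<p}"
  proof (rule inj_onI)
    fix i j assume ij: "i \<in> {..<p}" "j \<in> {..<p}" "letter_act La i = letter_act La j"
    then have "[i + 1 = j + 1] (mod p)" by (simp add: cong_def)
    then have "[i = j] (mod p)" by (simp only: cong_add_rcancel_nat)
    then show "i = j" using ij by (simp add: cong_def)
  qed
  moreover have "letter_act La ` {..<p} \<subseteq> {..<p}" by auto
  ultimately show ?thesis
    unfolding True bij_betw_def using endo_inj_surj[OF finite_lessThan] by blast
next
  case False
  then have "letter_act l = id" by (cases l) (auto simp: fun_eq_iff)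
  then show ?thesis by (simp add: bij_betw_id)
qed

lemma letter_act_less: "j < p \<Longrightarrow> letter_act l j < p"
  using bij_betwE[OF letter_act_bij] by auto

abbreviation "nA W \<equiv> count_list W La"
abbreviation "nB W \<equiv> count_list W Lb"
abbreviation "nC W \<equiv> count_list W Lc"

lemma act_eq: "j < p \<Longrightarrow> act W j = (j + nA W) mod p"
proof (induction W arbitrary: j)
  case (Cons l W)
  then show ?case using letter_act_less[OF Cons.prems, of l] by (cases l) (auto simp: mod_simps)
qed simp

lemma act_less: "j < p \<Longrightarrow> act W j < p"
  by (simp add: act_eq)

lemma act_inj: "i < p \<Longrightarrow> j < p \<Longrightarrow> act W i = act W j \<Longrightarrow> i = j"
proof -
  assume ij: "i < p" "j < p" "act W i = act W j"
  then have "[i + nA W = j + nA W] (mod p)" by (simp add: cong_def act_eq)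
  then have "[i = j] (mod p)" by (simp only: cong_add_rcancel_nat)
  then show "i = j" using ij by (simp add: cong_def)
qed

lemma act_surj: assumes "k < p" obtains j where "j < p" "act W j = k"
proof -
  have "act W ` {..<p} = {..<p}"
    by (rule endo_inj_surj) (auto simp: act_less intro!: inj_onI dest: act_inj)
  then show thesis using that assms by (metis imageE lessThan_iff)
qed

lemma ev_words: "v \<in> words p \<Longrightarrow> ev W v \<in> words p"
  by (induction v arbitrary: W) (auto simp: act_less)

lemma ev_inj: "v \<in> words p \<Longrightarrow> w \<in> words p \<Longrightarrow> ev W v = ev W w \<Longrightarrow> v = w"
proof (induction v arbitrary: w W)
  case Nil then show ?case by (cases w) auto
next
  case (Cons j v)
  then show ?case using act_inj by (cases w) (auto, metis)
qed

lemma ev_surj: "w \<in> words p \<Longrightarrow> \<exists>v\<in>words p. ev W v = w"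
proof (induction w arbitrary: W)
  case Nil then show ?case by (intro bexI[of _ "[]"]) auto
next
  case (Cons k w)
  then obtain j where j: "j < p" "act W j = k" using act_surj[of k W] Cons.prems by auto
  obtain v where "v \<in> words p" "ev (sec W j) v = w" using Cons by auto
  then show ?case using j by (intro bexI[of _ "j # v"]) auto
qed

lemma ev_extend: "\<exists>y. ev W (v @ [x]) = ev W v @ [y]"
  by (induction v arbitrary: W) auto

definition elt :: "letter list \<Rightarrow> nat list \<Rightarrow> nat list" where
  "elt W = restrict (ev W) (words p)"

lemma elt_apply [simp]: "v \<in> words p \<Longrightarrow> elt W v = ev W v"
  by (simp add: elt_def)

lemma elt_extensional [simp]: "elt W \<in> extensional (words p)"
  by (simp add: elt_def)

lemma elt_carrier [simp]: "elt W \<in> carrier (AutT p)"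
proof (rule AutT_carrierI)
  show "elt W \<in> Bij (words p)"
  proof -
    have "inj_on (elt W) (words p)" by (rule inj_onI) (auto dest: ev_inj)
    moreover have "words p \<subseteq> elt W ` words p"
    proof
      fix w assume "w \<in> words p"
      then obtain v where "v \<in> words p" "ev W v = w" using ev_surj by blast
      then show "w \<in> elt W ` words p" by (intro image_eqI[of _ _ v]) auto
    qed
    moreover have "elt W ` words p \<subseteq> words p" by (auto simp: ev_words)
    ultimately show ?thesis by (simp add: Bij_def bij_betw_def subset_antisym)
  qed
  show "\<exists>y. elt W (v @ [x]) = elt W v @ [y]" if "v @ [x] \<in> words p" for v x
    using that ev_extend by simp
qed simp

lemma elt_mult: "elt U \<cdot> elt V = elt (U @ V)"
  by (rule AutT_eqI[where p = p]) (auto simp: ev_words)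

lemma elt_Nil: "elt [] = \<one>\<^sub>T"
  by (rule AutT_eqI[where p = p]) (auto simp: AutT_one)

lemma elt_eq_one_iff: "elt W = \<one>\<^sub>T \<longleftrightarrow> (\<forall>v\<in>words p. ev W v = v)"
proof
  assume "elt W = \<one>\<^sub>T"
  then show "\<forall>v\<in>words p. ev W v = v" using elt_apply[of _ W] by (metis AutT_one_apply)
next
  assume "\<forall>v\<in>words p. ev W v = v"
  then show "elt W = \<one>\<^sub>T" by (intro AutT_eqI[where p = p]) (auto simp: AutT_one)
qed

lemma act_replicate: "l \<noteq> La \<Longrightarrow> act (replicate n l) j = j"
  by (induction n) (cases l; auto)+

lemma sec_replicate: "l \<noteq> La \<Longrightarrow> sec (replicate n l) j = concat (replicate n (letter_sec l j))"
  by (induction n) (cases l; auto)+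

lemma sec_replicate_La: "sec (replicate n La) j = []"
  by (induction n arbitrary: j) auto

lemma concat_replicate_replicate: "concat (replicate m (replicate n x)) = replicate (m * n) x"
  by (induction m) (auto simp: replicate_add)

lemma ev_La_pow: "v \<in> words p \<Longrightarrow> p dvd n \<Longrightarrow> ev (replicate n La) v = v"
  by (cases v) (auto simp: act_eq count_list_replicate sec_replicate_La)

lemma concat_replicate_single: "concat (replicate n [x]) = replicate n x"
  by (induction n) auto

lemma ev_letter_pow: "v \<in> words p \<Longrightarrow> ev (replicate p l) v = v"
proof (induction v)
  case (Cons j v)
  show ?case
  proof (cases "l = La")
    case True then show ?thesis using Cons.prems ev_La_pow[of "j # v" p] by simp
  next
    case False
    have "ev (concat (replicate p (letter_sec l j))) v = v"
      using False Cons ev_La_pow[of v]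
      by (cases l) (auto simp: concat_replicate_replicate concat_replicate_single)
    then show ?thesis using False by (simp add: act_replicate sec_replicate)
  qed
qed simp

fun inverse_word :: "letter list \<Rightarrow> letter list" where
  "inverse_word [] = []"
| "inverse_word (l # W) = inverse_word W @ replicate (p - 1) l"

lemma ev_inverse_word: "v \<in> words p \<Longrightarrow> ev (inverse_word W) (ev W v) = v"
proof (induction W arbitrary: v)
  case (Cons l W)
  have "ev [l] v \<in> words p" using Cons.prems by (rule ev_words)
  then have "ev (inverse_word (l # W)) (ev (l # W) v) = ev (replicate (p - 1) l) (ev [l] v)"
    using Cons.IH by simp
  also have "\<dots> = ev (l # replicate (p - 1) l) v" by simp
  also have "l # replicate (p - 1) l = replicate p l"
    using replicate_Suc[of "p - 1" l] by simp
  finally show ?case using ev_letter_pow[OF Cons.prems] by simp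
qed simp

lemma inv_elt: "inv\<^sub>T (elt W) = elt (inverse_word W)"
proof -
  interpret group "AutT p" by (rule AutT_group)
  have "elt W \<cdot> elt (inverse_word W) = \<one>\<^sub>T"
    by (rule AutT_eqI[where p = p]) (auto simp: AutT_one ev_inverse_word ev_words)
  then show ?thesis
    by (intro inv_equality) (auto simp: inv_comm)
qed

lemma count_inverse_word: "count_list (inverse_word W) l = (p - 1) * count_list W l"
  by (induction W) (auto simp: count_list_replicate)

lemma EGS_eq: "EGS p \<alpha> = range elt"
proof -
  interpret group "AutT p" by (rule AutT_group)
  have gens: "{restrict (a_map p) (words p), restrict (b_map p \<alpha>) (words p), restrict (c_map p \<alpha>) (words p)}
      = {elt [La], elt [Lb], elt [Lc]}"
  proof -
    have "ev [La] = a_map p" "ev [Lb] = b_map p \<alpha>" "ev [Lc] = c_map p \<alpha>" by auto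
    then show ?thesis by (simp add: elt_def)
  qed
  have letters: "elt [l] \<in> generate (AutT p) {elt [La], elt [Lb], elt [Lc]}" for l
    by (cases l) (auto intro: generate.incl)
  have "elt W \<in> generate (AutT p) {elt [La], elt [Lb], elt [Lc]}" for W
  proof (induction W)
    case Nil then show ?case by (simp add: elt_Nil generate.one)
  next
    case (Cons l W)
    then have "elt [l] \<cdot> elt W \<in> generate (AutT p) {elt [La], elt [Lb], elt [Lc]}"
      by (intro generate.eng letters)
    then show ?case by (simp add: elt_mult)
  qed
  moreover have "generate (AutT p) {elt [La], elt [Lb], elt [Lc]} \<subseteq> range elt"
  proof (rule generate_subgroup_incl)
    show "subgroup (range elt) (AutT p)"
    proof (rule subgroupI)
      show "inv\<^sub>T x \<in> range elt" if "x \<in> range elt" for x using that by (auto simp: inv_elt)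
      show "x \<cdot> y \<in> range elt" if "x \<in> range elt" "y \<in> range elt" for x y
        using that by (auto simp: elt_mult)
    qed auto
  qed auto
  ultimately show ?thesis unfolding EGS_def gens by auto
qed

lemma elt_eq_spread_sec:
  assumes "p dvd nA W" shows "elt W = spread p (\<lambda>j. elt (sec W j))"
  by (rule spread_eqI) (use assms in \<open>auto simp: act_eq\<close>)

text \<open>The vector \<open>\<alpha>\<close> with the entry \<open>0\<close> at \<open>0\<close>, extended periodically. With this convention the section of a
  conjugate of \<open>b\<close> or \<open>c\<close> by a power of \<open>a\<close>, at distance \<open>k\<close> from the place where \<open>b\<close> or \<open>c\<close> occurs, contributes
  \<open>alpha_at k\<close> letters \<open>a\<close>.\<close>

definition alpha_at :: "int \<Rightarrow> int" where
  "alpha_at k = (if int p dvd k then 0 else int (\<alpha> (nat (k mod int p))))"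

lemma alpha_at_cong: "[k = l] (mod int p) \<Longrightarrow> alpha_at k = alpha_at l"
  by (simp add: alpha_at_def cong_def dvd_eq_mod_eq_0)

lemma alpha_at_range: "0 \<le> alpha_at k" "alpha_at k < int p"
proof -
  have "0 \<le> k mod int p" "k mod int p < int p" by simp_all
  then obtain n where n: "k mod int p = int n" "n < p" using nonneg_int_cases by (metis of_nat_less_iff)
  then have "nat (k mod int p) \<in> {1..p - 1}" if "\<not> int p dvd k"
    using that by (cases "n = 0") (auto simp: dvd_eq_mod_eq_0)
  then show "alpha_at k < int p" using GF by (auto simp: alpha_at_def GF_vector_def)
qed (simp add: alpha_at_def)

lemma alpha_at_nat:
  assumes "0 < i" "i < p" shows "alpha_at (int i) = int (\<alpha> i)"
proof -
  have "\<not> int p dvd int i" using assms by (auto dest: nat_dvd_not_less)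
  moreover have "int i mod int p = int i" using assms by simp
  ultimately show ?thesis unfolding alpha_at_def by simp
qed

lemma alpha_at_0 [simp]: "alpha_at 0 = 0"
  by (simp add: alpha_at_def)

lemma nonsymmetric_alpha_at: obtains i where "\<not> int p dvd i" "\<not> [alpha_at i = alpha_at (- i)] (mod int p)"
proof -
  obtain i where i: "i \<in> {1..(p - 1) div 2}" "\<alpha> i \<noteq> \<alpha> (p - i)"
    using nonsymmetric by (auto simp: symmetric_vector_def)
  then have ip: "0 < i" "i < p" by auto
  then have nd: "\<not> int p dvd int i" "\<not> int p dvd - int i" by (auto simp: nat_dvd_not_less)
  have "alpha_at (int i) = \<alpha> i" using nd ip by (simp add: alpha_at_def)
  moreover have "(- int i) mod int p = int (p - i)"
    using ip by (simp add: zmod_zminus1_eq_if of_nat_diff)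
  then have "alpha_at (- int i) = \<alpha> (p - i)" using nd by (simp add: alpha_at_def)
  ultimately have "\<not> [alpha_at (int i) = alpha_at (- int i)] (mod int p)"
    using cong_less_imp_eq_int[OF alpha_at_range alpha_at_range, of "int i" "- int i"] i(2) by auto
  then show thesis by (rule that[OF nd(1)])
qed

lemma alpha_at_nonzero: obtains i where "\<not> int p dvd alpha_at i"
proof -
  obtain i where "\<not> [alpha_at i = alpha_at (- i)] (mod int p)" using nonsymmetric_alpha_at .
  then have "\<not> int p dvd alpha_at i \<or> \<not> int p dvd alpha_at (- i)" by (auto simp: cong_iff_dvd_diff)
  then show thesis using that by blast
qed

abbreviation "weight W \<equiv> nB W + nC W"

lemma sum_nB_sec: "(\<Sum>j<p. nB (sec W j)) = nB W"
proof (induction W)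
  case (Cons l W)
  have "(\<Sum>j<p. nB (sec W (letter_act l j))) = (\<Sum>j<p. nB (sec W j))"
    by (rule sum.reindex_bij_betw[OF letter_act_bij])
  moreover have "(\<Sum>j<p. nB (letter_sec l j)) = (if l = Lb then 1 else 0)"
    by (cases l) (simp_all add: count_list_replicate if_distrib[of "\<lambda>W. count_list W _"] cong: if_cong)
  ultimately show ?case using Cons by (simp add: sum.distrib)
qed simp

lemma sum_nC_sec: "(\<Sum>j<p. nC (sec W j)) = nC W"
proof (induction W)
  case (Cons l W)
  have "(\<Sum>j<p. nC (sec W (letter_act l j))) = (\<Sum>j<p. nC (sec W j))"
    by (rule sum.reindex_bij_betw[OF letter_act_bij])
  moreover have "(\<Sum>j<p. nC (letter_sec l j)) = (if l = Lc then 1 else 0)"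
    by (cases l) (simp_all add: count_list_replicate if_distrib[of "\<lambda>W. count_list W _"] cong: if_cong)
  ultimately show ?case using Cons by (simp add: sum.distrib)
qed simp

lemma int_p_minus_1: "int (p - Suc 0) = int p - 1"
  using of_nat_diff[of 1 p] p_ge_3 by simp

lemma nA_letter_sec:
  assumes "j < p"
  shows "int (nA (letter_sec l j)) = (\<Sum>i<p. alpha_at (int j - int i) * int (weight (letter_sec l i)))"
proof (cases l)
  case La then show ?thesis by simp
next
  case Lb
  have "(\<Sum>i<p. alpha_at (int j - int i) * int (weight (letter_sec l i)))
      = (\<Sum>i<p. if i = p - 1 then alpha_at (int j - int (p - 1)) else 0)"
    by (rule sum.cong) (auto simp: Lb count_list_replicate)
  also have "\<dots> = alpha_at (int j - int (p - 1))" by simp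
  also have "\<dots> = int (nA (letter_sec l j))"
  proof (cases "j = p - 1")
    case True then show ?thesis by (simp add: Lb alpha_at_def)
  next
    case False
    then have j: "j + 1 < p" using assms by simp
    have "alpha_at (int j - int (p - 1)) = alpha_at (int (j + 1))"
      by (rule alpha_at_cong) (simp add: cong_iff_dvd_diff int_p_minus_1)
    also have "\<dots> = int (\<alpha> (j + 1))"
      using j by (intro alpha_at_nat) auto
    finally show ?thesis using False by (simp add: Lb count_list_replicate)
  qed
  finally show ?thesis by simp
next
  case Lc
  have "(\<Sum>i<p. alpha_at (int j - int i) * int (weight (letter_sec l i)))
      = (\<Sum>i<p. if i = 0 then alpha_at (int j) else 0)"
    by (rule sum.cong) (auto simp: Lc count_list_replicate)
  also have "\<dots> = alpha_at (int j)" by simp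
  also have "\<dots> = int (nA (letter_sec l j))"
    using assms alpha_at_nat[of j] by (cases "j = 0") (simp_all add: Lc count_list_replicate)
  finally show ?thesis by simp
qed

lemma alpha_at_letter_act: "alpha_at (int (letter_act l j) - int (letter_act l i)) = alpha_at (int j - int i)"
proof (cases l)
  case La
  have "[int ((j + 1) mod p) - int ((i + 1) mod p) = int (j + 1) - int (i + 1)] (mod int p)"
    by (intro cong_diff) (simp_all add: of_nat_mod cong_def)
  then show ?thesis using La by (intro alpha_at_cong) simp
qed simp_all

text \<open>Every letter \<open>b\<close> or \<open>c\<close> of \<open>W\<close> passes to exactly one section, and to the other sections it contributes
  powers of \<open>a\<close> that depend only on the relative position. Reading a letter \<open>a\<close> rotates all places
  simultaneously, which does not change relative positions.\<close>

lemma nA_sec: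
  assumes "j < p"
  shows "int (nA (sec W j)) = (\<Sum>i<p. alpha_at (int j - int i) * int (weight (sec W i)))"
  using assms
proof (induction W arbitrary: j)
  case (Cons l W)
  have "int (nA (sec W (letter_act l j)))
      = (\<Sum>i<p. alpha_at (int (letter_act l j) - int i) * int (weight (sec W i)))"
    using Cons letter_act_less by blast
  also have "\<dots> = (\<Sum>i<p. alpha_at (int (letter_act l j) - int (letter_act l i)) * int (weight (sec W (letter_act l i))))"
    by (rule sum.reindex_bij_betw[OF letter_act_bij, symmetric])
  finally have "int (nA (sec W (letter_act l j)))
      = (\<Sum>i<p. alpha_at (int j - int i) * int (weight (sec W (letter_act l i))))"
    by (simp only: alpha_at_letter_act)
  then show ?case
    using nA_letter_sec[OF Cons.prems, of l] by (simp add: sum.distrib algebra_simps)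
qed simp

lemma sum_weight_sec: "(\<Sum>j<p. weight (sec W j)) = weight W"
  by (simp add: sum.distrib sum_nB_sec sum_nC_sec)

lemma weight_sec_le: "j < p \<Longrightarrow> weight (sec W j) \<le> weight W"
  using member_le_sum[of j "{..<p}" "\<lambda>j. weight (sec W j)"] by (simp add: sum_weight_sec)

definition trivial_word :: "letter list \<Rightarrow> bool" where
  "trivial_word W \<longleftrightarrow> (\<forall>v\<in>words p. ev W v = v)"

lemma trivial_word_sec: "trivial_word W \<Longrightarrow> j < p \<Longrightarrow> trivial_word (sec W j)"
  unfolding trivial_word_def by (metis Cons_in_words ev_Cons list.inject)

lemma trivial_word_nA: assumes "trivial_word W" shows "p dvd nA W"
proof -
  have "ev W [0] = [0]" by (rule bspec[OF assms[unfolded trivial_word_def]]) simp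
  then show ?thesis by (simp add: act_eq dvd_eq_mod_eq_0)
qed

text \<open>If no letter \<open>b\<close> or \<open>c\<close> is lost on the way to place \<open>j\<close>, then each of them passes to place \<open>j\<close> as itself, and
  none is replaced by a power of \<open>a\<close>.\<close>

lemma concentrated_no_La:
  assumes "j < p" "weight (sec W j) = weight W" shows "La \<notin> set (sec W j)"
  using assms
proof (induction W arbitrary: j)
  case (Cons l W)
  have 1: "weight (sec W (letter_act l j)) \<le> weight W"
    using Cons.prems letter_act_less by (intro weight_sec_le)
  have eq: "weight (letter_sec l j) + weight (sec W (letter_act l j)) = weight [l] + weight W"
  proof -
    have "weight (sec (l # W) j) = weight (letter_sec l j) + weight (sec W (letter_act l j))" by simp
    moreover have "weight (l # W) = weight [l] + weight W" by simp
    ultimately show ?thesis using Cons.prems(2) by linarith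
  qed
  moreover have 2: "weight (letter_sec l j) \<le> weight [l]" by (cases l) (auto simp: count_list_replicate)
  ultimately have "weight (sec W (letter_act l j)) = weight W" using 1 by linarith
  then have IH: "La \<notin> set (sec W (letter_act l j))"
    by (rule Cons.IH[OF letter_act_less[OF Cons.prems(1)]])
  have "weight (letter_sec l j) = weight [l]" using eq 1 2 by linarith
  then have "La \<notin> set (letter_sec l j)" by (cases l) (auto simp: count_list_replicate split: if_splits)
  then show ?case using IH by simp
qed simp

lemma no_La_sec:
  assumes "La \<notin> set U" "k < p"
  shows "k \<noteq> p - 1 \<Longrightarrow> nB (sec U k) = 0" "k \<noteq> 0 \<Longrightarrow> nC (sec U k) = 0"
proof -
  have "(k \<noteq> p - 1 \<longrightarrow> nB (sec U k) = 0) \<and> (k \<noteq> 0 \<longrightarrow> nC (sec U k) = 0)"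
    using assms
  proof (induction U)
    case (Cons l U)
    then show ?case by (cases l) (auto simp: count_list_replicate)
  qed simp
  then show "k \<noteq> p - 1 \<Longrightarrow> nB (sec U k) = 0" "k \<noteq> 0 \<Longrightarrow> nC (sec U k) = 0" by auto
qed

text \<open>All the weight sits at place \<open>j\<close>, so the number of letters \<open>a\<close> in the section at \<open>i\<close> is \<open>weight W\<close> times a single
  entry of the vector. That number is divisible by \<open>p\<close> for a trivial word, and some entry is a unit.\<close>

lemma concentrated_weight_dvd:
  assumes "trivial_word W" "j < p" "weight (sec W j) = weight W"
  shows "p dvd weight W"
proof -
  have "(\<Sum>i\<in>{..<p} - {j}. weight (sec W i)) = 0"
    using sum_weight_sec[of W] assms(2,3) by (simp add: sum.remove[of "{..<p}" j])
  then have others: "weight (sec W i) = 0" if "i < p" "i \<noteq> j" for i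
    using that by (simp add: sum_eq_0_iff)
  obtain k0 where k0: "\<not> int p dvd alpha_at k0" using alpha_at_nonzero .
  define i where "i = nat ((k0 + int j) mod int p)"
  have i: "i < p" "int i = (k0 + int j) mod int p" by (simp_all add: i_def nat_less_iff)
  have "[int i - int j = k0] (mod int p)" unfolding i(2) by (simp add: cong_def mod_simps)
  then have ai: "alpha_at (int i - int j) = alpha_at k0" by (rule alpha_at_cong)
  have "int (nA (sec W i)) = (\<Sum>m<p. if m = j then alpha_at (int i - int j) * int (weight W) else 0)"
    unfolding nA_sec[OF i(1)] by (rule sum.cong) (use others assms(3) in auto)
  also have "\<dots> = alpha_at k0 * int (weight W)" using assms(2) ai by simp
  finally have "int (nA (sec W i)) = alpha_at k0 * int (weight W)" .
  then have "int p dvd alpha_at k0 * int (weight W)"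
    using trivial_word_nA[OF trivial_word_sec[OF assms(1) i(1)]]
    by (metis int_dvd_int_iff)
  moreover have "prime (int p)" using prime_p by simp
  ultimately have "int p dvd int (weight W)" using k0 prime_dvd_multD by blast
  then show ?thesis by (simp only: int_dvd_int_iff)
qed

text \<open>The exponents of \<open>b\<close> and \<open>c\<close> are well defined modulo \<open>p\<close>. Sections of a trivial word are trivial and add up to
  the same exponents, so induction on the weight applies unless all the weight passes to one section \<open>U\<close>.
  That section contains no letter \<open>a\<close>, and hence its own sections separate the letters \<open>b\<close> (at \<open>p - 1\<close>) from
  the letters \<open>c\<close> (at \<open>0\<close>): either the weight drops now, or only one of the two letters occurs and the total
  weight is divisible by \<open>p\<close>.\<close>

lemma trivial_word_dvd: "trivial_word W \<Longrightarrow> p dvd nB W \<and> p dvd nC W"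
proof (induction "weight W" arbitrary: W rule: less_induct)
  case less
  have descend: "p dvd nB V \<and> p dvd nC V"
    if "trivial_word V" "\<And>j. j < p \<Longrightarrow> p dvd nB (sec V j) \<and> p dvd nC (sec V j)" for V
    unfolding sum_nB_sec[of V, symmetric] sum_nC_sec[of V, symmetric] using that(2) by (auto intro!: dvd_sum)
  show ?case
  proof (cases "\<exists>j<p. weight (sec W j) = weight W")
    case False
    then have "weight (sec W j) < weight W" if "j < p" for j
      using weight_sec_le[OF that, of W] that by (meson le_neq_implies_less)
    then show ?thesis
      using less.hyps trivial_word_sec[OF less.prems] by (intro descend[OF less.prems]) blast
  next
    case True
    then obtain j where j: "j < p" "weight (sec W j) = weight W" by blast
    define U where "U = sec W j"
    have U: "trivial_word U" "La \<notin> set U" "weight U = weight W"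
      using trivial_word_sec[OF less.prems j(1)] concentrated_no_La[OF j] j(2) by (auto simp: U_def)
    have le: "nB U \<le> nB W" "nC U \<le> nC W"
      using member_le_sum[of j "{..<p}" "\<lambda>j. nB (sec W j)"] member_le_sum[of j "{..<p}" "\<lambda>j. nC (sec W j)"]
        j(1) sum_nB_sec[of W] sum_nC_sec[of W] by (auto simp: U_def)
    then have nU: "nB U = nB W" "nC U = nC W" using U(3) by linarith+
    have "p dvd nB U \<and> p dvd nC U"
    proof (cases "\<exists>k<p. weight (sec U k) = weight U")
      case False
      then have "weight (sec U k) < weight W" if "k < p" for k
        using weight_sec_le[OF that, of U] U(3) that by (metis le_neq_implies_less)
      then show ?thesis
        using less.hyps trivial_word_sec[OF U(1)] by (intro descend[OF U(1)]) blast
    next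
      case True
      then obtain k where k: "k < p" "weight (sec U k) = weight U" by blast
      have dvd: "p dvd weight U" by (rule concentrated_weight_dvd[OF U(1) k])
      have leU: "nB (sec U k) \<le> nB U" "nC (sec U k) \<le> nC U"
        using member_le_sum[of k "{..<p}" "\<lambda>j. nB (sec U j)"] member_le_sum[of k "{..<p}" "\<lambda>j. nC (sec U j)"]
          k(1) sum_nB_sec[of U] sum_nC_sec[of U] by auto
      have "nB U = 0 \<or> nC U = 0"
        using no_La_sec[OF U(2) k(1)] leU k(2) p_gt_1 by (cases "k = 0") auto
      then show ?thesis using dvd by auto
    qed
    then show ?thesis using nU by simp
  qed
qed

lemma count_cong_of_elt_eq:
  assumes "elt U = elt V"
  shows "[nA U = nA V] (mod p)" "[nB U = nB V] (mod p)" "[nC U = nC V] (mod p)"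
proof -
  interpret group "AutT p" by (rule AutT_group)
  have "elt (U @ inverse_word V) = \<one>\<^sub>T"
    using assms by (simp add: inv_elt[symmetric] elt_mult[symmetric])
  then have "trivial_word (U @ inverse_word V)" by (simp add: elt_eq_one_iff trivial_word_def)
  then have dvd: "p dvd count_list U l + (p - 1) * count_list V l" for l
    using trivial_word_nA[of "U @ inverse_word V"] trivial_word_dvd[of "U @ inverse_word V"]
    by (cases l) (auto simp: count_inverse_word)
  have "[count_list U l = count_list V l] (mod p)" for l
  proof -
    have "[count_list U l + (p - 1) * count_list V l = p * count_list V l] (mod p)"
      using dvd[of l] by (simp add: cong_def dvd_eq_mod_eq_0)
    also have "p * count_list V l = count_list V l + (p - 1) * count_list V l"
      using p_pos by (cases p) auto
    finally show ?thesis by (simp only: cong_add_rcancel_nat)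
  qed
  then show "[nA U = nA V] (mod p)" "[nB U = nB V] (mod p)" "[nC U = nC V] (mod p)" by auto
qed

section \<open>The abelianization\<close>

abbreviation "\<Gamma> \<equiv> EGS p \<alpha>"
abbreviation "GG \<equiv> EGS_group p \<alpha>"

interpretation T: group "AutT p" by (rule AutT_group)

lemma elt_in_EGS [simp]: "elt W \<in> \<Gamma>"
  by (simp add: EGS_eq)

lemma EGS_elim: assumes "g \<in> \<Gamma>" obtains W where "g = elt W"
  using assms by (auto simp: EGS_eq)

lemma EGS_generators: "\<Gamma> = generate (AutT p) {elt [La], elt [Lb], elt [Lc]}"
proof -
  have "ev [La] = a_map p" "ev [Lb] = b_map p \<alpha>" "ev [Lc] = c_map p \<alpha>" by auto
  then show ?thesis by (simp add: elt_def EGS_def)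
qed

lemma EGS_subgroup: "subgroup \<Gamma> (AutT p)"
  unfolding EGS_generators by (rule T.generate_is_subgroup) auto

lemma EGS_carrier: "g \<in> \<Gamma> \<Longrightarrow> g \<in> carrier (AutT p)"
  by (rule subgroup.mem_carrier[OF EGS_subgroup])

lemma EGS_group_simps [simp]:
  "carrier GG = \<Gamma>" "x \<otimes>\<^bsub>GG\<^esub> y = x \<cdot> y" "\<one>\<^bsub>GG\<^esub> = \<one>\<^sub>T"
  by (simp_all add: EGS_group_def)

lemma EGS_group_group: "group GG"
  unfolding EGS_group_def by (rule subgroup.subgroup_is_group[OF EGS_subgroup AutT_group])

interpretation GG: group GG by (rule EGS_group_group)

lemma EGS_inv [simp]: "g \<in> \<Gamma> \<Longrightarrow> inv\<^bsub>GG\<^esub> g = inv\<^sub>T g"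
  unfolding EGS_group_def by (rule T.m_inv_consistent[OF EGS_subgroup])

lemma EGS_closed:
  "\<one>\<^sub>T \<in> \<Gamma>"
  "g \<in> \<Gamma> \<Longrightarrow> h \<in> \<Gamma> \<Longrightarrow> g \<cdot> h \<in> \<Gamma>"
  "g \<in> \<Gamma> \<Longrightarrow> inv\<^sub>T g \<in> \<Gamma>"
  by (fact subgroup.one_closed[OF EGS_subgroup] subgroup.m_closed[OF EGS_subgroup]
      subgroup.m_inv_closed[OF EGS_subgroup])+

text \<open>The choice of the word is irrelevant modulo \<open>p\<close>, by \<open>count_cong_of_elt_eq\<close>.\<close>

definition letter_exp :: "letter \<Rightarrow> (nat list \<Rightarrow> nat list) \<Rightarrow> nat" where
  "letter_exp l g = count_list (SOME W. elt W = g) l mod p"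

lemma letter_exp_elt: "letter_exp l (elt W) = count_list W l mod p"
proof -
  have "elt (SOME V. elt V = elt W) = elt W" by (rule someI) simp
  then show ?thesis
    using count_cong_of_elt_eq[of "SOME V. elt V = elt W" W] unfolding letter_exp_def cong_def by (cases l) auto
qed

lemma letter_exp_less [simp]: "letter_exp l g < p"
  by (simp add: letter_exp_def)

lemma letter_exp_mult:
  "g \<in> \<Gamma> \<Longrightarrow> h \<in> \<Gamma> \<Longrightarrow> letter_exp l (g \<cdot> h) = (letter_exp l g + letter_exp l h) mod p"
  by (elim EGS_elim) (simp add: elt_mult letter_exp_elt mod_simps)

lemma letter_exp_one: "letter_exp l \<one>\<^sub>T = 0"
  using letter_exp_elt[of l "[]"] by (simp add: elt_Nil)

lemma letter_exp_inv:
  assumes "g \<in> \<Gamma>" shows "(letter_exp l (inv\<^sub>T g) + letter_exp l g) mod p = 0"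
  using letter_exp_mult[OF EGS_closed(3)[OF assms] assms, of l] EGS_carrier[OF assms]
  by (simp add: letter_exp_one)

lemma letter_exp_pow:
  "g \<in> \<Gamma> \<Longrightarrow> g [^]\<^bsub>GG\<^esub> (n::nat) \<in> \<Gamma> \<and> letter_exp l (g [^]\<^bsub>GG\<^esub> n) = (n * letter_exp l g) mod p"
proof (induction n)
  case 0 then show ?case by (simp add: letter_exp_one EGS_closed)
next
  case (Suc n)
  then have "letter_exp l (g [^]\<^bsub>GG\<^esub> Suc n) = (letter_exp l (g [^]\<^bsub>GG\<^esub> n) + letter_exp l g) mod p"
    by (simp add: letter_exp_mult)
  then show ?case using Suc by (simp add: EGS_closed mod_simps add.commute)
qed

lemma elt_replicate_dvd:
  assumes "p dvd n" shows "elt (replicate n l) = \<one>\<^sub>T"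
proof -
  obtain m where n: "n = p * m" using assms by blast
  have "ev (replicate n l) v = v" if v: "v \<in> words p" for v
  proof -
    have "((letter_map l ^^ p) ^^ k) v = v" for k
    proof (induction k)
      case (Suc k)
      then show ?case using ev_letter_pow[OF v, of l] by (simp add: ev_replicate)
    qed simp
    then show ?thesis by (simp add: n ev_replicate funpow_mult)
  qed
  then show ?thesis by (simp add: elt_eq_one_iff)
qed

lemma elt_single_pow: "elt [l] [^]\<^bsub>GG\<^esub> n = elt (replicate n l)"
  by (induction n) (auto simp: elt_Nil elt_mult replicate_append_same)

lemma derived_EGS_group: "derived (AutT p) \<Gamma> = derived GG (carrier GG)"
  unfolding EGS_group_def using T.derived_consistent[OF _ EGS_subgroup, of \<Gamma>] by simp

text \<open>In the abelian quotient a word can be sorted into \<open>a\<^sup>i b\<^sup>j c\<^sup>k\<close>, which is trivial when \<open>p\<close> divides the three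
  exponents. Conversely the exponents are homomorphisms into an abelian group.\<close>

lemma derived_eq: "derived (AutT p) \<Gamma> = {g \<in> \<Gamma>. \<forall>l. letter_exp l g = 0}"
proof (intro equalityI subsetI)
  have sub: "subgroup {g \<in> \<Gamma>. \<forall>l. letter_exp l g = 0} (AutT p)"
  proof (rule T.subgroupI)
    show "{g \<in> \<Gamma>. \<forall>l. letter_exp l g = 0} \<noteq> {}" using EGS_closed(1) letter_exp_one by blast
    show "inv\<^sub>T g \<in> {g \<in> \<Gamma>. \<forall>l. letter_exp l g = 0}" if "g \<in> {g \<in> \<Gamma>. \<forall>l. letter_exp l g = 0}" for g
      using that letter_exp_inv[of g] EGS_closed(3) by auto
    show "g \<cdot> h \<in> {g \<in> \<Gamma>. \<forall>l. letter_exp l g = 0}"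
      if "g \<in> {g \<in> \<Gamma>. \<forall>l. letter_exp l g = 0}" "h \<in> {g \<in> \<Gamma>. \<forall>l. letter_exp l g = 0}" for g h
      using that EGS_closed(2) by (auto simp: letter_exp_mult)
  qed (use EGS_carrier in auto)
  have "comm_of (AutT p) g h \<in> {g \<in> \<Gamma>. \<forall>l. letter_exp l g = 0}" if gh: "g \<in> \<Gamma>" "h \<in> \<Gamma>" for g h
  proof -
    have "letter_exp l (comm_of (AutT p) g h)
        = (letter_exp l g + letter_exp l h + letter_exp l (inv\<^sub>T g) + letter_exp l (inv\<^sub>T h)) mod p" for l
      using gh by (simp add: letter_exp_mult EGS_closed mod_simps)
    moreover have "p dvd letter_exp l g + letter_exp l h + letter_exp l (inv\<^sub>T g) + letter_exp l (inv\<^sub>T h)" for l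
    proof -
      have "p dvd (letter_exp l (inv\<^sub>T g) + letter_exp l g) + (letter_exp l (inv\<^sub>T h) + letter_exp l h)"
        by (rule dvd_add[OF mod_0_imp_dvd[OF letter_exp_inv[OF gh(1)]] mod_0_imp_dvd[OF letter_exp_inv[OF gh(2)]]])
      then show ?thesis by (simp only: add_ac)
    qed
    ultimately have "letter_exp l (comm_of (AutT p) g h) = 0" for l
      by (simp only: dvd_eq_mod_eq_0)
    then show ?thesis using gh by (simp add: EGS_closed)
  qed
  then have "derived_set (AutT p) \<Gamma> \<subseteq> {g \<in> \<Gamma>. \<forall>l. letter_exp l g = 0}"
    by (intro UN_least) (simp only: insert_subset empty_subsetI simp_thms)
  then have "derived (AutT p) \<Gamma> \<subseteq> {g \<in> \<Gamma>. \<forall>l. letter_exp l g = 0}"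
    unfolding derived_def by (rule T.generate_subgroup_incl) (rule sub)
  then show "g \<in> derived (AutT p) \<Gamma> \<Longrightarrow> g \<in> {g \<in> \<Gamma>. \<forall>l. letter_exp l g = 0}" for g by blast
next
  fix g assume g: "g \<in> {g \<in> \<Gamma>. \<forall>l. letter_exp l g = 0}"
  define D where "D = derived GG (carrier GG)"
  have Dn: "D \<lhd> GG" unfolding D_def by (rule GG.derived_self_is_normal)
  interpret D: normal D GG by (rule Dn)
  interpret Q: comm_group "GG Mod D" unfolding D_def by (rule GG.derived_quot_is_comm_group)
  interpret h: group_hom GG "GG Mod D" "(#>\<^bsub>GG\<^esub>) D"
    by (simp add: group_hom_def group_hom_axioms_def EGS_group_group Q.is_group D.r_coset_hom_Mod)
  define h where "h = (#>\<^bsub>GG\<^esub>) D"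
  have hc: "h (elt W) \<in> carrier (GG Mod D)" for W using h.hom_closed[of "elt W"] by (simp add: h_def)
  have hm: "h (elt (U @ W)) = h (elt U) \<otimes>\<^bsub>GG Mod D\<^esub> h (elt W)" for U W
    using h.hom_mult[of "elt U" "elt W"] by (simp add: h_def elt_mult)
  have h1: "h (elt []) = \<one>\<^bsub>GG Mod D\<^esub>" using h.hom_one by (simp add: h_def elt_Nil)
  have sort: "h (elt W) = h (elt (replicate (nA W) La)) \<otimes>\<^bsub>GG Mod D\<^esub>
      (h (elt (replicate (nB W) Lb)) \<otimes>\<^bsub>GG Mod D\<^esub> h (elt (replicate (nC W) Lc)))" for W
  proof (induction W)
    case Nil then show ?case by (simp add: h1 del: one_FactGroup mult_FactGroup)
  next
    case (Cons l W)
    have 1: "h (elt (l # W)) = h (elt [l]) \<otimes>\<^bsub>GG Mod D\<^esub> h (elt W)" for l W using hm[of "[l]" W] by simp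
    show ?case
      unfolding 1[of l W] Cons.IH using hc 1[of _ "replicate _ _"]
      by (cases l) (simp_all add: Q.m_ac del: one_FactGroup mult_FactGroup)
  qed
  obtain W where W: "g = elt W" using g by (auto elim: EGS_elim)
  then have "p dvd count_list W l" for l using g letter_exp_elt[of l W] by (auto simp: dvd_eq_mod_eq_0)
  then have "h g = \<one>\<^bsub>GG Mod D\<^esub>"
    unfolding W sort[of W] using h1 by (simp add: elt_replicate_dvd elt_Nil del: one_FactGroup mult_FactGroup)
  then have "D #>\<^bsub>GG\<^esub> g = D" by (simp add: h_def)
  then have "g \<in> D" using GG.coset_join1[OF _ _ D.is_subgroup] g by auto
  then show "g \<in> derived (AutT p) \<Gamma>" by (simp add: D_def derived_EGS_group)
qed

section \<open>Rigid elements and commutators\<close>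

text \<open>Only the values at \<open>0, \<dots>, p - 1\<close> matter.\<close>

definition EGS_tuples :: "(nat \<Rightarrow> nat list \<Rightarrow> nat list) set" where
  "EGS_tuples = {t. (\<forall>j<p. t j \<in> \<Gamma>) \<and> spread p t \<in> \<Gamma>}"

lemma EGS_tuplesD: "t \<in> EGS_tuples \<Longrightarrow> j < p \<Longrightarrow> t j \<in> \<Gamma>" "t \<in> EGS_tuples \<Longrightarrow> spread p t \<in> \<Gamma>"
  by (auto simp: EGS_tuples_def)

lemma EGS_tuples_mult:
  assumes "s \<in> EGS_tuples" "t \<in> EGS_tuples"
  shows "(\<lambda>j. s j \<cdot> t j) \<in> EGS_tuples"
proof -
  have "spread p (\<lambda>j. s j \<cdot> t j) = spread p s \<cdot> spread p t"
    using EGS_tuplesD(1)[OF assms(1)] EGS_carrier by (intro spread_mult[symmetric]) blast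
  then show ?thesis using assms unfolding EGS_tuples_def by (auto intro!: EGS_closed)
qed

lemma EGS_tuples_inv:
  assumes "t \<in> EGS_tuples"
  shows "(\<lambda>j. inv\<^sub>T (t j)) \<in> EGS_tuples"
proof -
  have "spread p (\<lambda>j. inv\<^sub>T (t j)) = inv\<^sub>T (spread p t)"
    using EGS_tuplesD(1)[OF assms] EGS_carrier by (intro spread_inv[symmetric]) blast
  then show ?thesis using assms unfolding EGS_tuples_def by (auto intro!: EGS_closed)
qed

lemma EGS_tuples_rotate1:
  assumes "t \<in> EGS_tuples" shows "(\<lambda>j. t ((j + 1) mod p)) \<in> EGS_tuples"
proof -
  define a where "a = elt [La]"
  have a: "a \<in> \<Gamma>" "a \<in> carrier (AutT p)" by (simp_all add: a_def)
  have ts: "spread p t \<in> carrier (AutT p)" using EGS_tuplesD(2)[OF assms] by (rule EGS_carrier)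
  have "a \<cdot> spread p t = spread p (\<lambda>j. t ((j + 1) mod p)) \<cdot> a"
  proof (rule AutT_eqI[where p = p])
    fix v assume v: "v \<in> words p"
    show "(a \<cdot> spread p t) v = (spread p (\<lambda>j. t ((j + 1) mod p)) \<cdot> a) v"
    proof (cases v)
      case (Cons j w)
      then have j: "j < p" "w \<in> words p" using v by auto
      then have "t ((j + 1) mod p) w \<in> words p"
        using EGS_tuplesD(1)[OF assms, of "(j + 1) mod p"] EGS_carrier AutT_carrierD(6) by simp
      then show ?thesis using v j Cons by (simp add: a_def del: ev_Cons)
    qed (simp add: a_def)
  qed auto
  moreover have "spread p (\<lambda>j. t ((j + 1) mod p)) \<in> carrier (AutT p)"
    using EGS_tuplesD(1)[OF assms] EGS_carrier by (intro spread_carrier) simp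
  ultimately have "spread p (\<lambda>j. t ((j + 1) mod p)) = a \<cdot> spread p t \<cdot> inv\<^sub>T a"
    using a ts by (intro iffD2[OF T.inv_solve_right]) auto
  then show ?thesis using assms a unfolding EGS_tuples_def by (auto intro!: EGS_closed)
qed

lemma EGS_tuples_rotate:
  assumes "t \<in> EGS_tuples" shows "(\<lambda>j. t ((j + m) mod p)) \<in> EGS_tuples"
proof (induction m)
  case 0
  have "spread p (\<lambda>j. t ((j + 0) mod p)) = spread p t" by (rule spread_cong) simp
  then show ?case using assms by (simp add: EGS_tuples_def)
next
  case (Suc m)
  have "(\<lambda>j. t (((j + 1) mod p + m) mod p)) \<in> EGS_tuples"
    using EGS_tuples_rotate1[OF Suc.IH] .
  moreover have "((j + 1) mod p + m) mod p = (j + Suc m) mod p" for j by (simp add: mod_simps)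
  ultimately show ?case by simp
qed

lemma sec_in_EGS_tuples: "p dvd nA W \<Longrightarrow> (\<lambda>j. elt (sec W j)) \<in> EGS_tuples"
  using elt_eq_spread_sec[of W] elt_in_EGS[of W] by (simp add: EGS_tuples_def)

lemma EGS_tuples_cong:
  assumes "t \<in> EGS_tuples" "\<And>j. j < p \<Longrightarrow> s j = t j" shows "s \<in> EGS_tuples"
  using assms spread_cong[of p s t] by (simp add: EGS_tuples_def)

text \<open>The group is self-replicating: the sections at place \<open>0\<close> of rotations of \<open>b\<close> and \<open>c\<close> include \<open>b\<close>, \<open>c\<close> and a
  nontrivial power of \<open>a\<close>.\<close>

lemma coordinate_onto:
  assumes "x \<in> \<Gamma>" obtains t where "t \<in> EGS_tuples" "t 0 = x"
proof -
  have cT: "(\<lambda>j. elt (letter_sec Lc j)) \<in> EGS_tuples"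
    using sec_in_EGS_tuples[of "[Lc]"] by simp
  have bT: "(\<lambda>j. elt (letter_sec Lb j)) \<in> EGS_tuples"
    using sec_in_EGS_tuples[of "[Lb]"] by simp
  let ?K = "(\<lambda>t. t 0) ` EGS_tuples"
  have sub: "subgroup ?K GG"
  proof (rule GG.subgroupI)
    show "?K \<subseteq> carrier GG" using EGS_tuplesD(1) by auto
    show "?K \<noteq> {}" using cT by blast
    show "inv\<^bsub>GG\<^esub> y \<in> ?K" if "y \<in> ?K" for y
    proof -
      obtain t where t: "t \<in> EGS_tuples" "y = t 0" using \<open>y \<in> ?K\<close> by blast
      then have "inv\<^bsub>GG\<^esub> y = (\<lambda>j. inv\<^sub>T (t j)) 0" using EGS_tuplesD(1)[OF t(1)] by simp
      then show ?thesis using EGS_tuples_inv[OF t(1)] by (rule image_eqI)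
    qed
    show "y \<otimes>\<^bsub>GG\<^esub> z \<in> ?K" if "y \<in> ?K" "z \<in> ?K" for y z
    proof -
      obtain t s where t: "t \<in> EGS_tuples" "y = t 0" "s \<in> EGS_tuples" "z = s 0"
        using \<open>y \<in> ?K\<close> \<open>z \<in> ?K\<close> by blast
      then have "y \<otimes>\<^bsub>GG\<^esub> z = (\<lambda>j. t j \<cdot> s j) 0" by simp
      then show ?thesis using EGS_tuples_mult[OF t(1,3)] by (rule image_eqI)
    qed
  qed
  have "elt [Lc] \<in> ?K"
    by (rule image_eqI[OF _ cT]) simp
  moreover have "elt [Lb] \<in> ?K"
    by (rule image_eqI[OF _ EGS_tuples_rotate[OF bT, of "p - 1"]]) simp
  moreover have "elt [La] \<in> ?K"
  proof -
    obtain k where k: "\<not> int p dvd alpha_at k" using alpha_at_nonzero .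
    define j where "j = nat (k mod int p)"
    have j: "j < p" "int j = k mod int p" by (simp_all add: j_def nat_less_iff)
    have "[k = int j] (mod int p)" by (simp add: j cong_def)
    then have kj: "alpha_at k = alpha_at (int j)" by (rule alpha_at_cong)
    then have "j \<noteq> 0" using k by (cases "j = 0") auto
    then have aj: "alpha_at k = int (\<alpha> j)" using alpha_at_nat j(1) kj by simp
    have "elt (letter_sec Lc j) \<in> ?K"
      by (rule image_eqI[OF _ EGS_tuples_rotate[OF cT, of j]]) (use j in simp)
    then have "elt [La] [^]\<^bsub>GG\<^esub> (alpha_at k) \<in> ?K"
      using \<open>j \<noteq> 0\<close> by (simp add: aj int_pow_int elt_single_pow)
    then show ?thesis
      by (rule GG.mem_of_power_mem[OF sub _ _ prime_p _ k, rotated 2])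
        (simp_all add: elt_single_pow elt_replicate_dvd)
  qed
  ultimately have gens: "{elt [La], elt [Lb], elt [Lc]} \<subseteq> ?K" by blast
  have "subgroup ?K (AutT p)"
    using T.incl_subgroup[OF EGS_subgroup] sub by (simp add: EGS_group_def)
  then have "\<Gamma> \<subseteq> ?K"
    unfolding EGS_generators by (rule T.generate_subgroup_incl[OF gens])
  then show thesis using that assms by blast
qed

definition single :: "(nat list \<Rightarrow> nat list) \<Rightarrow> nat \<Rightarrow> nat list \<Rightarrow> nat list" where
  "single g = (\<lambda>j. if j = 0 then g else \<one>\<^sub>T)"

text \<open>Up to the identification of the subtree below the vertex \<open>0\<close> with the whole tree, this is the rigid
  stabilizer of that vertex.\<close>

definition rigid :: "(nat list \<Rightarrow> nat list) set" where
  "rigid = {g \<in> \<Gamma>. single g \<in> EGS_tuples}"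

lemma rigid_normal: "rigid \<lhd> GG"
proof (rule GG.normal_invI)
  show "subgroup rigid GG"
  proof (rule GG.subgroupI)
    show "rigid \<subseteq> carrier GG" by (auto simp: rigid_def)
    have "(\<lambda>j. elt (sec [] j)) \<in> EGS_tuples" by (rule sec_in_EGS_tuples) simp
    then have "single \<one>\<^sub>T \<in> EGS_tuples" by (rule EGS_tuples_cong) (simp add: elt_Nil single_def)
    then show "rigid \<noteq> {}" using EGS_closed(1) by (auto simp: rigid_def)
    show "inv\<^bsub>GG\<^esub> g \<in> rigid" if "g \<in> rigid" for g
    proof -
      have g: "g \<in> \<Gamma>" "single g \<in> EGS_tuples" using that by (auto simp: rigid_def)
      have "single (inv\<^sub>T g) \<in> EGS_tuples"
        using EGS_tuples_inv[OF g(2)] by (rule EGS_tuples_cong) (simp add: single_def)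
      then show ?thesis using g EGS_closed(3) by (simp add: rigid_def)
    qed
    show "g \<otimes>\<^bsub>GG\<^esub> h \<in> rigid" if "g \<in> rigid" "h \<in> rigid" for g h
    proof -
      have gh: "g \<in> \<Gamma>" "single g \<in> EGS_tuples" "h \<in> \<Gamma>" "single h \<in> EGS_tuples"
        using that by (auto simp: rigid_def)
      have "single (g \<cdot> h) \<in> EGS_tuples"
        using EGS_tuples_mult[OF gh(2,4)] by (rule EGS_tuples_cong) (simp add: single_def)
      then show ?thesis using gh EGS_closed(2) by (simp add: rigid_def)
    qed
  qed
  fix x g assume x: "x \<in> carrier GG" and "g \<in> rigid"
  then have g: "g \<in> \<Gamma>" "single g \<in> EGS_tuples" by (auto simp: rigid_def)
  obtain t where t: "t \<in> EGS_tuples" "t 0 = x" using coordinate_onto x by auto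
  have "(\<lambda>j. t j \<cdot> single g j \<cdot> inv\<^sub>T (t j)) \<in> EGS_tuples"
    by (rule EGS_tuples_mult[OF EGS_tuples_mult[OF t(1) g(2)] EGS_tuples_inv[OF t(1)]])
  then have "single (x \<cdot> g \<cdot> inv\<^sub>T x) \<in> EGS_tuples"
    by (rule EGS_tuples_cong) (use t EGS_carrier[OF EGS_tuplesD(1)[OF t(1)]] in \<open>auto simp: single_def\<close>)
  then show "x \<otimes>\<^bsub>GG\<^esub> g \<otimes>\<^bsub>GG\<^esub> inv\<^bsub>GG\<^esub> x \<in> rigid"
    using x g EGS_closed by (simp add: rigid_def)
qed

text \<open>The conjugate \<open>b\<^sup>a\<close> has the sections \<open>(b, a\<^sup>\<alpha>\<^sup>1, \<dots>)\<close>, where \<open>c\<close> has \<open>(c, a\<^sup>\<alpha>\<^sup>1, \<dots>)\<close>, so that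
  \<open>b\<^sup>a c\<^sup>-\<^sup>1 = (b c\<^sup>-\<^sup>1, 1, \<dots>, 1)\<close>.\<close>

lemma bc_inv_in_rigid: "elt [Lb] \<cdot> inv\<^sub>T (elt [Lc]) \<in> rigid"
proof -
  have cT: "(\<lambda>j. elt (letter_sec Lc j)) \<in> EGS_tuples"
    using sec_in_EGS_tuples[of "[Lc]"] by simp
  have bT: "(\<lambda>j. elt (letter_sec Lb ((j + (p - 1)) mod p))) \<in> EGS_tuples"
    using EGS_tuples_rotate[OF sec_in_EGS_tuples[of "[Lb]"], of "p - 1"] by simp
  have shift: "(j + (p - 1)) mod p = j - 1" if "0 < j" "j < p" for j
  proof -
    have "j + (p - 1) = (j - 1) + p" using that by simp
    then have "(j + (p - 1)) mod p = (j - 1) mod p" by (simp only: mod_add_self2)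
    then show ?thesis using that by simp
  qed
  have "single (elt [Lb] \<cdot> inv\<^sub>T (elt [Lc])) \<in> EGS_tuples"
  proof (rule EGS_tuples_cong[OF EGS_tuples_mult[OF bT EGS_tuples_inv[OF cT]]])
    fix j assume j: "j < p"
    show "single (elt [Lb] \<cdot> inv\<^sub>T (elt [Lc])) j
        = elt (letter_sec Lb ((j + (p - 1)) mod p)) \<cdot> inv\<^sub>T elt (letter_sec Lc j)"
    proof (cases "j = 0")
      case False
      then have "(j + (p - 1)) mod p = j - 1" using j by (intro shift) auto
      moreover have "j - Suc 0 \<noteq> p - Suc 0" using False j by arith
      ultimately show ?thesis using False j by (simp add: single_def)
    qed (simp add: single_def)
  qed
  then show ?thesis by (simp add: rigid_def EGS_closed)
qed

text \<open>Multiply rotated copies of \<open>(t j, 1, \<dots>, 1)\<close>, one for each place.\<close>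

lemma rigid_tuple:
  assumes "\<And>j. j < p \<Longrightarrow> t j \<in> rigid" shows "t \<in> EGS_tuples"
proof -
  define s where "s = (\<lambda>n j. if j < n then t j else \<one>\<^sub>T)"
  have one: "single \<one>\<^sub>T \<in> EGS_tuples"
    using subgroup.one_closed[OF normal_imp_subgroup[OF rigid_normal]] by (simp add: rigid_def)
  have "n \<le> p \<Longrightarrow> s n \<in> EGS_tuples" for n
  proof (induction n)
    case 0
    show ?case by (rule EGS_tuples_cong[OF one]) (simp add: s_def single_def)
  next
    case (Suc n)
    then have "single (t n) \<in> EGS_tuples" "t n \<in> carrier (AutT p)"
      using assms[of n] by (auto simp: rigid_def intro: EGS_carrier)
    then have 1: "(\<lambda>j. single (t n) ((j + (p - n)) mod p)) \<in> EGS_tuples" by (intro EGS_tuples_rotate)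
    show ?case
    proof (rule EGS_tuples_cong[OF EGS_tuples_mult[OF Suc.IH 1]])
      fix j assume j: "j < p"
      have "(j + (p - n)) mod p = 0 \<longleftrightarrow> j = n"
      proof
        assume "(j + (p - n)) mod p = 0"
        then have "p dvd j + (p - n)" by (simp add: dvd_eq_mod_eq_0)
        then have "[j + (p - n) = n + (p - n)] (mod p)" using Suc.prems by (simp add: cong_def dvd_eq_mod_eq_0)
        then have "[j = n] (mod p)" by (simp only: cong_add_rcancel_nat)
        then show "j = n" using j Suc.prems by (simp add: cong_def)
      qed (use Suc.prems in simp)
      moreover have "t j \<in> carrier (AutT p)" using assms[OF j] EGS_carrier by (simp add: rigid_def)
      ultimately show "s (Suc n) j = s n j \<cdot> single (t n) ((j + (p - n)) mod p)"
        by (auto simp: s_def single_def)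
    qed (use Suc.prems in simp)
  qed
  then have "s p \<in> EGS_tuples" by simp
  then show ?thesis by (rule EGS_tuples_cong) (simp add: s_def)
qed

text \<open>Modulo the rigid elements, \<open>b\<close> and \<open>c\<close> agree, and the sections of \<open>c\<close> form the generating tuple of the abstract
  setting. A tuple whose entries off place \<open>0\<close> are rigid can be corrected there to \<open>1\<close>, so its entry at \<open>0\<close> is
  rigid as well: this is the isolation property, and the conclusion is that the quotient is abelian.\<close>

lemma derived_subset_rigid: "derived (AutT p) \<Gamma> \<subseteq> rigid"
proof -
  interpret N: normal rigid GG by (rule rigid_normal)
  interpret Q: group "GG Mod rigid" by (rule N.factorgroup_is_group)
  interpret h: group_hom GG "GG Mod rigid" "(#>\<^bsub>GG\<^esub>) rigid"
    by (simp add: group_hom_def group_hom_axioms_def EGS_group_group Q.is_group N.r_coset_hom_Mod)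
  define h where "h = (#>\<^bsub>GG\<^esub>) rigid"
  have h_closed: "h g \<in> carrier (GG Mod rigid)" if "g \<in> \<Gamma>" for g
    using h.hom_closed[of g] that by (simp only: h_def EGS_group_simps)
  have h_mult: "h (g \<cdot> g') = h g \<otimes>\<^bsub>GG Mod rigid\<^esub> h g'" if "g \<in> \<Gamma>" "g' \<in> \<Gamma>" for g g'
    using h.hom_mult[of g g'] that by (simp only: h_def EGS_group_simps)
  have h_inv: "h (inv\<^sub>T g) = inv\<^bsub>GG Mod rigid\<^esub> h g" if "g \<in> \<Gamma>" for g
    using h.hom_inv[of g] that by (simp only: h_def EGS_group_simps EGS_inv)
  have h_one: "h \<one>\<^sub>T = \<one>\<^bsub>GG Mod rigid\<^esub>"
    using h.hom_one by (simp only: h_def EGS_group_simps)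
  have h_one_iff: "h g = \<one>\<^bsub>GG Mod rigid\<^esub> \<longleftrightarrow> g \<in> rigid" if "g \<in> \<Gamma>" for g
  proof
    assume "h g = \<one>\<^bsub>GG Mod rigid\<^esub>"
    then have "rigid #>\<^bsub>GG\<^esub> g = rigid" by (simp add: h_def)
    then show "g \<in> rigid" using GG.coset_join1[OF _ _ N.is_subgroup] that by simp
  next
    assume "g \<in> rigid"
    then show "h g = \<one>\<^bsub>GG Mod rigid\<^esub>"
      unfolding h_def one_FactGroup by (rule N.rcos_const[OF EGS_group_group])
  qed
  have h_pow: "h (elt (replicate n l)) = h (elt [l]) [^]\<^bsub>GG Mod rigid\<^esub> n" for n l
    using h.hom_nat_pow[of "elt [l]" n] by (simp only: h_def elt_single_pow EGS_group_simps elt_in_EGS)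
  have bc: "h (elt [Lc]) = h (elt [Lb])"
  proof -
    have "h (elt [Lb]) \<otimes>\<^bsub>GG Mod rigid\<^esub> inv\<^bsub>GG Mod rigid\<^esub> h (elt [Lc]) = \<one>\<^bsub>GG Mod rigid\<^esub>"
      using bc_inv_in_rigid h_one_iff[of "elt [Lb] \<cdot> inv\<^sub>T elt [Lc]"]
      by (simp only: h_mult h_inv EGS_closed elt_in_EGS)
    then have "h (elt [Lb]) = \<one>\<^bsub>GG Mod rigid\<^esub> \<otimes>\<^bsub>GG Mod rigid\<^esub> h (elt [Lc])"
      using Q.inv_solve_right'[of "\<one>\<^bsub>GG Mod rigid\<^esub>" "h (elt [Lb])" "h (elt [Lc])"]
        h_closed[OF elt_in_EGS] by (simp del: one_FactGroup mult_FactGroup)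
    then show ?thesis using h_closed[OF elt_in_EGS] by (simp del: one_FactGroup mult_FactGroup)
  qed
  obtain i where i: "\<not> int p dvd i" "\<not> [alpha_at i = alpha_at (- i)] (mod int p)"
    using nonsymmetric_alpha_at .
  have prime_int: "prime (int p)" using prime_p by simp
  have "coprime i (int p)"
    using i(1) prime_int by (metis coprime_commute prime_imp_coprime)
  then obtain i' where i': "[i * i' = 1] (mod int p)" using cong_solve_coprime_int by blast
  \<comment> \<open>Rescaling positions by \<open>i\<close> moves the asymmetric pair of entries to the positions \<open>1\<close> and \<open>- 1\<close>.\<close>
  define pos where "pos k = nat ((k * i) mod int p)" for k
  have pos: "pos k < p" "int (pos k) = (k * i) mod int p" for k
    by (simp_all add: pos_def nat_less_iff)
  have pos_0: "pos k = 0 \<longleftrightarrow> int p dvd k" for k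
  proof -
    have "pos k = 0 \<longleftrightarrow> int (pos k) = 0" by simp
    also have "\<dots> \<longleftrightarrow> int p dvd k * i" unfolding pos(2) by (simp add: dvd_eq_mod_eq_0)
    also have "\<dots> \<longleftrightarrow> int p dvd k" using i(1) prime_int by (simp add: prime_dvd_mult_iff)
    finally show ?thesis .
  qed
  define S where "S = {\<lambda>k. h (t (pos k)) | t. t \<in> EGS_tuples}"
  have SI: "(\<lambda>k. h (t (pos k))) \<in> S" if "t \<in> EGS_tuples" for t
    using that by (auto simp: S_def)
  have "shift_invariant_tuples (GG Mod rigid) p S (h (elt [La])) (h (elt [Lb])) (\<lambda>k. alpha_at (k * i))"
  proof (intro_locales; unfold_locales)
    show "prime p" by (rule prime_p)
    show "3 \<le> p" by (rule p_ge_3)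
    show "h (elt [La]) \<in> carrier (GG Mod rigid)" "h (elt [Lb]) \<in> carrier (GG Mod rigid)"
      by (simp_all only: h_closed elt_in_EGS)
    show "generate (GG Mod rigid) {h (elt [La]), h (elt [Lb])} = carrier (GG Mod rigid)"
    proof -
      have "generate GG {elt [La], elt [Lb], elt [Lc]} = \<Gamma>"
        unfolding EGS_group_def
        using T.generate_consistent[OF _ EGS_subgroup, of "{elt [La], elt [Lb], elt [Lc]}"]
        by (simp add: EGS_generators[symmetric])
      moreover have "h ` {elt [La], elt [Lb], elt [Lc]} = {h (elt [La]), h (elt [Lb])}" by (auto simp: bc)
      moreover have "generate (GG Mod rigid) (h ` {elt [La], elt [Lb], elt [Lc]})
          = h ` generate GG {elt [La], elt [Lb], elt [Lc]}"
        unfolding h_def by (rule h.generate_img) simp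
      moreover have "h ` \<Gamma> = carrier (GG Mod rigid)"
        by (auto simp: h_def FactGroup_def RCOSETS_def)
      ultimately show ?thesis by simp
    qed
    show "h (elt [La]) [^]\<^bsub>GG Mod rigid\<^esub> p = \<one>\<^bsub>GG Mod rigid\<^esub>"
      using h_pow[of p La] elt_replicate_dvd[of p La] h_one by simp
    show "t k \<in> carrier (GG Mod rigid)" if "t \<in> S" for t k
      using that EGS_tuplesD(1) pos(1) h_closed unfolding S_def by blast
    show "t k = t l" if "t \<in> S" "[k = l] (mod int p)" for t k l
    proof -
      have "[k * i = l * i] (mod int p)" using that(2) by (rule cong_scalar_right)
      then have "pos k = pos l" by (simp add: pos_def cong_def)
      then show ?thesis using that(1) by (auto simp: S_def)
    qed
    show "(\<lambda>k. s k \<otimes>\<^bsub>GG Mod rigid\<^esub> t k) \<in> S" if "s \<in> S" "t \<in> S" for s t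
    proof -
      obtain s' t' where st: "s' \<in> EGS_tuples" "s = (\<lambda>k. h (s' (pos k)))"
        "t' \<in> EGS_tuples" "t = (\<lambda>k. h (t' (pos k)))" using \<open>s \<in> S\<close> \<open>t \<in> S\<close> unfolding S_def by blast
      have "(\<lambda>k. s k \<otimes>\<^bsub>GG Mod rigid\<^esub> t k) = (\<lambda>k. h (s' (pos k) \<cdot> t' (pos k)))"
        unfolding st by (intro ext h_mult[symmetric] EGS_tuplesD(1)[OF st(1)] EGS_tuplesD(1)[OF st(3)] pos(1))
      then show ?thesis using SI[OF EGS_tuples_mult[OF st(1,3)]] by simp
    qed
    show "(\<lambda>k. inv\<^bsub>GG Mod rigid\<^esub> t k) \<in> S" if "t \<in> S" for t
    proof -
      obtain t' where t: "t' \<in> EGS_tuples" "t = (\<lambda>k. h (t' (pos k)))" using \<open>t \<in> S\<close> unfolding S_def by blast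
      have "(\<lambda>k. inv\<^bsub>GG Mod rigid\<^esub> t k) = (\<lambda>k. h (inv\<^sub>T t' (pos k)))"
        unfolding t by (intro ext h_inv[symmetric] EGS_tuplesD(1)[OF t(1)] pos(1))
      then show ?thesis using SI[OF EGS_tuples_inv[OF t(1)]] by simp
    qed
    show "(\<lambda>k. t (k + m)) \<in> S" if "t \<in> S" for t m
    proof -
      obtain t' where t: "t' \<in> EGS_tuples" "t = (\<lambda>k. h (t' (pos k)))" using \<open>t \<in> S\<close> unfolding S_def by blast
      have "pos (k + m) = (pos k + pos m) mod p" for k
      proof -
        have "int (pos (k + m)) = int ((pos k + pos m) mod p)"
          by (simp add: pos(2) of_nat_mod mod_simps distrib_right)
        then show ?thesis by (simp only: of_nat_eq_iff)
      qed
      then have "(\<lambda>k. t (k + m)) = (\<lambda>k. h (t' ((pos k + pos m) mod p)))" unfolding t by simp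
      then show ?thesis using SI[OF EGS_tuples_rotate[OF t(1), of "pos m"]] by simp
    qed
    show "(\<lambda>k. if int p dvd k then h (elt [Lb]) else h (elt [La]) [^]\<^bsub>GG Mod rigid\<^esub> alpha_at (k * i)) \<in> S"
    proof -
      have cT: "(\<lambda>j. elt (letter_sec Lc j)) \<in> EGS_tuples"
        using sec_in_EGS_tuples[of "[Lc]"] by simp
      have "(\<lambda>k. if int p dvd k then h (elt [Lb]) else h (elt [La]) [^]\<^bsub>GG Mod rigid\<^esub> alpha_at (k * i))
          = (\<lambda>k. h (elt (letter_sec Lc (pos k))))"
      proof
        fix k
        show "(if int p dvd k then h (elt [Lb]) else h (elt [La]) [^]\<^bsub>GG Mod rigid\<^esub> alpha_at (k * i))
            = h (elt (letter_sec Lc (pos k)))"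
        proof (cases "int p dvd k")
          case True then show ?thesis by (simp add: pos_0 bc)
        next
          case False
          then have "alpha_at (k * i) = int (\<alpha> (pos k))"
            using i(1) prime_int unfolding alpha_at_def pos_def by (simp add: prime_dvd_mult_iff)
          then show ?thesis using False by (simp add: pos_0 h_pow int_pow_int)
        qed
      qed
      then show ?thesis using SI[OF cT] by simp
    qed
    show "t 0 = \<one>\<^bsub>GG Mod rigid\<^esub>"
      if "t \<in> S" and triv: "\<And>k. \<not> int p dvd k \<Longrightarrow> t k = \<one>\<^bsub>GG Mod rigid\<^esub>" for t
    proof -
      obtain t' where t: "t' \<in> EGS_tuples" "t = (\<lambda>k. h (t' (pos k)))" using \<open>t \<in> S\<close> unfolding S_def by blast
      define r where "r = (\<lambda>j. if j = 0 then \<one>\<^sub>T else t' j)"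
      have "r j \<in> rigid" if j: "j < p" for j
      proof (cases "j = 0")
        case True
        then show ?thesis using N.one_closed by (simp add: r_def)
      next
        case False
        have "[int j * i' * i = int j * 1] (mod int p)"
          using cong_scalar_left[OF i', of "int j"] by (simp add: ac_simps)
        then have "int (pos (int j * i')) = int j" using j unfolding pos(2) by (simp add: cong_def)
        then have pj: "pos (int j * i') = j" by simp
        then have "\<not> int p dvd int j * i'" using False pos_0 by metis
        moreover have "t (int j * i') = h (t' j)" unfolding t(2) pj ..
        ultimately have "h (t' j) = \<one>\<^bsub>GG Mod rigid\<^esub>" using triv[of "int j * i'"] by metis
        then show ?thesis using h_one_iff[OF EGS_tuplesD(1)[OF t(1) j]] False by (simp add: r_def)
      qed
      then have "r \<in> EGS_tuples" by (rule rigid_tuple)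
      then have "(\<lambda>j. t' j \<cdot> inv\<^sub>T (r j)) \<in> EGS_tuples"
        by (intro EGS_tuples_mult[OF t(1)] EGS_tuples_inv)
      then have "single (t' 0) \<in> EGS_tuples"
        by (rule EGS_tuples_cong) (use EGS_carrier[OF EGS_tuplesD(1)[OF t(1)]] in \<open>auto simp: single_def r_def\<close>)
      then have "t' 0 \<in> rigid" using EGS_tuplesD(1)[OF t(1)] by (simp add: rigid_def)
      moreover have "pos 0 = 0" by (simp add: pos_0)
      ultimately show ?thesis using h_one_iff EGS_tuplesD(1)[OF t(1)] by (simp only: t p_pos)
    qed
    show "\<not> [alpha_at (1 * i) = alpha_at (- 1 * i)] (mod int p)" using i(2) by simp
  qed
  then interpret tup: shift_invariant_tuples "GG Mod rigid" p S "h (elt [La])" "h (elt [Lb])" "\<lambda>k. alpha_at (k * i)" .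
  have ab: "h (elt [La]) \<otimes>\<^bsub>GG Mod rigid\<^esub> h (elt [Lb]) = h (elt [Lb]) \<otimes>\<^bsub>GG Mod rigid\<^esub> h (elt [La])"
    by (rule tup.generators_commute) (intro alpha_at_cong cong_scalar_right)
  have "derived GG (carrier GG) \<subseteq> rigid"
    by (rule GG.derived_subset_of_quotient_commute[OF rigid_normal])
      (intro Q.generators_commute_imp_commute[OF tup.gen tup.a tup.b ab] h.hom_closed)
  then show ?thesis by (simp add: derived_EGS_group)
qed

section \<open>Balanced elements\<close>

text \<open>Elements whose class in the abelianization can occur for a section of an element of arbitrarily deep
  stabilizers.\<close>

definition balanced :: "(nat list \<Rightarrow> nat list) set" where
  "balanced = {g \<in> \<Gamma>. letter_exp La g = 0 \<and> p dvd letter_exp Lb g + letter_exp Lc g}"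

text \<open>A balanced element differs from a power of \<open>b c\<^sup>-\<^sup>1\<close> by a commutator, and both are rigid.\<close>

lemma balanced_subset_rigid: "balanced \<subseteq> rigid"
proof
  fix g assume g: "g \<in> balanced"
  then have gG: "g \<in> \<Gamma>" by (simp add: balanced_def)
  interpret N: normal rigid GG by (rule rigid_normal)
  define d where "d = elt [Lb] \<cdot> inv\<^sub>T (elt [Lc])"
  have d: "d \<in> rigid" "d \<in> \<Gamma>" using bc_inv_in_rigid by (auto simp: d_def rigid_def)
  have "d = elt ([Lb] @ replicate (p - 1) Lc)" by (simp add: d_def inv_elt elt_mult)
  then have d_exp: "letter_exp La d = 0" "letter_exp Lb d = 1" "letter_exp Lc d = p - 1"
    using p_ge_3 by (simp_all add: letter_exp_elt count_list_replicate del: append_Cons append_Nil)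
  define n where "n = p - letter_exp Lb g"
  have n: "n + letter_exp Lb g = p" by (simp add: n_def less_imp_le)
  define e where "e = d [^]\<^bsub>GG\<^esub> n"
  have e: "e \<in> rigid" "e \<in> \<Gamma>"
    using letter_exp_pow[OF d(2)] GG.subgroup_int_pow_closed[OF N.is_subgroup d(1), of "int n"]
    by (auto simp: e_def int_pow_int)
  have e_exp: "letter_exp l e = (n * letter_exp l d) mod p" for l
    using letter_exp_pow[OF d(2)] by (simp add: e_def)
  have "letter_exp l (g \<cdot> e) = 0" for l
  proof (cases l)
    case La then show ?thesis using g by (simp add: letter_exp_mult gG e e_exp d_exp balanced_def)
  next
    case Lb then show ?thesis using n by (simp add: letter_exp_mult gG e e_exp d_exp mod_simps add.commute)
  next
    case Lc
    have "p dvd (letter_exp Lb g + letter_exp Lc g) + n * p" using g by (simp add: balanced_def)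
    moreover have "n * p = n * (p - 1) + n" using p_ge_3 by (cases p) auto
    ultimately have "p dvd (letter_exp Lc g + n * (p - 1)) + (n + letter_exp Lb g)" by (simp only: add_ac)
    then have "p dvd letter_exp Lc g + n * (p - 1)" unfolding n by simp
    then show ?thesis
      using Lc by (simp only: letter_exp_mult gG e e_exp d_exp mod_add_right_eq dvd_eq_mod_eq_0)
  qed
  then have "g \<cdot> e \<in> rigid"
    using derived_subset_rigid e gG by (auto simp: derived_eq EGS_closed)
  then have "g \<cdot> e \<cdot> inv\<^sub>T e \<in> rigid"
    using N.m_closed[OF _ N.m_inv_closed[OF e(1)]] e by simp
  then show "g \<in> rigid" using gG e EGS_carrier by (simp add: T.m_assoc)
qed

lemma EGS_tuples_words:
  assumes "t \<in> EGS_tuples"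
  obtains W where "p dvd nA W" "spread p t = elt W" "\<And>j. j < p \<Longrightarrow> t j = elt (sec W j)"
proof -
  obtain W where W: "spread p t = elt W" using EGS_tuplesD(2)[OF assms] by (rule EGS_elim)
  have "ev W [0] = [0]"
    using fun_cong[OF W, of "[0]"] EGS_carrier[OF EGS_tuplesD(1)[OF assms p_pos]] by (simp add: AutT_carrierD(5) del: ev_Cons)
  then have dvd: "p dvd nA W" by (simp add: act_eq dvd_eq_mod_eq_0)
  have "spread p t = spread p (\<lambda>j. elt (sec W j))" using W elt_eq_spread_sec[OF dvd] by simp
  then have "t j = elt (sec W j)" if "j < p" for j
    using spread_inj[of p t "\<lambda>j. elt (sec W j)" j] that
      AutT_carrierD(2)[OF EGS_carrier[OF EGS_tuplesD(1)[OF assms that]]] by simp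
  then show thesis using that W dvd by blast
qed

lemma letter_exp_spread_La:
  assumes "t \<in> EGS_tuples" shows "letter_exp La (spread p t) = 0"
proof -
  obtain W where "p dvd nA W" "spread p t = elt W" using EGS_tuples_words[OF assms] by blast
  then show ?thesis by (simp add: letter_exp_elt)
qed

lemma letter_exp_spread:
  assumes "t \<in> EGS_tuples" "l \<noteq> La"
  shows "letter_exp l (spread p t) = (\<Sum>j<p. letter_exp l (t j)) mod p"
proof -
  obtain W where W: "spread p t = elt W" "\<And>j. j < p \<Longrightarrow> t j = elt (sec W j)"
    using EGS_tuples_words[OF assms(1)] by blast
  have "(\<Sum>j<p. letter_exp l (t j)) mod p = (\<Sum>j<p. count_list (sec W j) l mod p) mod p"
    by (rule arg_cong[of _ _ "\<lambda>x. x mod p"], rule sum.cong) (auto simp: W letter_exp_elt)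
  also have "\<dots> = (\<Sum>j<p. count_list (sec W j) l) mod p" by (rule mod_sum_eq)
  also have "\<dots> = count_list W l mod p" using assms(2) by (cases l) (simp_all add: sum_nB_sec sum_nC_sec)
  finally show ?thesis by (simp add: W letter_exp_elt)
qed

lemma letter_exp_La_coordinate:
  assumes "t \<in> EGS_tuples" "j < p"
  shows "[int (letter_exp La (t j))
    = (\<Sum>i<p. int (letter_exp Lb (t i) + letter_exp Lc (t i)) * alpha_at (int j - int i))] (mod int p)"
proof -
  obtain W where W: "\<And>j. j < p \<Longrightarrow> t j = elt (sec W j)"
    using EGS_tuples_words[OF assms(1)] by blast
  have "[int (letter_exp La (t j)) = int (nA (sec W j))] (mod int p)"
    using W[OF assms(2)] by (simp add: letter_exp_elt cong_def of_nat_mod)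
  also have "int (nA (sec W j)) = (\<Sum>i<p. int (weight (sec W i)) * alpha_at (int j - int i))"
    unfolding nA_sec[OF assms(2)] by (rule sum.cong) simp_all
  also have "[(\<Sum>i<p. int (weight (sec W i)) * alpha_at (int j - int i))
      = (\<Sum>i<p. int (letter_exp Lb (t i) + letter_exp Lc (t i)) * alpha_at (int j - int i))] (mod int p)"
  proof (intro cong_sum cong_scalar_right)
    fix i assume "i \<in> {..<p}"
    then have "int (letter_exp Lb (t i) + letter_exp Lc (t i)) = int (nB (sec W i)) mod int p + int (nC (sec W i)) mod int p"
      by (simp add: W letter_exp_elt of_nat_mod)
    then show "[int (weight (sec W i)) = int (letter_exp Lb (t i) + letter_exp Lc (t i))] (mod int p)"
      by (simp add: cong_def mod_simps)
  qed
  finally show ?thesis .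
qed

text \<open>Such a tuple is realized because its entries are rigid. Being balanced is inherited since the exponents of
  \<open>b\<close> and \<open>c\<close> add up; this is what makes the construction iterate down the tree.\<close>

lemma balanced_tuple:
  assumes t: "\<And>j. j < p \<Longrightarrow> t j \<in> balanced" shows "spread p t \<in> balanced"
proof -
  have tt: "t \<in> EGS_tuples" using t balanced_subset_rigid by (intro rigid_tuple) blast
  have "p dvd (\<Sum>j<p. letter_exp Lb (t j) + letter_exp Lc (t j))"
    using t by (intro dvd_sum) (simp add: balanced_def)
  then have "p dvd letter_exp Lb (spread p t) + letter_exp Lc (spread p t)"
    by (simp add: letter_exp_spread[OF tt] sum.distrib dvd_eq_mod_eq_0 mod_simps)
  then show ?thesis
    using EGS_tuplesD(2)[OF tt] letter_exp_spread_La[OF tt] by (simp add: balanced_def)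
qed

lemma sections_in_EGS_tuples:
  assumes g: "g \<in> \<Gamma>" and fix1: "\<And>j. j < p \<Longrightarrow> g [j] = [j]"
  shows "(\<lambda>j. section_at p g [j]) \<in> EGS_tuples" "g = spread p (\<lambda>j. section_at p g [j])"
proof -
  show eq: "g = spread p (\<lambda>j. section_at p g [j])"
    by (rule eq_spread_sections[OF EGS_carrier[OF g] fix1])
  obtain W where W: "g = elt W" using g by (rule EGS_elim)
  have "ev W [0] = [0]" using fix1[of 0] by (simp add: W del: ev_Cons)
  then have dvd: "p dvd nA W" by (simp add: act_eq dvd_eq_mod_eq_0)
  have "section_at p g [j] = elt (sec W j)" if "j < p" for j
    unfolding W elt_eq_spread_sec[OF dvd] using that by (simp add: section_at_spread section_at_Nil)
  then show "(\<lambda>j. section_at p g [j]) \<in> EGS_tuples"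
    by (rule EGS_tuples_cong[OF sec_in_EGS_tuples[OF dvd]])
qed

text \<open>The sections on the first level fix their first level, so their exponents of \<open>a\<close> vanish. By
  \<open>letter_exp_La_coordinate\<close> this says that a circulant matrix kills the vector of their \<open>b\<close>- and \<open>c\<close>-exponents,
  and the coordinate sum of that vector is the corresponding exponent of \<open>g\<close>.\<close>

lemma balanced_of_two_levels:
  assumes g: "g \<in> \<Gamma>" and fix1: "\<And>j. j < p \<Longrightarrow> g [j] = [j]"
    and fix2: "\<And>j k. j < p \<Longrightarrow> k < p \<Longrightarrow> g [j, k] = [j, k]"
  shows "g \<in> balanced"
proof -
  define t where "t = (\<lambda>j. section_at p g [j])"
  have t: "t \<in> EGS_tuples" "g = spread p t"
    using sections_in_EGS_tuples[OF g fix1] by (auto simp: t_def)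
  have "letter_exp La (t j) = 0" if j: "j < p" for j
  proof -
    have "t j [k] = [k]" if "k < p" for k using fix2[OF j that] that by (simp add: t_def)
    then show ?thesis
      using sections_in_EGS_tuples[OF EGS_tuplesD(1)[OF t(1) j]] letter_exp_spread_La by metis
  qed
  then have conv0: "int p dvd (\<Sum>i<p. int (letter_exp Lb (t i) + letter_exp Lc (t i)) * alpha_at (int j - int i))"
    if "j < p" for j
    using letter_exp_La_coordinate[OF t(1) that] that by (simp add: cong_0_iff cong_sym_eq[of 0])
  have conv: "int p dvd (\<Sum>i<p. int (letter_exp Lb (t i) + letter_exp Lc (t i)) * alpha_at (j - int i))" for j
  proof -
    define j' where "j' = nat (j mod int p)"
    have j': "j' < p" "int j' = j mod int p" by (simp_all add: j'_def nat_less_iff)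
    have "alpha_at (j - int i) = alpha_at (int j' - int i)" for i
      by (rule alpha_at_cong) (simp add: j' cong_def mod_simps)
    then show ?thesis using conv0[OF j'(1)] by simp
  qed
  obtain k where k: "\<not> int p dvd alpha_at k" using alpha_at_nonzero .
  have "int p dvd (\<Sum>i<p. int (letter_exp Lb (t i) + letter_exp Lc (t i)))"
    by (rule circulant_kernel_sum_zero[OF prime_p _ k conv]) (rule alpha_at_cong, simp add: cong_def)
  then have "p dvd (\<Sum>i<p. letter_exp Lb (t i) + letter_exp Lc (t i))"
    by (simp only: of_nat_sum[symmetric] int_dvd_int_iff)
  then have "p dvd letter_exp Lb g + letter_exp Lc g"
    unfolding t(2) by (simp add: letter_exp_spread[OF t(1)] sum.distrib dvd_eq_mod_eq_0 mod_simps)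
  then show ?thesis using g letter_exp_spread_La[OF t(1)] t(2) by (simp add: balanced_def)
qed

lemma balanced_subgroup: "subgroup balanced (AutT p)"
proof (rule T.subgroupI)
  show "balanced \<subseteq> carrier (AutT p)" using EGS_carrier by (auto simp: balanced_def)
  show "balanced \<noteq> {}" using EGS_closed(1) letter_exp_one by (auto simp: balanced_def intro!: exI[of _ "\<one>\<^sub>T"])
  fix g assume g: "g \<in> balanced"
  then have gG: "g \<in> \<Gamma>" by (simp add: balanced_def)
  note inv = letter_exp_inv[OF gG]
  have "p dvd (letter_exp Lb (inv\<^sub>T g) + letter_exp Lb g) + (letter_exp Lc (inv\<^sub>T g) + letter_exp Lc g)"
    using inv by (intro dvd_add mod_0_imp_dvd)
  then have "p dvd (letter_exp Lb (inv\<^sub>T g) + letter_exp Lc (inv\<^sub>T g)) + (letter_exp Lb g + letter_exp Lc g)"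
    by (simp only: add_ac)
  then have "p dvd letter_exp Lb (inv\<^sub>T g) + letter_exp Lc (inv\<^sub>T g)"
    using g by (simp add: balanced_def dvd_add_left_iff)
  then show "inv\<^sub>T g \<in> balanced"
    using inv[of La] g gG EGS_closed(3) by (simp add: balanced_def)
next
  fix g h assume gh: "g \<in> balanced" "h \<in> balanced"
  then have "p dvd (letter_exp Lb g + letter_exp Lc g) + (letter_exp Lb h + letter_exp Lc h)"
    by (simp add: balanced_def)
  then have "p dvd (letter_exp Lb g + letter_exp Lb h) + (letter_exp Lc g + letter_exp Lc h)"
    by (simp only: add_ac)
  then show "g \<cdot> h \<in> balanced"
    using gh by (simp add: balanced_def EGS_closed letter_exp_mult dvd_eq_mod_eq_0 mod_simps)
qed

end

section \<open>Subgroups given by sections on a level\<close>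

text \<open>The subgroups \<open>H\<^sub>n\<close> arise for the derived subgroup \<open>P\<close>. Taking the balanced elements for \<open>P\<close> instead gives
  the elements that are relevant for the kernel.\<close>

definition with_sections :: "nat \<Rightarrow> nat \<Rightarrow> (nat list \<Rightarrow> nat list) set \<Rightarrow> (nat list \<Rightarrow> nat list) set" where
  "with_sections p n P = {h \<in> carrier (AutT p). \<forall>v\<in>level p n. h v = v \<and> section_at p h v \<in> P}"

lemma H_sub_eq: "H_sub p \<alpha> n = with_sections p n (derived (AutT p) (EGS p \<alpha>))"
  by (simp add: H_sub_def with_sections_def)

lemma level_0 [simp]: "level p 0 = {[]}"
  by (auto simp: level_def)

lemma level_Suc_iff: "v \<in> level p (Suc n) \<longleftrightarrow> (\<exists>j u. v = j # u \<and> j < p \<and> u \<in> level p n)"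
  by (cases v) (auto simp: level_def)

lemma level_words: "v \<in> level p n \<Longrightarrow> v \<in> words p"
  by (simp add: level_def)

lemma level_append: "v \<in> level p n \<Longrightarrow> w \<in> level p m \<Longrightarrow> v @ w \<in> level p (n + m)"
  by (simp add: level_def)

lemma level_nonempty: "0 < p \<Longrightarrow> level p n \<noteq> {}"
proof (induction n)
  case (Suc n)
  then obtain u where "u \<in> level p n" by auto
  then have "0 # u \<in> level p (Suc n)" using Suc.prems by (simp add: level_Suc_iff)
  then show ?case by blast
qed simp

lemma finite_level: "finite (level p n)"
proof (induction n)
  case (Suc n)
  have "level p (Suc n) \<subseteq> (\<lambda>(j, u). j # u) ` ({..<p} \<times> level p n)"
    by (auto simp: level_Suc_iff)
  then show ?case using Suc by (meson finite_SigmaI finite_imageI finite_lessThan finite_subset)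
qed simp

lemma fixes_prefix:
  assumes h: "h \<in> carrier (AutT p)" and "v @ w \<in> words p" "h (v @ w) = v @ w"
  shows "h v = v"
proof -
  obtain w' where "h (v @ w) = h v @ w'" using AutT_append[OF h assms(2)] by auto
  moreover have "length (h v) = length v" using AutT_length[OF h, of v] assms(2) by simp
  ultimately show ?thesis using assms(3) by simp
qed

lemma fixes_level_down:
  assumes h: "h \<in> carrier (AutT p)" and "0 < p" "\<And>v. v \<in> level p (n + m) \<Longrightarrow> h v = v" "v \<in> level p n"
  shows "h v = v"
proof -
  obtain w where w: "w \<in> level p m" using level_nonempty[OF assms(2)] by blast
  show ?thesis
    using fixes_prefix[OF h, of v w] assms(3)[OF level_append[OF assms(4) w]] level_words[OF assms(4)] level_words[OF w]
    by simp
qed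

lemma with_sections_0:
  assumes "P \<subseteq> carrier (AutT p)" shows "with_sections p 0 P = P"
proof -
  have "section_at p h [] = h" "h [] = []" if "h \<in> carrier (AutT p)" for h
    using section_at_Nil AutT_carrierD(2,5)[OF that] by auto
  then show ?thesis using assms by (auto simp: with_sections_def)
qed

lemma with_sections_Suc:
  assumes "0 < p"
  shows "h \<in> with_sections p (Suc n) P \<longleftrightarrow>
    h \<in> carrier (AutT p) \<and> (\<forall>j<p. h [j] = [j] \<and> section_at p h [j] \<in> with_sections p n P)"
proof (intro iffI conjI allI impI)
  assume "h \<in> with_sections p (Suc n) P"
  then have h: "h \<in> carrier (AutT p)" and hv: "\<And>v. v \<in> level p (Suc n) \<Longrightarrow> h v = v \<and> section_at p h v \<in> P"
    by (auto simp: with_sections_def)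
  show "h \<in> carrier (AutT p)" by (rule h)
  fix j assume j: "j < p"
  then have j1: "[j] \<in> level p 1" by (simp add: level_def)
  show hj: "h [j] = [j]"
    by (rule fixes_level_down[OF h assms _ j1, of n]) (use hv in simp)
  have "section_at p h [j] v = v \<and> section_at p (section_at p h [j]) v \<in> P" if v: "v \<in> level p n" for v
  proof -
    have "j # v \<in> level p (Suc n)" using j v by (simp add: level_Suc_iff)
    then show ?thesis using hv[of "j # v"] level_words[OF v] by (simp add: section_at_append)
  qed
  then show "section_at p h [j] \<in> with_sections p n P"
    using section_carrier[OF h _ hj] j by (simp add: with_sections_def)
next
  assume a: "h \<in> carrier (AutT p) \<and> (\<forall>j<p. h [j] = [j] \<and> section_at p h [j] \<in> with_sections p n P)"
  then have h: "h \<in> carrier (AutT p)" by blast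
  have "h v = v \<and> section_at p h v \<in> P" if vl: "v \<in> level p (Suc n)" for v
  proof -
    obtain j u where v: "v = j # u" "j < p" "u \<in> level p n" using vl by (auto simp: level_Suc_iff)
    then have s: "section_at p h [j] u = u" "section_at p (section_at p h [j]) u \<in> P" "h [j] = [j]"
      using a by (auto simp: with_sections_def)
    have "h ([j] @ u) = [j] @ section_at p h [j] u"
      by (rule section_fixed_apply(1)[OF h]) (use v s level_words in auto)
    then have "h v = v" using s(1) v(1) by simp
    moreover have "section_at p h v \<in> P"
      using s(2) level_words[OF v(3)] v(1) by (simp add: section_at_append)
    ultimately show ?thesis by simp
  qed
  then show "h \<in> with_sections p (Suc n) P" using h by (simp add: with_sections_def)
qed

lemma with_sections_add:
  assumes "h \<in> with_sections p (n + m) P" "0 < p" "v \<in> level p n"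
  shows "h v = v" "section_at p h v \<in> with_sections p m P"
proof -
  have h: "h \<in> carrier (AutT p)" and hv: "\<And>w. w \<in> level p (n + m) \<Longrightarrow> h w = w \<and> section_at p h w \<in> P"
    using assms(1) by (auto simp: with_sections_def)
  show v: "h v = v" by (rule fixes_level_down[OF h assms(2) _ assms(3)]) (use hv in blast)
  have "section_at p h v w = w \<and> section_at p (section_at p h v) w \<in> P" if w: "w \<in> level p m" for w
    using hv[OF level_append[OF assms(3) w]] level_words[OF w] assms(3)
    by (simp add: section_at_append level_def)
  then show "section_at p h v \<in> with_sections p m P"
    using section_carrier[OF h level_words[OF assms(3)] v] by (simp add: with_sections_def)
qed

lemma with_sections_exists:
  assumes "0 < p" "\<And>v. v \<in> level p n \<Longrightarrow> s v \<in> carrier (AutT p)"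
  shows "\<exists>h\<in>carrier (AutT p). \<forall>v\<in>level p n. h v = v \<and> section_at p h v = s v"
  using assms(2)
proof (induction n arbitrary: s)
  case 0
  then show ?case
    using section_at_Nil AutT_carrierD(2,5)[of "s []"] by (intro bexI[of _ "s []"]) auto
next
  case (Suc n)
  have "\<exists>h\<in>carrier (AutT p). \<forall>v\<in>level p n. h v = v \<and> section_at p h v = s (j # v)" if "j < p" for j
    by (rule Suc.IH) (use that Suc.prems in \<open>auto simp: level_Suc_iff\<close>)
  then obtain t where t: "\<And>j. j < p \<Longrightarrow> t j \<in> carrier (AutT p)"
    "\<And>j v. j < p \<Longrightarrow> v \<in> level p n \<Longrightarrow> t j v = v \<and> section_at p (t j) v = s (j # v)"
    by metis
  have "spread p t v = v \<and> section_at p (spread p t) v = s v" if v: "v \<in> level p (Suc n)" for v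
  proof -
    obtain j u where "v = j # u" "j < p" "u \<in> level p n" using v by (auto simp: level_Suc_iff)
    then show ?thesis using t(2)[of j u] level_words[of u p n] by (simp add: section_at_spread)
  qed
  then show ?case by (intro bexI[OF _ spread_carrier[OF t(1)]] ballI)
qed

lemma with_sections_subgroup:
  assumes P: "subgroup P (AutT p)"
  shows "subgroup (with_sections p n P) (AutT p)"
proof -
  interpret T: group "AutT p" by (rule AutT_group)
  interpret P: subgroup P "AutT p" by (rule P)
  have one: "section_at p \<one>\<^bsub>AutT p\<^esub> v = \<one>\<^bsub>AutT p\<^esub>" if "v \<in> words p" for v
    by (rule AutT_eqI[where p = p]) (use that in \<open>auto simp: AutT_one\<close>)
  show ?thesis
  proof (rule T.subgroupI)
    show "with_sections p n P \<subseteq> carrier (AutT p)" by (auto simp: with_sections_def)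
    have "\<one>\<^bsub>AutT p\<^esub> \<in> with_sections p n P"
      using one by (auto simp: with_sections_def level_words)
    then show "with_sections p n P \<noteq> {}" by blast
    fix g assume g: "g \<in> with_sections p n P"
    then have gc: "g \<in> carrier (AutT p)" by (simp add: with_sections_def)
    have "(inv\<^bsub>AutT p\<^esub> g) v = v \<and> section_at p (inv\<^bsub>AutT p\<^esub> g) v \<in> P" if v: "v \<in> level p n" for v
    proof -
      have gv: "g v = v" "section_at p g v \<in> P" using g v by (auto simp: with_sections_def)
      have iv: "(inv\<^bsub>AutT p\<^esub> g) v = v"
        using fun_cong[OF T.r_inv[OF gc], of v] gv(1) level_words[OF v] by simp
      have ic: "inv\<^bsub>AutT p\<^esub> g \<in> carrier (AutT p)" by (rule T.inv_closed[OF gc])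
      have "section_at p (inv\<^bsub>AutT p\<^esub> g) v \<otimes>\<^bsub>AutT p\<^esub> section_at p g v = \<one>\<^bsub>AutT p\<^esub>"
        unfolding section_mult[OF ic level_words[OF v] iv, symmetric] T.l_inv[OF gc] by (rule one[OF level_words[OF v]])
      then have "inv\<^bsub>AutT p\<^esub> section_at p g v = section_at p (inv\<^bsub>AutT p\<^esub> g) v"
        by (rule T.inv_equality[OF _ section_carrier[OF gc level_words[OF v] gv(1)] section_carrier[OF ic level_words[OF v] iv]])
      then show ?thesis using iv P.m_inv_closed[OF gv(2)] by (simp only:)
    qed
    then show "inv\<^bsub>AutT p\<^esub> g \<in> with_sections p n P" using gc by (simp add: with_sections_def)
    fix h assume h: "h \<in> with_sections p n P"
    then have hc: "h \<in> carrier (AutT p)" by (simp add: with_sections_def)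
    have "(g \<otimes>\<^bsub>AutT p\<^esub> h) v = v \<and> section_at p (g \<otimes>\<^bsub>AutT p\<^esub> h) v \<in> P" if v: "v \<in> level p n" for v
      using g h v section_mult[OF gc level_words[OF v]] level_words[OF v] P.m_closed
      by (auto simp: with_sections_def)
    then show "g \<otimes>\<^bsub>AutT p\<^esub> h \<in> with_sections p n P" using gc hc by (simp add: with_sections_def)
  qed
qed

context nonsymmetric_EGS
begin

interpretation T: group "AutT p" by (rule AutT_group)
interpretation GG: group GG by (rule EGS_group_group)

abbreviation "bal n \<equiv> with_sections p n balanced"

lemma bal_0: "bal 0 = balanced"
  using subgroup.subset[OF balanced_subgroup] by (rule with_sections_0)

text \<open>Only the sections are required to be in \<open>\<Gamma>\<close>; that the elements themselves are in \<open>\<Gamma>\<close> is a consequence of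
  this inclusion and rests on the realization of balanced tuples.\<close>

lemma bal_Suc_subset: "bal (Suc n) \<subseteq> bal n"
proof (induction n)
  case 0
  show ?case
  proof
    fix h assume "h \<in> bal (Suc 0)"
    then have h: "h \<in> carrier (AutT p)" "\<And>j. j < p \<Longrightarrow> h [j] = [j]" "\<And>j. j < p \<Longrightarrow> section_at p h [j] \<in> balanced"
      by (auto simp: with_sections_Suc bal_0)
    have "spread p (\<lambda>j. section_at p h [j]) \<in> balanced" by (rule balanced_tuple) (rule h(3))
    then show "h \<in> bal 0" unfolding bal_0 using eq_spread_sections[OF h(1,2)] by simp
  qed
next
  case (Suc n)
  show ?case
  proof
    fix h assume "h \<in> bal (Suc (Suc n))"
    then show "h \<in> bal (Suc n)"
      using Suc.IH unfolding with_sections_Suc[OF p_pos, of h "Suc n"] with_sections_Suc[OF p_pos, of h n] by blast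
  qed
qed

lemma bal_subset_balanced: "bal n \<subseteq> balanced"
  by (induction n) (use bal_0 bal_Suc_subset in blast)+

lemma bal_subset_EGS: "bal n \<subseteq> \<Gamma>"
  using bal_subset_balanced by (auto simp: balanced_def)

lemma bal_subgroup: "subgroup (bal n) (AutT p)"
  by (rule with_sections_subgroup[OF balanced_subgroup])

lemma EGS_sections:
  "g \<in> \<Gamma> \<Longrightarrow> (\<And>v. v \<in> level p n \<Longrightarrow> g v = v) \<Longrightarrow> g \<in> with_sections p n \<Gamma>"
proof (induction n arbitrary: g)
  case 0
  then show ?case using with_sections_0[OF subgroup.subset[OF EGS_subgroup]] by simp
next
  case (Suc n)
  have gc: "g \<in> carrier (AutT p)" using Suc.prems(1) by (rule EGS_carrier)
  have fix1: "g [j] = [j]" if "j < p" for j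
    by (rule fixes_level_down[OF gc p_pos, of 1 n]) (use Suc.prems(2) that in \<open>auto simp: level_def\<close>)
  have "section_at p g [j] \<in> with_sections p n \<Gamma>" if j: "j < p" for j
  proof (rule Suc.IH)
    show "section_at p g [j] \<in> \<Gamma>"
      using EGS_tuplesD(1)[OF sections_in_EGS_tuples(1)[OF Suc.prems(1) fix1] j] .
    show "section_at p g [j] v = v" if "v \<in> level p n" for v
      using Suc.prems(2)[of "j # v"] that j level_words[OF that] by (auto simp: level_Suc_iff)
  qed
  then show ?case using gc fix1 by (simp add: with_sections_Suc)
qed

text \<open>This is how the kernel sees only balanced sections: a coset in a coherent sequence can be represented
  two levels further down.\<close>

lemma stab_subset_bal: "level_stab p \<Gamma> (n + 2) \<subseteq> bal n"
proof
  fix g assume "g \<in> level_stab p \<Gamma> (n + 2)"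
  then have g: "g \<in> \<Gamma>" "\<And>v. v \<in> level p (n + 2) \<Longrightarrow> g v = v" by (auto simp: level_stab_def)
  have gs: "g \<in> with_sections p (n + 2) \<Gamma>" by (rule EGS_sections[OF g])
  have "g v = v \<and> section_at p g v \<in> balanced" if v: "v \<in> level p n" for v
  proof -
    have s: "section_at p g v \<in> with_sections p 2 \<Gamma>" "g v = v"
      using with_sections_add[OF gs p_pos v] by auto
    have "section_at p g v \<in> \<Gamma>"
      using EGS_sections[OF g(1), of n] with_sections_add(1)[OF gs p_pos] v by (auto simp: with_sections_def)
    moreover have "section_at p g v [j, k] = [j, k]" if "j < p" "k < p" for j k
      using s(1) that unfolding with_sections_def by (auto simp: level_def)
    moreover have "section_at p g v [j] = [j]" if "j < p" for j
      using with_sections_add(1)[of "section_at p g v" p 1 1 \<Gamma> "[j]"] s(1) that by (simp add: level_def numeral_2_eq_2)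
    ultimately show ?thesis using balanced_of_two_levels s(2) by blast
  qed
  then show "g \<in> bal n" using EGS_carrier[OF g(1)] by (simp add: with_sections_def)
qed

text \<open>On a balanced section the exponent of \<open>b\<close> is the only coordinate left in the abelianization.\<close>

definition b_exp :: "nat \<Rightarrow> (nat list \<Rightarrow> nat list) \<Rightarrow> nat list \<Rightarrow> int" where
  "b_exp n h = (\<lambda>v\<in>level p n. int (letter_exp Lb (section_at p h v)))"

lemma bal_fixes: "h \<in> bal n \<Longrightarrow> v \<in> level p n \<Longrightarrow> h v = v"
  and bal_section: "h \<in> bal n \<Longrightarrow> v \<in> level p n \<Longrightarrow> section_at p h v \<in> balanced"
  and bal_carrier: "h \<in> bal n \<Longrightarrow> h \<in> carrier (AutT p)"
  by (auto simp: with_sections_def)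

lemma balanced_EGS: "g \<in> balanced \<Longrightarrow> g \<in> \<Gamma>"
  by (simp add: balanced_def)

lemma b_exp_mult:
  assumes "g \<in> bal n" "h \<in> bal n" "v \<in> level p n"
  shows "b_exp n (g \<cdot> h) v = (b_exp n g v + b_exp n h v) mod int p"
proof -
  have "section_at p (g \<cdot> h) v = section_at p g v \<cdot> section_at p h v"
    using section_mult[OF bal_carrier[OF assms(1)] level_words[OF assms(3)] bal_fixes[OF assms(1,3)]] .
  then show ?thesis
    using assms bal_section balanced_EGS by (simp add: b_exp_def letter_exp_mult of_nat_mod)
qed

text \<open>So \<open>H\<^sub>n\<close> is the kernel of \<open>b_exp n\<close> on \<open>bal n\<close>, and its cosets there are the fibers of \<open>b_exp n\<close>.\<close>

lemma H_sub_eq_b_exp: "H_sub p \<alpha> n = {h \<in> bal n. \<forall>v\<in>level p n. b_exp n h v = 0}"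
proof -
  have "g \<in> derived (AutT p) \<Gamma> \<longleftrightarrow> g \<in> balanced \<and> letter_exp Lb g = 0" for g
  proof
    assume "g \<in> derived (AutT p) \<Gamma>"
    then show "g \<in> balanced \<and> letter_exp Lb g = 0" by (auto simp: derived_eq balanced_def)
  next
    assume g: "g \<in> balanced \<and> letter_exp Lb g = 0"
    then have "letter_exp Lc g = 0"
      using nat_dvd_not_less[of "letter_exp Lc g" p] by (cases "letter_exp Lc g = 0") (auto simp: balanced_def)
    then have "letter_exp l g = 0" for l using g by (cases l) (auto simp: balanced_def)
    then show "g \<in> derived (AutT p) \<Gamma>" using g by (auto simp: derived_eq balanced_def)
  qed
  then show ?thesis by (auto simp: H_sub_def with_sections_def b_exp_def)
qed

text \<open>Powers of \<open>b c\<^sup>-\<^sup>1\<close> are balanced and can be prescribed independently as sections on level \<open>n\<close>.\<close>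

lemma b_exp_exists:
  assumes "\<And>v. v \<in> level p n \<Longrightarrow> 0 \<le> \<eta> v \<and> \<eta> v < int p"
  obtains h where "h \<in> bal n" "\<And>v. v \<in> level p n \<Longrightarrow> b_exp n h v = \<eta> v"
proof -
  define d where "d = elt ([Lb] @ replicate (p - 1) Lc)"
  have d_exp: "letter_exp La d = 0" "letter_exp Lb d = 1" "letter_exp Lc d = p - 1"
    using p_ge_3 by (simp_all add: d_def letter_exp_elt count_list_replicate del: append_Cons append_Nil)
  have d: "d \<in> \<Gamma>" by (simp add: d_def)
  define s where "s v = d [^]\<^bsub>GG\<^esub> nat (\<eta> v)" for v
  have s_exp: "s v \<in> \<Gamma>" "letter_exp l (s v) = (nat (\<eta> v) * letter_exp l d) mod p" for v l
    using letter_exp_pow[OF d] by (auto simp: s_def)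
  have s_bal: "s v \<in> balanced" for v
  proof -
    have "p dvd nat (\<eta> v) * 1 + nat (\<eta> v) * (p - 1)"
      unfolding add_mult_distrib2[symmetric] using p_ge_3 by simp
    then have "p dvd letter_exp Lb (s v) + letter_exp Lc (s v)"
      by (simp only: s_exp d_exp dvd_eq_mod_eq_0 mod_add_eq)
    then show ?thesis by (simp add: balanced_def s_exp d_exp)
  qed
  obtain h where h: "h \<in> carrier (AutT p)" "\<And>v. v \<in> level p n \<Longrightarrow> h v = v \<and> section_at p h v = s v"
    using with_sections_exists[OF p_pos, of n s] s_exp(1) EGS_carrier by blast
  have "h \<in> bal n" using h s_bal by (simp add: with_sections_def)
  moreover have "b_exp n h v = \<eta> v" if "v \<in> level p n" for v
    using h(2)[OF that] that assms[OF that] by (simp add: b_exp_def s_exp d_exp nat_less_iff)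
  ultimately show thesis using that by blast
qed

lemma b_exp_parent:
  assumes h: "h \<in> bal (Suc n)" and u: "u \<in> level p n"
  shows "b_exp n h u = (\<Sum>j<p. b_exp (Suc n) h (u @ [j])) mod int p"
proof -
  define g where "g = section_at p h u"
  have g: "g \<in> bal 1" using with_sections_add(2)[of h p n 1 balanced u] h u by (simp add: g_def)
  have gG: "g \<in> \<Gamma>" using g bal_subset_EGS by blast
  have fix1: "g [j] = [j]" if "j < p" for j using bal_fixes[OF g, of "[j]"] that by (simp add: level_def)
  have "letter_exp Lb g = (\<Sum>j<p. letter_exp Lb (section_at p g [j])) mod p"
    using sections_in_EGS_tuples[OF gG fix1] letter_exp_spread[of "\<lambda>j. section_at p g [j]" Lb] by simp
  then have "int (letter_exp Lb g) = (\<Sum>j<p. int (letter_exp Lb (section_at p g [j]))) mod int p"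
    by (simp add: of_nat_mod)
  also have "(\<Sum>j<p. int (letter_exp Lb (section_at p g [j]))) = (\<Sum>j<p. b_exp (Suc n) h (u @ [j]))"
  proof (rule sum.cong)
    fix j assume "j \<in> {..<p}"
    moreover from this have "u @ [j] \<in> level p (Suc n)" using u by (simp add: level_def)
    ultimately show "int (letter_exp Lb (section_at p g [j])) = b_exp (Suc n) h (u @ [j])"
      by (simp add: b_exp_def g_def section_at_append)
  qed simp
  finally show ?thesis using u by (simp add: b_exp_def g_def)
qed

lemma b_exp_range: "v \<in> level p n \<Longrightarrow> 0 \<le> b_exp n h v \<and> b_exp n h v < int p"
  by (simp add: b_exp_def)

end

section \<open>Projective limits of finite groups\<close>

lemma proj_lim_simps:
  "carrier (proj_lim m G \<phi>) = {x \<in> \<Pi>\<^sub>E n\<in>{m..}. carrier (G n). \<forall>n\<ge>m. \<phi> (Suc n) (x (Suc n)) = x n}"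
  "x \<otimes>\<^bsub>proj_lim m G \<phi>\<^esub> y = (\<lambda>n\<in>{m..}. x n \<otimes>\<^bsub>G n\<^esub> y n)"
  "\<one>\<^bsub>proj_lim m G \<phi>\<^esub> = (\<lambda>n\<in>{m..}. \<one>\<^bsub>G n\<^esub>)"
  by (simp_all add: proj_lim_def)

lemma proj_lim_subgroup:
  assumes G: "\<And>n. n \<ge> m \<Longrightarrow> group (G n)" and \<phi>: "\<And>n. n \<ge> m \<Longrightarrow> \<phi> (Suc n) \<in> hom (G (Suc n)) (G n)"
  shows "subgroup (carrier (proj_lim m G \<phi>)) (product_group {m..} G)"
proof -
  interpret P: group "product_group {m..} G" by (rule product_group) (simp add: G)
  show ?thesis
  proof (rule P.subgroupI)
    show "carrier (proj_lim m G \<phi>) \<subseteq> carrier (product_group {m..} G)" by (auto simp: proj_lim_simps)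
    have "\<phi> (Suc n) \<one>\<^bsub>G (Suc n)\<^esub> = \<one>\<^bsub>G n\<^esub>" if "n \<ge> m" for n
      using hom_one[OF \<phi>[OF that] G G[OF that]] that by simp
    then have "(\<lambda>n\<in>{m..}. \<one>\<^bsub>G n\<^esub>) \<in> carrier (proj_lim m G \<phi>)"
      using G by (auto simp: proj_lim_simps group.is_monoid monoid.one_closed)
    then show "carrier (proj_lim m G \<phi>) \<noteq> {}" by blast
    fix x assume x: "x \<in> carrier (proj_lim m G \<phi>)"
    then have xc: "x \<in> (\<Pi>\<^sub>E n\<in>{m..}. carrier (G n))" and xn: "\<And>n. n \<ge> m \<Longrightarrow> x n \<in> carrier (G n)"
      and xeq: "\<And>n. n \<ge> m \<Longrightarrow> \<phi> (Suc n) (x (Suc n)) = x n"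
      by (auto simp: proj_lim_simps)
    have "\<phi> (Suc n) (inv\<^bsub>G (Suc n)\<^esub> x (Suc n)) = inv\<^bsub>G n\<^esub> x n" if n: "n \<ge> m" for n
    proof -
      interpret h: group_hom "G (Suc n)" "G n" "\<phi> (Suc n)"
        using G[of n] G[of "Suc n"] \<phi>[OF n] n by (simp add: group_hom_def group_hom_axioms_def)
      show ?thesis using h.hom_inv[of "x (Suc n)"] xn[of "Suc n"] xeq[OF n] n by simp
    qed
    then show "inv\<^bsub>product_group {m..} G\<^esub> x \<in> carrier (proj_lim m G \<phi>)"
      using inv_product_group[OF xc] G xn by (auto simp: proj_lim_simps group.inv_closed)
    fix y assume y: "y \<in> carrier (proj_lim m G \<phi>)"
    then have yn: "\<And>n. n \<ge> m \<Longrightarrow> y n \<in> carrier (G n)"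
      and yeq: "\<And>n. n \<ge> m \<Longrightarrow> \<phi> (Suc n) (y (Suc n)) = y n"
      by (auto simp: proj_lim_simps)
    have "\<phi> (Suc n) (x (Suc n) \<otimes>\<^bsub>G (Suc n)\<^esub> y (Suc n)) = x n \<otimes>\<^bsub>G n\<^esub> y n" if n: "n \<ge> m" for n
      using hom_mult[OF \<phi>[OF n], of "x (Suc n)" "y (Suc n)"] xn yn xeq[OF n] yeq[OF n] n by simp
    then show "x \<otimes>\<^bsub>product_group {m..} G\<^esub> y \<in> carrier (proj_lim m G \<phi>)"
      using G xn yn by (auto simp: proj_lim_simps group.is_monoid monoid.m_closed)
  qed
qed

lemma proj_lim_group:
  assumes "\<And>n. n \<ge> m \<Longrightarrow> group (G n)" "\<And>n. n \<ge> m \<Longrightarrow> \<phi> (Suc n) \<in> hom (G (Suc n)) (G n)"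
  shows "group (proj_lim m G \<phi>)"
    and "x \<in> carrier (proj_lim m G \<phi>) \<Longrightarrow> inv\<^bsub>proj_lim m G \<phi>\<^esub> x = (\<lambda>n\<in>{m..}. inv\<^bsub>G n\<^esub> x n)"
proof -
  have P: "group (product_group {m..} G)" by (rule product_group) (simp add: assms(1))
  have eq: "proj_lim m G \<phi> = (product_group {m..} G)\<lparr>carrier := carrier (proj_lim m G \<phi>)\<rparr>"
    by (simp add: proj_lim_def)
  have sub: "subgroup (carrier (proj_lim m G \<phi>)) (product_group {m..} G)"
    using assms by (rule proj_lim_subgroup)
  show "group (proj_lim m G \<phi>)"
    by (subst eq) (rule subgroup.subgroup_is_group[OF sub P])
  assume x: "x \<in> carrier (proj_lim m G \<phi>)"
  have "inv\<^bsub>proj_lim m G \<phi>\<^esub> x = inv\<^bsub>product_group {m..} G\<^esub> x"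
    by (subst eq) (rule group.m_inv_consistent[OF P sub x])
  then show "inv\<^bsub>proj_lim m G \<phi>\<^esub> x = (\<lambda>n\<in>{m..}. inv\<^bsub>G n\<^esub> x n)"
    using x assms(1) inv_product_group[of x "{m..}" G] unfolding proj_lim_simps by auto
qed

lemma discrete_coordinate:
  assumes "n \<in> I"
  shows "continuous_map (subtopology (product_topology (\<lambda>n. discrete_topology (C n)) I) L)
    (discrete_topology (C n)) (\<lambda>x. x n)"
  using continuous_map_from_subtopology[OF continuous_map_product_projection[OF assms]] .

lemma Hausdorff_discrete_product_subspace:
  "Hausdorff_space (subtopology (product_topology (\<lambda>n. discrete_topology (C n)) I) L)"
  by (intro Hausdorff_space_subtopology) (simp add: Hausdorff_space_product_topology)

lemma totally_disconnected_discrete_product_subspace: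
  "totally_disconnected (subtopology (product_topology (\<lambda>n. discrete_topology (C n)) I) L)"
  unfolding totally_disconnected_def
proof (intro allI impI)
  let ?X = "subtopology (product_topology (\<lambda>n. discrete_topology (C n)) I) L"
  fix S assume S: "connectedin ?X S"
  have ext: "S \<subseteq> extensional I"
    using connectedin_subset_topspace[OF S] by (auto simp: PiE_iff)
  have coord: "x n = y n" if xy: "x \<in> S" "y \<in> S" and n: "n \<in> I" for x y n
  proof -
    have "connectedin (discrete_topology (C n)) ((\<lambda>x. x n) ` S)"
      by (rule connectedin_continuous_map_image[OF discrete_coordinate[OF n] S])
    then obtain c where "(\<lambda>x. x n) ` S \<subseteq> {c}" by (auto simp: connectedin_discrete_topology)
    then show ?thesis using xy by blast
  qed
  show "\<exists>a. S \<subseteq> {a}"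
  proof (cases "S = {}")
    case False
    then obtain x where x: "x \<in> S" by blast
    have "y = x" if "y \<in> S" for y
      by (rule extensionalityI[of _ I]) (use ext x that coord in auto)
    then show ?thesis by blast
  qed auto
qed

text \<open>On discrete spaces an arbitrary function of continuous maps is continuous. All continuity
  statements below reduce to this, coordinate by coordinate.\<close>

lemma continuous_discrete_map2:
  assumes "continuous_map X (discrete_topology C) f" "continuous_map X (discrete_topology C') g"
    and "\<And>a b. a \<in> C \<Longrightarrow> b \<in> C' \<Longrightarrow> F a b \<in> C''"
  shows "continuous_map X (discrete_topology C'') (\<lambda>x. F (f x) (g x))"
proof -
  have "continuous_map X (discrete_topology (C \<times> C')) (\<lambda>x. (f x, g x))"
    unfolding prod_topology_discrete_topology using assms(1,2) by (rule continuous_map_pairedI)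
  moreover have "continuous_map (discrete_topology (C \<times> C')) (discrete_topology C'') (\<lambda>(a, b). F a b)"
    using assms(3) by (auto simp: continuous_map_from_discrete_topology)
  ultimately have "continuous_map X (discrete_topology C'') ((\<lambda>(a, b). F a b) \<circ> (\<lambda>x. (f x, g x)))"
    by (rule continuous_map_compose)
  then show ?thesis by (simp add: o_def)
qed

lemma topspace_proj_lim: "topspace (proj_lim_topology m G \<phi>) = carrier (proj_lim m G \<phi>)"
  by (auto simp: proj_lim_topology_def proj_lim_simps)

lemma continuous_map_into_proj_lim:
  assumes "\<And>x. x \<in> topspace X \<Longrightarrow> f x \<in> carrier (proj_lim m G \<phi>)"
    and "\<And>n. n \<ge> m \<Longrightarrow> continuous_map X (discrete_topology (carrier (G n))) (\<lambda>x. f x n)"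
  shows "continuous_map X (proj_lim_topology m G \<phi>) f"
  unfolding proj_lim_topology_def continuous_map_in_subtopology continuous_map_componentwise
  using assms by (auto simp: proj_lim_simps PiE_iff)

lemma proj_lim_coordinate:
  assumes "n \<ge> m"
  shows "continuous_map (proj_lim_topology m G \<phi>) (discrete_topology (carrier (G n))) (\<lambda>x. x n)"
  unfolding proj_lim_topology_def by (rule discrete_coordinate) (use assms in simp)

text \<open>The limit is the intersection of the sets on which two neighbouring coordinates match, and each of these
  is closed, being the preimage of a subset of a discrete space.\<close>

lemma proj_lim_compact:
  assumes fin: "\<And>n. n \<ge> m \<Longrightarrow> finite (carrier (G n))"
  shows "compact_space (proj_lim_topology m G \<phi>)"
proof -
  define X where "X = product_topology (\<lambda>n. discrete_topology (carrier (G n))) {m..}"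
  have "compact_space X"
    unfolding X_def compact_space_product_topology using fin by (auto simp: compact_space_discrete_topology)
  define A where "A n = {x \<in> topspace X. (x (Suc n), x n) \<in> {(a, b). a \<in> carrier (G (Suc n)) \<and> b \<in> carrier (G n) \<and> \<phi> (Suc n) a = b}}" for n
  have "closedin X (A n)" if n: "n \<ge> m" for n
    unfolding A_def
  proof (rule closedin_continuous_map_preimage)
    show "continuous_map X (discrete_topology (carrier (G (Suc n)) \<times> carrier (G n))) (\<lambda>x. (x (Suc n), x n))"
      unfolding prod_topology_discrete_topology X_def
      by (intro continuous_map_pairedI continuous_map_product_projection) (use n in auto)
  qed auto
  then have "closedin X (\<Inter> (A ` {m..}))" by (intro closedin_Inter) auto
  also have "\<Inter> (A ` {m..}) = carrier (proj_lim m G \<phi>)"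
    by (auto simp: A_def X_def proj_lim_simps PiE_iff)
  finally have "compactin X (carrier (proj_lim m G \<phi>))"
    by (rule closedin_compact_space[OF \<open>compact_space X\<close>])
  then show ?thesis
    unfolding proj_lim_topology_def X_def by (rule compact_space_subtopology)
qed

lemma proj_lim_profinite:
  assumes G: "\<And>n. n \<ge> m \<Longrightarrow> group (G n)" and \<phi>: "\<And>n. n \<ge> m \<Longrightarrow> \<phi> (Suc n) \<in> hom (G (Suc n)) (G n)"
    and fin: "\<And>n. n \<ge> m \<Longrightarrow> finite (carrier (G n))"
  shows "profinite_group (proj_lim m G \<phi>) (proj_lim_topology m G \<phi>)"
proof -
  let ?P = "proj_lim m G \<phi>" and ?X = "proj_lim_topology m G \<phi>"
  interpret P: group ?P using G \<phi> by (rule proj_lim_group)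
  have "continuous_map (prod_topology ?X ?X) ?X (\<lambda>z. fst z \<otimes>\<^bsub>?P\<^esub> snd z)"
  proof (rule continuous_map_into_proj_lim)
    show "fst z \<otimes>\<^bsub>?P\<^esub> snd z \<in> carrier ?P" if "z \<in> topspace (prod_topology ?X ?X)" for z
      using that by (auto simp: topspace_proj_lim)
    fix n assume n: "n \<ge> m"
    have "continuous_map (prod_topology ?X ?X) (discrete_topology (carrier (G n)))
        (\<lambda>z. (\<lambda>x. x n) (fst z) \<otimes>\<^bsub>G n\<^esub> (\<lambda>x. x n) (snd z))"
      by (rule continuous_discrete_map2[OF
          continuous_map_compose[OF continuous_map_fst proj_lim_coordinate[OF n], unfolded o_def]
          continuous_map_compose[OF continuous_map_snd proj_lim_coordinate[OF n], unfolded o_def]])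
        (rule monoid.m_closed[OF group.is_monoid[OF G[OF n]]])
    then show "continuous_map (prod_topology ?X ?X) (discrete_topology (carrier (G n)))
        (\<lambda>z. (fst z \<otimes>\<^bsub>?P\<^esub> snd z) n)" using n by (simp add: proj_lim_simps)
  qed
  moreover have "continuous_map ?X ?X (\<lambda>x. inv\<^bsub>?P\<^esub> x)"
  proof (rule continuous_map_into_proj_lim)
    show "inv\<^bsub>?P\<^esub> x \<in> carrier ?P" if "x \<in> topspace ?X" for x
      using that by (simp add: topspace_proj_lim)
    fix n assume n: "n \<ge> m"
    have "continuous_map ?X (discrete_topology (carrier (G n))) (\<lambda>x. inv\<^bsub>G n\<^esub> (x n))"
      by (rule continuous_discrete_map2[OF proj_lim_coordinate[OF n] proj_lim_coordinate[OF n]])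
        (rule group.inv_closed[OF G[OF n]])
    then show "continuous_map ?X (discrete_topology (carrier (G n))) (\<lambda>x. (inv\<^bsub>?P\<^esub> x) n)"
      by (rule continuous_map_eq) (use proj_lim_group(2)[of m G \<phi>, OF G \<phi>] n in \<open>simp add: topspace_proj_lim\<close>)
  qed
  ultimately have "topological_group ?P ?X"
    unfolding topological_group_def by (simp add: P.is_group topspace_proj_lim case_prod_unfold)
  then show ?thesis
    unfolding profinite_group_def
    using proj_lim_compact[of m G \<phi>] fin
      Hausdorff_discrete_product_subspace[of "\<lambda>n. carrier (G n)" "{m..}" "carrier ?P"]
      totally_disconnected_discrete_product_subspace[of "\<lambda>n. carrier (G n)" "{m..}" "carrier ?P"]
    by (simp add: proj_lim_topology_def)
qed

lemma totally_disconnected_homeomorphic: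
  assumes "homeomorphic_maps X Y f g" "totally_disconnected X"
  shows "totally_disconnected Y"
  unfolding totally_disconnected_def
proof (intro allI impI)
  fix S assume S: "connectedin Y S"
  have g: "continuous_map Y X g" and fg: "\<And>y. y \<in> topspace Y \<Longrightarrow> f (g y) = y"
    using assms(1) by (auto simp: homeomorphic_maps_def)
  obtain a where "g ` S \<subseteq> {a}"
    using connectedin_continuous_map_image[OF g S] assms(2) unfolding totally_disconnected_def by blast
  then have "S \<subseteq> {f a}" using fg connectedin_subset_topspace[OF S] by fastforce
  then show "\<exists>a. S \<subseteq> {a}" by blast
qed

text \<open>The group axioms of the target are carried over along the bijection, too: all that has to be known about
  its multiplication is that \<open>f\<close> respects it.\<close>

lemma profinite_group_transport:
  assumes prof: "profinite_group G X" and homeo: "homeomorphic_maps X Y f g" and Y: "topspace Y = carrier H"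
    and mult: "\<And>x y. x \<in> carrier G \<Longrightarrow> y \<in> carrier G \<Longrightarrow> f (x \<otimes>\<^bsub>G\<^esub> y) = f x \<otimes>\<^bsub>H\<^esub> f y"
    and one: "f \<one>\<^bsub>G\<^esub> = \<one>\<^bsub>H\<^esub>"
  shows "profinite_group H Y" "f \<in> iso G H"
proof -
  interpret G: group G using prof by (simp add: profinite_group_def topological_group_def)
  have X: "topspace X = carrier G" and cm: "continuous_map (prod_topology X X) X (\<lambda>(x, y). x \<otimes>\<^bsub>G\<^esub> y)"
    and ci: "continuous_map X X (\<lambda>x. inv\<^bsub>G\<^esub> x)"
    using prof by (auto simp: profinite_group_def topological_group_def)
  have f: "continuous_map X Y f" and g: "continuous_map Y X g"
    and gf: "\<And>x. x \<in> carrier G \<Longrightarrow> g (f x) = x" and fg: "\<And>y. y \<in> carrier H \<Longrightarrow> f (g y) = y"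
    using homeo by (auto simp: homeomorphic_maps_def X Y)
  have fc: "f x \<in> carrier H" if "x \<in> carrier G" for x using f that X Y by (auto simp: continuous_map_def)
  have gc: "g y \<in> carrier G" if "y \<in> carrier H" for y using g that X Y by (auto simp: continuous_map_def)
  have Hmult: "y \<otimes>\<^bsub>H\<^esub> z = f (g y \<otimes>\<^bsub>G\<^esub> g z)" if "y \<in> carrier H" "z \<in> carrier H" for y z
    using mult[OF gc[OF that(1)] gc[OF that(2)]] fg that by simp
  interpret H: group H
  proof (rule groupI)
    show "x \<otimes>\<^bsub>H\<^esub> y \<in> carrier H" if "x \<in> carrier H" "y \<in> carrier H" for x y
      using that by (simp add: Hmult fc gc)
    show "\<one>\<^bsub>H\<^esub> \<in> carrier H" using fc[OF G.one_closed] one by simp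
    show "x \<otimes>\<^bsub>H\<^esub> y \<otimes>\<^bsub>H\<^esub> z = x \<otimes>\<^bsub>H\<^esub> (y \<otimes>\<^bsub>H\<^esub> z)"
      if "x \<in> carrier H" "y \<in> carrier H" "z \<in> carrier H" for x y z
      using that by (simp add: Hmult fc gc gf G.m_assoc)
    show "\<one>\<^bsub>H\<^esub> \<otimes>\<^bsub>H\<^esub> x = x" if "x \<in> carrier H" for x
      using mult[OF G.one_closed gc[OF that]] that one by (simp add: fg gc)
    show "\<exists>y\<in>carrier H. y \<otimes>\<^bsub>H\<^esub> x = \<one>\<^bsub>H\<^esub>" if "x \<in> carrier H" for x
      using mult[OF G.inv_closed[OF gc[OF that]] gc[OF that]] that one
      by (intro bexI[of _ "f (inv\<^bsub>G\<^esub> g x)"]) (simp_all add: fg gc fc)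
  qed
  have Hinv: "inv\<^bsub>H\<^esub> y = f (inv\<^bsub>G\<^esub> g y)" if "y \<in> carrier H" for y
    using mult[OF G.inv_closed[OF gc[OF that]] gc[OF that]] that one
    by (intro H.inv_equality) (simp_all add: fg gc fc)
  have "continuous_map (prod_topology Y Y) X (\<lambda>z. g (fst z) \<otimes>\<^bsub>G\<^esub> g (snd z))"
    using continuous_map_compose[OF continuous_map_pairedI[OF
        continuous_map_compose[OF continuous_map_fst g] continuous_map_compose[OF continuous_map_snd g]] cm]
    by (simp add: o_def)
  then have "continuous_map (prod_topology Y Y) Y (\<lambda>z. f (g (fst z) \<otimes>\<^bsub>G\<^esub> g (snd z)))"
    using continuous_map_compose[OF _ f] by (simp add: o_def)
  then have "continuous_map (prod_topology Y Y) Y (\<lambda>(y, z). y \<otimes>\<^bsub>H\<^esub> z)"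
    by (rule continuous_map_eq) (auto simp: Y Hmult)
  moreover have "continuous_map Y Y (\<lambda>y. f (inv\<^bsub>G\<^esub> g y))"
    using continuous_map_compose[OF continuous_map_compose[OF g ci] f] by (simp add: o_def)
  then have "continuous_map Y Y (\<lambda>y. inv\<^bsub>H\<^esub> y)"
    by (rule continuous_map_eq) (auto simp: Y Hinv)
  ultimately have "topological_group H Y" by (simp add: topological_group_def H.is_group Y)
  moreover have "X homeomorphic_space Y" using homeo by (auto simp: homeomorphic_space_def)
  ultimately show "profinite_group H Y"
    using prof homeomorphic_compact_space homeomorphic_Hausdorff_space totally_disconnected_homeomorphic[OF homeo]
    by (auto simp: profinite_group_def)
  have "bij_betw f (carrier G) (carrier H)"
    by (rule bij_betw_byWitness[of _ g]) (auto simp: gf fg fc gc)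
  then show "f \<in> iso G H" using mult fc by (auto simp: iso_def hom_def)
qed

section \<open>The inverse system of direct sums\<close>

lemma Ztilde_carrier:
  assumes "0 < p"
  shows "carrier (Ztilde p n) = (\<Pi>\<^sub>E v\<in>(if n = 0 then {} else level p n). {0..<int p})"
  using assms finite_level[of p n]
  unfolding Ztilde_def by (subst carrier_sum_group) (auto simp: carrier_integer_mod_group)

lemma Ztilde_group: "group (Ztilde p n)"
  unfolding Ztilde_def by (rule sum_group) simp

lemma Ztilde_mult: "0 < n \<Longrightarrow> x \<otimes>\<^bsub>Ztilde p n\<^esub> y = (\<lambda>v\<in>level p n. (x v + y v) mod int p)"
  by (simp add: Ztilde_def)

lemma Ztilde_one: "0 < n \<Longrightarrow> \<one>\<^bsub>Ztilde p n\<^esub> = (\<lambda>v\<in>level p n. 0)"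
  by (simp add: Ztilde_def)

lemma Ztilde_finite: "0 < p \<Longrightarrow> finite (carrier (Ztilde p n))"
  unfolding Ztilde_carrier by (rule finite_PiE) (auto simp: finite_level)

lemma level_children:
  assumes "u \<in> level p n"
  shows "{v \<in> level p (Suc n). prefix u v} = (\<lambda>j. u @ [j]) ` {..<p}"
proof (intro equalityI subsetI)
  fix v assume v: "v \<in> {v \<in> level p (Suc n). prefix u v}"
  then obtain w where w: "v = u @ w" by (auto simp: prefix_def)
  then have "length w = 1" using v assms by (auto simp: level_def)
  then obtain j where "w = [j]" by (auto simp: length_Suc_conv)
  then show "v \<in> (\<lambda>j. u @ [j]) ` {..<p}" using v w by (auto simp: level_def)
qed (use assms in \<open>auto simp: level_def\<close>)

lemma theta_Suc:
  assumes "0 < n"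
  shows "theta p (Suc n) x = (\<lambda>u\<in>level p n. (\<Sum>j<p. x (u @ [j])) mod int p)"
proof -
  have "theta p (Suc n) x = (\<lambda>u\<in>level p n. (\<Sum>v\<in>{v \<in> level p (Suc n). prefix u v}. x v) mod int p)"
    using assms by (simp add: theta_def)
  also have "\<dots> = (\<lambda>u\<in>level p n. (\<Sum>j<p. x (u @ [j])) mod int p)"
  proof (rule restrict_ext)
    fix u assume "u \<in> level p n"
    then show "(\<Sum>v\<in>{v \<in> level p (Suc n). prefix u v}. x v) mod int p = (\<Sum>j<p. x (u @ [j])) mod int p"
      by (simp add: level_children sum.reindex inj_on_def)
  qed
  finally show ?thesis .
qed

text \<open>For \<open>n = 0\<close> the target is the trivial group, and \<open>\<theta>\<close> is constant.\<close>

lemma theta_hom: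
  assumes "0 < p" shows "theta p (Suc n) \<in> hom (Ztilde p (Suc n)) (Ztilde p n)"
proof (cases "n = 0")
  case True
  then show ?thesis
    using group.is_monoid[OF Ztilde_group, of p 0]
    by (auto simp: hom_def theta_def monoid.one_closed monoid.l_one simp del: One_nat_def)
next
  case False
  show ?thesis
  proof (rule homI)
    fix x assume "x \<in> carrier (Ztilde p (Suc n))"
    then show "theta p (Suc n) x \<in> carrier (Ztilde p n)"
      using False assms by (simp add: theta_Suc Ztilde_carrier)
  next
    fix x y assume "x \<in> carrier (Ztilde p (Suc n))" "y \<in> carrier (Ztilde p (Suc n))"
    show "theta p (Suc n) (x \<otimes>\<^bsub>Ztilde p (Suc n)\<^esub> y) = theta p (Suc n) x \<otimes>\<^bsub>Ztilde p n\<^esub> theta p (Suc n) y"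
    proof -
      have "(\<Sum>j<p. (\<lambda>v\<in>level p (Suc n). (x v + y v) mod int p) (u @ [j])) mod int p
          = ((\<Sum>j<p. x (u @ [j])) mod int p + (\<Sum>j<p. y (u @ [j])) mod int p) mod int p"
        if u: "u \<in> level p n" for u
      proof -
        have "(\<Sum>j<p. (\<lambda>v\<in>level p (Suc n). (x v + y v) mod int p) (u @ [j]))
            = (\<Sum>j<p. (x (u @ [j]) + y (u @ [j])) mod int p)"
          by (rule sum.cong) (use u in \<open>auto simp: level_def\<close>)
        also have "\<dots> mod int p = (\<Sum>j<p. x (u @ [j]) + y (u @ [j])) mod int p"
          by (rule mod_sum_eq)
        finally show ?thesis by (simp add: sum.distrib mod_add_eq)
      qed
      then show ?thesis
        using False by (simp add: theta_Suc Ztilde_mult cong: restrict_cong)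
    qed
  qed
qed

lemma Ztilde_inf_profinite:
  assumes "0 < p" shows "profinite_group (Ztilde_inf p) (Ztilde_inf_topology p)"
  unfolding Ztilde_inf_def Ztilde_inf_topology_def
  by (rule proj_lim_profinite) (simp_all add: Ztilde_group theta_hom Ztilde_finite assms)

lemma Ztilde_inf_pow:
  assumes "0 < p" "x \<in> carrier (Ztilde_inf p)" "0 < n" "v \<in> level p n"
  shows "(x [^]\<^bsub>Ztilde_inf p\<^esub> (k::nat)) n v = (int k * x n v) mod int p"
proof (induction k)
  case 0
  then show ?case using assms by (simp add: Ztilde_inf_def proj_lim_simps Ztilde_one)
next
  case (Suc k)
  have "(x [^]\<^bsub>Ztilde_inf p\<^esub> Suc k) n v = ((x [^]\<^bsub>Ztilde_inf p\<^esub> k) n v + x n v) mod int p"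
    using assms by (simp add: Ztilde_inf_def proj_lim_simps Ztilde_mult)
  then show ?case using Suc by (simp add: mod_simps algebra_simps)
qed

lemma Ztilde_inf_eqI:
  assumes "0 < p" "x \<in> carrier (Ztilde_inf p)" "y \<in> carrier (Ztilde_inf p)"
    and "\<And>n v. 0 < n \<Longrightarrow> v \<in> level p n \<Longrightarrow> x n v = y n v"
  shows "x = y"
proof (rule extensionalityI[of _ "{0..}"])
  fix n :: nat assume "n \<in> {0..}"
  have n: "x n \<in> carrier (Ztilde p n)" "y n \<in> carrier (Ztilde p n)"
    using assms(2,3) by (auto simp: Ztilde_inf_def proj_lim_simps)
  show "x n = y n"
    by (rule extensionalityI[of _ "if n = 0 then {} else level p n"])
      (use n assms(1,4) in \<open>auto simp: Ztilde_carrier PiE_iff split: if_splits\<close>)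
qed (use assms(2,3) in \<open>auto simp: Ztilde_inf_def proj_lim_simps PiE_iff\<close>)

lemma Ztilde_inf_comm:
  assumes "0 < p" shows "comm_group (Ztilde_inf p)"
proof -
  interpret group "Ztilde_inf p"
    using Ztilde_inf_profinite[OF assms] by (simp add: profinite_group_def topological_group_def)
  show ?thesis
  proof (rule group_comm_groupI)
    fix x y assume xy: "x \<in> carrier (Ztilde_inf p)" "y \<in> carrier (Ztilde_inf p)"
    show "x \<otimes>\<^bsub>Ztilde_inf p\<^esub> y = y \<otimes>\<^bsub>Ztilde_inf p\<^esub> x"
      by (rule Ztilde_inf_eqI[OF assms m_closed[OF xy] m_closed[OF xy(2,1)]])
        (simp add: Ztilde_inf_def proj_lim_simps Ztilde_mult add.commute)
  qed
qed

lemma Ztilde_inf_exponent: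
  assumes p: "0 < p" shows "has_exponent (Ztilde_inf p) p"
proof -
  interpret group "Ztilde_inf p"
    using Ztilde_inf_profinite[OF p] by (simp add: profinite_group_def topological_group_def)
  have "x [^]\<^bsub>Ztilde_inf p\<^esub> p = \<one>\<^bsub>Ztilde_inf p\<^esub>" if x: "x \<in> carrier (Ztilde_inf p)" for x
  proof (rule Ztilde_inf_eqI[OF p])
    fix n v assume "0 < n" "v \<in> level p n"
    then show "(x [^]\<^bsub>Ztilde_inf p\<^esub> p) n v = \<one>\<^bsub>Ztilde_inf p\<^esub> n v"
      unfolding Ztilde_inf_pow[OF p x \<open>0 < n\<close> \<open>v \<in> level p n\<close>]
      by (simp add: Ztilde_inf_def proj_lim_simps Ztilde_one)
  qed (use x in simp_all)
  moreover have "p \<le> m"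
    if m: "0 < m" "\<forall>x\<in>carrier (Ztilde_inf p). x [^]\<^bsub>Ztilde_inf p\<^esub> m = \<one>\<^bsub>Ztilde_inf p\<^esub>" for m
  proof (cases "p = 1")
    case False
    \<comment> \<open>The constant thread along the leftmost branch has order \<open>p\<close>.\<close>
    define y :: "nat \<Rightarrow> nat list \<Rightarrow> int"
      where "y n = (\<lambda>v\<in>(if n = 0 then {} else level p n). if v = replicate n 0 then 1 else 0)" for n
    have "y \<in> carrier (Ztilde_inf p)"
    proof -
      have "theta p (Suc n) (y (Suc n)) = y n" for n
      proof (cases "n = 0")
        case True
        then show ?thesis by (simp add: y_def theta_def Ztilde_def fun_eq_iff)
      next
        case n: False
        have "(\<Sum>j<p. y (Suc n) (u @ [j])) mod int p = y n u" if u: "u \<in> level p n" for u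
        proof -
          have "y (Suc n) (u @ [j]) = (if j = 0 then y n u else 0)" if "j < p" for j
          proof -
            have "replicate (Suc n) (0::nat) = replicate n 0 @ [0]" by (simp add: replicate_append_same)
            then show ?thesis using that u n by (auto simp: y_def level_def simp del: replicate_Suc)
          qed
          then have "(\<Sum>j<p. y (Suc n) (u @ [j])) = (\<Sum>j<p. if j = 0 then y n u else 0)" by simp
          also have "\<dots> = y n u" using p by simp
          finally show ?thesis using False p n u by (simp add: y_def)
        qed
        then show ?thesis using n by (auto simp: theta_Suc y_def cong: restrict_cong)
      qed
      then show ?thesis
        using p False by (auto simp: Ztilde_inf_def proj_lim_simps Ztilde_carrier y_def PiE_iff extensional_def)
    qed
    then have "(y [^]\<^bsub>Ztilde_inf p\<^esub> m) 1 [0] = 0" "(y [^]\<^bsub>Ztilde_inf p\<^esub> m) 1 [0] = (int m * y 1 [0]) mod int p"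
      using m Ztilde_inf_pow[OF p, of y 1 "[0]" m] p
      by (simp_all add: Ztilde_inf_def proj_lim_simps Ztilde_one level_def)
    then have "int m mod int p = 0" using p by (simp add: y_def level_def)
    then have "p dvd m" by (simp add: dvd_eq_mod_eq_0 flip: of_nat_mod)
    then show ?thesis using m(1) by (rule dvd_imp_le)
  qed (use m in simp)
  ultimately show ?thesis using p by (auto simp: has_exponent_def)
qed

lemma has_exponent_iso:
  assumes "group G" "group H" "f \<in> iso G H" "has_exponent G k"
  shows "has_exponent H k"
proof -
  have pow: "f (x [^]\<^bsub>G\<^esub> n) = f x [^]\<^bsub>H\<^esub> n" if "x \<in> carrier G" for x and n :: nat
    using hom_nat_pow[OF _ that assms(1,2)] assms(3) by (simp add: iso_def)
  have one: "f \<one>\<^bsub>G\<^esub> = \<one>\<^bsub>H\<^esub>" using hom_one[OF _ assms(1,2)] assms(3) by (simp add: iso_def)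
  have bij: "bij_betw f (carrier G) (carrier H)" using assms(3) by (simp add: iso_def)
  have "(\<forall>y\<in>carrier H. y [^]\<^bsub>H\<^esub> n = \<one>\<^bsub>H\<^esub>) \<longleftrightarrow> (\<forall>x\<in>carrier G. x [^]\<^bsub>G\<^esub> n = \<one>\<^bsub>G\<^esub>)" for n :: nat
  proof -
    have "(\<forall>y\<in>carrier H. y [^]\<^bsub>H\<^esub> n = \<one>\<^bsub>H\<^esub>) \<longleftrightarrow> (\<forall>x\<in>carrier G. f x [^]\<^bsub>H\<^esub> n = \<one>\<^bsub>H\<^esub>)"
      unfolding bij_betw_imp_surj_on[OF bij, symmetric] by simp
    also have "\<dots> \<longleftrightarrow> (\<forall>x\<in>carrier G. x [^]\<^bsub>G\<^esub> n = \<one>\<^bsub>G\<^esub>)"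
    proof (intro ball_cong refl)
      fix x assume x: "x \<in> carrier G"
      have "x [^]\<^bsub>G\<^esub> n \<in> carrier G" "\<one>\<^bsub>G\<^esub> \<in> carrier G"
        using x assms(1) by (simp_all add: group.is_monoid monoid.nat_pow_closed monoid.one_closed)
      then have "f (x [^]\<^bsub>G\<^esub> n) = f \<one>\<^bsub>G\<^esub> \<longleftrightarrow> x [^]\<^bsub>G\<^esub> n = \<one>\<^bsub>G\<^esub>"
        using bij by (auto simp: bij_betw_def inj_on_def)
      then show "f x [^]\<^bsub>H\<^esub> n = \<one>\<^bsub>H\<^esub> \<longleftrightarrow> x [^]\<^bsub>G\<^esub> n = \<one>\<^bsub>G\<^esub>" by (simp only: pow[OF x] one)
    qed
    finally show ?thesis .
  qed
  then show ?thesis using assms(4) by (simp add: has_exponent_def)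
qed

section \<open>Cosets and exponents of \<open>b\<close>\<close>

context nonsymmetric_EGS
begin

interpretation T: group "AutT p" by (rule AutT_group)
interpretation GG: group GG by (rule EGS_group_group)

abbreviation "H n \<equiv> H_sub p \<alpha> n"
abbreviation "St n \<equiv> level_stab p \<Gamma> n"

text \<open>A description of the cosets of \<open>H\<^sub>n\<close> in \<open>bal n\<close> without representatives.\<close>

definition fiber :: "nat \<Rightarrow> (nat list \<Rightarrow> int) \<Rightarrow> (nat list \<Rightarrow> nat list) set" where
  "fiber n \<eta> = {h \<in> bal n. \<forall>v\<in>level p n. b_exp n h v = \<eta> v}"

lemma bal_closed:
  "g \<in> bal n \<Longrightarrow> h \<in> bal n \<Longrightarrow> g \<cdot> h \<in> bal n"
  "g \<in> bal n \<Longrightarrow> inv\<^sub>T g \<in> bal n"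
  by (fact subgroup.m_closed[OF bal_subgroup] subgroup.m_inv_closed[OF bal_subgroup])+

lemma H_eq_fiber: "H n = fiber n (\<lambda>v. 0)"
  by (simp add: H_sub_eq_b_exp fiber_def)

lemma fiber_divide:
  assumes "g \<in> fiber n \<eta>" "k \<in> fiber n \<xi>"
  obtains h where "h \<in> fiber n (\<lambda>v. (\<xi> v - \<eta> v) mod int p)" "k = h \<cdot> g"
proof -
  have g: "g \<in> bal n" "\<And>v. v \<in> level p n \<Longrightarrow> b_exp n g v = \<eta> v"
    and k: "k \<in> bal n" "\<And>v. v \<in> level p n \<Longrightarrow> b_exp n k v = \<xi> v"
    using assms by (auto simp: fiber_def)
  define h where "h = k \<cdot> inv\<^sub>T g"
  have h: "h \<in> bal n" using g(1) k(1) by (simp add: h_def bal_closed)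
  have kh: "k = h \<cdot> g"
    using bal_carrier[OF g(1)] bal_carrier[OF k(1)] by (simp add: h_def T.m_assoc)
  have "b_exp n h v = (\<xi> v - \<eta> v) mod int p" if v: "v \<in> level p n" for v
  proof -
    have "\<xi> v = (b_exp n h v + \<eta> v) mod int p"
      using b_exp_mult[OF h g(1) v] kh g(2)[OF v] k(2)[OF v] by simp
    then have "(\<xi> v - \<eta> v) mod int p = b_exp n h v mod int p" by (simp add: mod_simps)
    then show ?thesis using b_exp_range[OF v] by simp
  qed
  then have "h \<in> fiber n (\<lambda>v. (\<xi> v - \<eta> v) mod int p)" using h by (simp add: fiber_def)
  then show thesis using kh by (rule that)
qed

lemma fiber_mult:
  assumes "g \<in> fiber n \<eta>" "h \<in> fiber n \<xi>"
  shows "g \<cdot> h \<in> fiber n (\<lambda>v. (\<eta> v + \<xi> v) mod int p)"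
  using assms b_exp_mult by (auto simp: fiber_def bal_closed)

lemma fiber_cong: "(\<And>v. v \<in> level p n \<Longrightarrow> \<eta> v = \<xi> v) \<Longrightarrow> fiber n \<eta> = fiber n \<xi>"
  by (auto simp: fiber_def)

lemma set_mult_eq: "X <#>\<^bsub>GG\<^esub> Y = {x \<cdot> y | x y. x \<in> X \<and> y \<in> Y}"
  by (auto simp: set_mult_def)

lemma r_coset_eq: "X #>\<^bsub>GG\<^esub> g = {x \<cdot> g | x. x \<in> X}"
  by (auto simp: r_coset_def)

lemma fiber_set_mult:
  assumes "fiber n \<eta> \<noteq> {}" "fiber n \<xi> \<noteq> {}"
  shows "fiber n \<eta> <#>\<^bsub>GG\<^esub> fiber n \<xi> = fiber n (\<lambda>v. (\<eta> v + \<xi> v) mod int p)"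
proof (intro equalityI subsetI)
  fix k assume "k \<in> fiber n \<eta> <#>\<^bsub>GG\<^esub> fiber n \<xi>"
  then show "k \<in> fiber n (\<lambda>v. (\<eta> v + \<xi> v) mod int p)" using fiber_mult by (auto simp: set_mult_eq)
next
  fix k assume k: "k \<in> fiber n (\<lambda>v. (\<eta> v + \<xi> v) mod int p)"
  obtain g where g: "g \<in> fiber n \<xi>" using assms by blast
  obtain e where e: "e \<in> fiber n \<eta>" using assms by blast
  obtain h where h: "h \<in> fiber n (\<lambda>v. ((\<eta> v + \<xi> v) mod int p - \<xi> v) mod int p)" "k = h \<cdot> g"
    using fiber_divide[OF g k] by blast
  have "((\<eta> v + \<xi> v) mod int p - \<xi> v) mod int p = \<eta> v" if v: "v \<in> level p n" for v
  proof -
    have "0 \<le> \<eta> v" "\<eta> v < int p" using e v b_exp_range[OF v, of e] by (simp_all add: fiber_def)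
    then show ?thesis by (simp add: mod_diff_left_eq)
  qed
  then have "fiber n (\<lambda>v. ((\<eta> v + \<xi> v) mod int p - \<xi> v) mod int p) = fiber n \<eta>" by (rule fiber_cong)
  then have "h \<in> fiber n \<eta>" using h(1) by simp
  then show "k \<in> fiber n \<eta> <#>\<^bsub>GG\<^esub> fiber n \<xi>" using h(2) g by (auto simp: set_mult_eq)
qed

lemma fiber_coset:
  assumes "g \<in> fiber n \<eta>" shows "fiber n \<eta> = H n #>\<^bsub>GG\<^esub> g"
proof (intro equalityI subsetI)
  fix k assume "k \<in> fiber n \<eta>"
  then obtain h where "h \<in> fiber n (\<lambda>v. (\<eta> v - \<eta> v) mod int p)" "k = h \<cdot> g"
    using fiber_divide[OF assms] by blast
  then show "k \<in> H n #>\<^bsub>GG\<^esub> g" by (auto simp: r_coset_eq H_eq_fiber)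
next
  fix k assume "k \<in> H n #>\<^bsub>GG\<^esub> g"
  then obtain h where h: "h \<in> H n" "k = h \<cdot> g" by (auto simp: r_coset_eq)
  then have "k \<in> fiber n (\<lambda>v. (0 + \<eta> v) mod int p)" using fiber_mult[of h n "\<lambda>v. 0" g \<eta>] assms by (simp add: H_eq_fiber)
  moreover have "(0 + \<eta> v) mod int p = \<eta> v" if v: "v \<in> level p n" for v
    using assms v b_exp_range[OF v, of g] by (auto simp: fiber_def)
  then have "fiber n (\<lambda>v. (0 + \<eta> v) mod int p) = fiber n \<eta>" by (rule fiber_cong)
  ultimately show "k \<in> fiber n \<eta>" by simp
qed

lemma fiber_nonempty:
  assumes "0 < n" "\<eta> \<in> carrier (Ztilde p n)" shows "fiber n \<eta> \<noteq> {}"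
proof -
  have "0 \<le> \<eta> v \<and> \<eta> v < int p" if "v \<in> level p n" for v
    using assms that by (auto simp: Ztilde_carrier PiE_iff)
  then obtain h where "h \<in> bal n" "\<And>v. v \<in> level p n \<Longrightarrow> b_exp n h v = \<eta> v" using b_exp_exists by blast
  then show ?thesis by (auto simp: fiber_def)
qed

lemma self_in_fiber: "g \<in> bal n \<Longrightarrow> g \<in> fiber n (b_exp n g)"
  by (simp add: fiber_def)

lemma b_exp_carrier: "0 < n \<Longrightarrow> b_exp n g \<in> carrier (Ztilde p n)"
  using b_exp_range by (auto simp: Ztilde_carrier PiE_iff b_exp_def)

lemma b_exp_of_fiber:
  assumes "0 < n" "\<eta> \<in> carrier (Ztilde p n)" "g \<in> fiber n \<eta>" shows "b_exp n g = \<eta>"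
  by (rule extensionalityI[of _ "level p n"])
    (use assms in \<open>auto simp: fiber_def b_exp_def Ztilde_carrier PiE_iff\<close>)

text \<open>The exponent at a vertex is the sum of the exponents at its children, which is the map \<open>\<theta>\<close>.\<close>

lemma fiber_Suc_subset:
  assumes "0 < n" "theta p (Suc n) \<eta> = \<xi>"
  shows "fiber (Suc n) \<eta> \<subseteq> fiber n \<xi>"
proof
  fix h assume h: "h \<in> fiber (Suc n) \<eta>"
  then have hb: "h \<in> bal (Suc n)" by (simp add: fiber_def)
  have "b_exp n h u = \<xi> u" if u: "u \<in> level p n" for u
  proof -
    have "(\<Sum>j<p. b_exp (Suc n) h (u @ [j])) = (\<Sum>j<p. \<eta> (u @ [j]))"
      by (rule sum.cong) (use h u in \<open>auto simp: fiber_def level_def\<close>)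
    then show ?thesis
      unfolding b_exp_parent[OF hb u] using assms u by (auto simp: theta_Suc)
  qed
  then show "h \<in> fiber n \<xi>" using hb bal_Suc_subset by (auto simp: fiber_def)
qed

lemma bal_subset_stab: "bal n \<subseteq> St n"
  using bal_subset_EGS bal_fixes by (auto simp: level_stab_def)

lemma one_in_H: "\<one>\<^sub>T \<in> H n"
proof -
  have "subgroup (H n) (AutT p)"
    unfolding H_sub_eq
    by (rule with_sections_subgroup) (rule T.derived_is_subgroup, use EGS_carrier in blast)
  then show ?thesis by (rule subgroup.one_closed)
qed

lemma stab_subgroup: "subgroup (St n) (AutT p)"
proof (rule T.subgroupI)
  show "St n \<subseteq> carrier (AutT p)" using EGS_carrier by (auto simp: level_stab_def)
  show "St n \<noteq> {}" using EGS_closed(1) level_words by (fastforce simp: level_stab_def)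
  fix g assume g: "g \<in> St n"
  then have gc: "g \<in> carrier (AutT p)" "g \<in> \<Gamma>" using EGS_carrier by (auto simp: level_stab_def)
  have "(inv\<^sub>T g) v = v" if v: "v \<in> level p n" for v
    using fun_cong[OF T.r_inv[OF gc(1)], of v] g v level_words[OF v] by (simp add: level_stab_def)
  then show "inv\<^sub>T g \<in> St n" using EGS_closed(3)[OF gc(2)] by (simp add: level_stab_def)
  fix h assume "h \<in> St n"
  then show "g \<cdot> h \<in> St n"
    using g EGS_closed(2) level_words by (auto simp: level_stab_def)
qed

section \<open>The kernel\<close>

definition thread :: "(nat \<Rightarrow> nat list \<Rightarrow> int) \<Rightarrow> nat \<Rightarrow> (nat list \<Rightarrow> nat list) set" where
  "thread y = (\<lambda>n\<in>{1..}. fiber n (y n))"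

text \<open>The inverse of \<open>fiber\<close> on cosets. Index \<open>0\<close> is not a coordinate of the kernel and carries the trivial group.\<close>

definition coset_exp :: "nat \<Rightarrow> (nat list \<Rightarrow> nat list) set \<Rightarrow> nat list \<Rightarrow> int" where
  "coset_exp n X = (if n = 0 then \<one>\<^bsub>Ztilde p 0\<^esub> else b_exp n (SOME h. h \<in> X))"

lemma coset_exp_fiber:
  assumes "0 < n" "\<eta> \<in> carrier (Ztilde p n)" shows "coset_exp n (fiber n \<eta>) = \<eta>"
proof -
  have "(SOME h. h \<in> fiber n \<eta>) \<in> fiber n \<eta>" using fiber_nonempty[OF assms] by (simp add: some_in_eq)
  then have "b_exp n (SOME h. h \<in> fiber n \<eta>) = \<eta>" by (rule b_exp_of_fiber[OF assms])
  then show ?thesis using assms(1) by (simp add: coset_exp_def)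
qed

lemma Ztilde_infD:
  assumes "y \<in> carrier (Ztilde_inf p)"
  shows "y n \<in> carrier (Ztilde p n)" "theta p (Suc n) (y (Suc n)) = y n"
  using assms by (auto simp: Ztilde_inf_def proj_lim_simps)

lemma Ker_sigma_simps:
  "carrier (Ker_sigma p \<alpha>) = {x \<in> \<Pi>\<^sub>E n\<in>{1..}. rcosets\<^bsub>GG\<^esub> (H n).
     (\<forall>n\<ge>1. H n <#>\<^bsub>GG\<^esub> x (Suc n) = x n) \<and> (\<forall>n\<ge>1. St n <#>\<^bsub>GG\<^esub> x n = St n)}"
  "x \<otimes>\<^bsub>Ker_sigma p \<alpha>\<^esub> y = (\<lambda>n\<in>{1..}. x n <#>\<^bsub>GG\<^esub> y n)"
  "\<one>\<^bsub>Ker_sigma p \<alpha>\<^esub> = (\<lambda>n\<in>{1..}. H n)"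
proof -
  have "sigma p \<alpha> x = \<one>\<^bsub>Gamma_bar p \<alpha>\<^esub> \<longleftrightarrow> (\<forall>n\<ge>1. St n <#>\<^bsub>GG\<^esub> x n = St n)" for x
    by (auto simp: sigma_def Gamma_bar_def proj_lim_simps coset_proj_def fun_eq_iff restrict_def)
  then show "carrier (Ker_sigma p \<alpha>) = {x \<in> \<Pi>\<^sub>E n\<in>{1..}. rcosets\<^bsub>GG\<^esub> (H n).
     (\<forall>n\<ge>1. H n <#>\<^bsub>GG\<^esub> x (Suc n) = x n) \<and> (\<forall>n\<ge>1. St n <#>\<^bsub>GG\<^esub> x n = St n)}"
    by (auto simp: Ker_sigma_def kernel_def Gamma_hat_def proj_lim_simps coset_proj_def FactGroup_def)
qed (simp_all add: Ker_sigma_def Gamma_hat_def proj_lim_simps)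

lemma Ker_sigma_topology_eq:
  "Ker_sigma_topology p \<alpha> = subtopology
     (product_topology (\<lambda>n. discrete_topology (rcosets\<^bsub>GG\<^esub> (H n))) {1..}) (carrier (Ker_sigma p \<alpha>))"
proof -
  have "carrier (Ker_sigma p \<alpha>) \<subseteq> carrier (Gamma_hat p \<alpha>)" by (auto simp: Ker_sigma_def kernel_def)
  moreover have "Gamma_hat_topology p \<alpha> = subtopology
      (product_topology (\<lambda>n. discrete_topology (carrier (GG Mod H n))) {1..}) (carrier (Gamma_hat p \<alpha>))"
    by (simp only: Gamma_hat_topology_def proj_lim_topology_def Gamma_hat_def)
  moreover have "carrier (GG Mod H n) = rcosets\<^bsub>GG\<^esub> (H n)" for n by (simp add: FactGroup_def)
  ultimately show ?thesis
    by (simp only: Ker_sigma_topology_def subtopology_subtopology Int_absorb1)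
qed

lemma thread_in_Ker:
  assumes y: "y \<in> carrier (Ztilde_inf p)" shows "thread y \<in> carrier (Ker_sigma p \<alpha>)"
proof -
  have ne: "fiber n (y n) \<noteq> {}" if "n \<ge> 1" for n
    using fiber_nonempty[OF _ Ztilde_infD(1)[OF y]] that by simp
  have "fiber n (y n) \<in> rcosets\<^bsub>GG\<^esub> (H n)" if n: "n \<ge> 1" for n
  proof -
    obtain g where g: "g \<in> fiber n (y n)" using ne[OF n] by blast
    then have "g \<in> \<Gamma>" using bal_subset_EGS by (auto simp: fiber_def)
    then show ?thesis using fiber_coset[OF g] by (auto simp: RCOSETS_def)
  qed
  moreover have "H n <#>\<^bsub>GG\<^esub> fiber (Suc n) (y (Suc n)) = fiber n (y n)" if n: "n \<ge> 1" for n
  proof (intro equalityI subsetI)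
    have sub: "fiber (Suc n) (y (Suc n)) \<subseteq> fiber n (y n)"
      using fiber_Suc_subset[OF _ Ztilde_infD(2)[OF y]] n by simp
    show "k \<in> fiber n (y n)" if "k \<in> H n <#>\<^bsub>GG\<^esub> fiber (Suc n) (y (Suc n))" for k
    proof -
      obtain a h where ah: "a \<in> H n" "h \<in> fiber (Suc n) (y (Suc n))" "k = a \<cdot> h"
        using \<open>k \<in> _\<close> by (auto simp: set_mult_eq)
      then show ?thesis using fiber_coset[of h n "y n"] sub by (auto simp: r_coset_eq)
    qed
    show "k \<in> H n <#>\<^bsub>GG\<^esub> fiber (Suc n) (y (Suc n))" if k: "k \<in> fiber n (y n)" for k
    proof -
      obtain h where h: "h \<in> fiber (Suc n) (y (Suc n))" using ne[of "Suc n"] by auto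
      then show ?thesis using fiber_coset[of h n "y n"] sub k by (auto simp: r_coset_eq set_mult_eq)
    qed
  qed
  moreover have "St n <#>\<^bsub>GG\<^esub> fiber n (y n) = St n" if n: "n \<ge> 1" for n
  proof (intro equalityI subsetI)
    have sub: "fiber n (y n) \<subseteq> St n" using bal_subset_stab by (auto simp: fiber_def)
    show "k \<in> St n" if "k \<in> St n <#>\<^bsub>GG\<^esub> fiber n (y n)" for k
      using that sub subgroup.m_closed[OF stab_subgroup] by (auto simp: set_mult_eq)
    show "k \<in> St n <#>\<^bsub>GG\<^esub> fiber n (y n)" if k: "k \<in> St n" for k
    proof -
      obtain h where h: "h \<in> fiber n (y n)" using ne[OF n] by blast
      then have hS: "h \<in> St n" using sub by blast
      then have "k \<cdot> inv\<^sub>T h \<in> St n"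
        using k stab_subgroup by (simp add: subgroup.m_closed subgroup.m_inv_closed)
      moreover have "k = k \<cdot> inv\<^sub>T h \<cdot> h"
        using subgroup.mem_carrier[OF stab_subgroup k] subgroup.mem_carrier[OF stab_subgroup hS]
        by (simp add: T.m_assoc)
      ultimately show ?thesis using h unfolding set_mult_eq by blast
    qed
  qed
  ultimately show ?thesis by (auto simp: Ker_sigma_simps thread_def)
qed

text \<open>Take a representative \<open>g\<close> of the coset two levels further down. The kernel condition there puts \<open>g\<close> into
  \<open>St (n + 2)\<close>, so \<open>g\<close> lies in \<open>bal n\<close>, and by coherence \<open>g\<close> also represents the coset with index \<open>n\<close>.\<close>

lemma Ker_component:
  assumes x: "x \<in> carrier (Ker_sigma p \<alpha>)" and n: "1 \<le> n"
  obtains g where "g \<in> bal n" "g \<in> x n" "x n = fiber n (b_exp n g)"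
proof -
  have xD: "x n \<in> rcosets\<^bsub>GG\<^esub> (H n)" "H n <#>\<^bsub>GG\<^esub> x (Suc n) = x n" "St n <#>\<^bsub>GG\<^esub> x n = St n" if "1 \<le> n" for n
    using x that by (auto simp: Ker_sigma_simps)
  obtain g where g: "g \<in> \<Gamma>" "x (n + 2) = H (n + 2) #>\<^bsub>GG\<^esub> g" using xD(1)[of "n + 2"] by (auto simp: RCOSETS_def)
  have gc: "g \<in> carrier (AutT p)" using g(1) by (rule EGS_carrier)
  have one_mult: "\<one>\<^sub>T \<cdot> g = g" using gc by simp
  have "g \<in> x (n + 2)" using g(2) one_in_H one_mult unfolding r_coset_eq by force
  then have "g \<in> St (n + 2)"
    using xD(3)[of "n + 2"] subgroup.one_closed[OF stab_subgroup, of "n + 2"] one_mult unfolding set_mult_eq by force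
  then have gb: "g \<in> bal n" using stab_subset_bal by blast
  have up: "g \<in> x m" if "g \<in> x (Suc m)" "1 \<le> m" for m
    using xD(2)[OF \<open>1 \<le> m\<close>] one_in_H[of m] one_mult that(1) unfolding set_mult_eq by force
  have gx: "g \<in> x n" using up[OF up[of "Suc n"]] \<open>g \<in> x (n + 2)\<close> n by simp
  have "subgroup (H n) GG"
  proof -
    have "subgroup (H n) (AutT p)"
      unfolding H_sub_eq by (rule with_sections_subgroup) (rule T.derived_is_subgroup, use EGS_carrier in blast)
    moreover have "H n \<subseteq> \<Gamma>" using bal_subset_EGS by (auto simp: H_sub_eq_b_exp)
    ultimately show ?thesis unfolding EGS_group_def by (rule T.subgroup_incl[OF _ EGS_subgroup])
  qed
  moreover obtain g' where "g' \<in> \<Gamma>" "x n = H n #>\<^bsub>GG\<^esub> g'" using xD(1)[OF n] by (auto simp: RCOSETS_def)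
  ultimately have "x n = H n #>\<^bsub>GG\<^esub> g"
    using GG.repr_independence[of g "H n" g'] gx g(1) by simp
  then have "x n = fiber n (b_exp n g)" using fiber_coset[OF self_in_fiber[OF gb]] by simp
  then show thesis using that gb gx by blast
qed

text \<open>A common element of the cosets with indices \<open>n\<close> and \<open>n + 1\<close> has exponents on both levels, and these are
  related by \<open>\<theta>\<close>.\<close>

lemma Ker_thread:
  assumes x: "x \<in> carrier (Ker_sigma p \<alpha>)"
  shows "(\<lambda>n. coset_exp n (x n)) \<in> carrier (Ztilde_inf p)" "thread (\<lambda>n. coset_exp n (x n)) = x"
proof -
  define y where "y = (\<lambda>n. coset_exp n (x n))"
  have y: "x n = fiber n (y n)" "y n \<in> carrier (Ztilde p n)" if "1 \<le> n" for n
  proof -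
    obtain g where g: "g \<in> bal n" "x n = fiber n (b_exp n g)" using Ker_component[OF x \<open>1 \<le> n\<close>] by blast
    have "b_exp n g \<in> carrier (Ztilde p n)" using b_exp_carrier \<open>1 \<le> n\<close> by simp
    then have "y n = b_exp n g" using coset_exp_fiber[of n "b_exp n g"] g(2) \<open>1 \<le> n\<close> by (simp add: y_def)
    then show "x n = fiber n (y n)" "y n \<in> carrier (Ztilde p n)"
      using g(2) \<open>b_exp n g \<in> _\<close> by simp_all
  qed
  have th: "theta p (Suc n) (y (Suc n)) = y n" if n: "1 \<le> n" for n
  proof -
    obtain h where h: "h \<in> fiber (Suc n) (y (Suc n))"
      using fiber_nonempty[OF _ y(2)[of "Suc n"]] by auto
    have hc: "h \<in> carrier (AutT p)" using h bal_carrier by (auto simp: fiber_def)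
    have "H n <#>\<^bsub>GG\<^esub> x (Suc n) = x n" using x n by (simp add: Ker_sigma_simps)
    then have "h \<in> x n"
      using h y(1)[of "Suc n"] one_in_H[of n] T.l_one[OF hc] unfolding set_mult_eq by force
    then have "b_exp n h = y n" using b_exp_of_fiber[OF _ y(2)[OF n]] y(1)[OF n] n by simp
    moreover have "h \<in> fiber n (theta p (Suc n) (y (Suc n)))"
      using fiber_Suc_subset[of n "y (Suc n)"] h n by auto
    then have "b_exp n h = theta p (Suc n) (y (Suc n))"
      using b_exp_of_fiber[of n] hom_in_carrier[OF theta_hom[OF p_pos, of n] y(2)[of "Suc n"]] n by simp
    ultimately show ?thesis by simp
  qed
  have y0: "y 0 = \<one>\<^bsub>Ztilde p 0\<^esub>" by (simp add: y_def coset_exp_def)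
  have "y n \<in> carrier (Ztilde p n)" for n
    using y(2)[of n] y0 group.is_monoid[OF Ztilde_group[of p 0]] monoid.one_closed by (cases "n = 0") auto
  moreover have "theta p (Suc n) (y (Suc n)) = y n" for n
    using th[of n] y0 by (cases "n = 0") (auto simp: theta_def)
  ultimately have "y \<in> carrier (Ztilde_inf p)"
    by (simp add: Ztilde_inf_def proj_lim_simps PiE_iff extensional_def)
  then show "(\<lambda>n. coset_exp n (x n)) \<in> carrier (Ztilde_inf p)" by (simp add: y_def)
  have "x \<in> extensional {1..}" using x by (auto simp: Ker_sigma_simps PiE_iff)
  then have "thread y = x"
    by (intro extensionalityI[of _ "{1..}"]) (auto simp: thread_def y(1)[symmetric])
  then show "thread (\<lambda>n. coset_exp n (x n)) = x" by (simp add: y_def)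
qed

lemma coset_exp_thread:
  assumes y: "y \<in> carrier (Ztilde_inf p)"
  shows "(\<lambda>n. coset_exp n (thread y n)) = y"
proof
  fix n
  show "coset_exp n (thread y n) = y n"
  proof (cases "n = 0")
    case True
    have "y 0 \<in> carrier (Ztilde p 0)" by (rule Ztilde_infD(1)[OF y])
    then show ?thesis using True by (simp add: coset_exp_def Ztilde_carrier) (simp add: Ztilde_def fun_eq_iff)
  next
    case False
    then show ?thesis using coset_exp_fiber[OF _ Ztilde_infD(1)[OF y], of n] by (simp add: thread_def)
  qed
qed

lemma thread_homeomorphic:
  "homeomorphic_maps (Ztilde_inf_topology p) (Ker_sigma_topology p \<alpha>) thread (\<lambda>x n. coset_exp n (x n))"
proof -
  have tZ: "topspace (Ztilde_inf_topology p) = carrier (Ztilde_inf p)"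
    unfolding Ztilde_inf_topology_def Ztilde_inf_def by (rule topspace_proj_lim)
  have tK: "topspace (Ker_sigma_topology p \<alpha>) = carrier (Ker_sigma p \<alpha>)"
    unfolding Ker_sigma_topology_eq by (auto simp: Ker_sigma_simps)
  have "continuous_map (Ztilde_inf_topology p) (Ker_sigma_topology p \<alpha>) thread"
    unfolding Ker_sigma_topology_eq continuous_map_in_subtopology continuous_map_componentwise
  proof (intro conjI ballI)
    show "thread ` topspace (Ztilde_inf_topology p) \<subseteq> extensional {1..}" by (auto simp: thread_def)
    show "thread \<in> topspace (Ztilde_inf_topology p) \<rightarrow> carrier (Ker_sigma p \<alpha>)"
      using thread_in_Ker by (auto simp: tZ)
    fix n :: nat assume n: "n \<in> {1..}"
    have c: "continuous_map (Ztilde_inf_topology p) (discrete_topology (carrier (Ztilde p n))) (\<lambda>y. y n)"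
      unfolding Ztilde_inf_topology_def by (rule proj_lim_coordinate) simp
    have mem: "fiber n \<eta> \<in> rcosets\<^bsub>GG\<^esub> (H n)" if \<eta>: "\<eta> \<in> carrier (Ztilde p n)" for \<eta>
    proof -
      obtain g where g: "g \<in> fiber n \<eta>" using fiber_nonempty[of n \<eta>] \<eta> n by auto
      then have "g \<in> \<Gamma>" using bal_subset_EGS by (auto simp: fiber_def)
      then show ?thesis using fiber_coset[OF g] by (auto simp: RCOSETS_def)
    qed
    have "continuous_map (Ztilde_inf_topology p) (discrete_topology (rcosets\<^bsub>GG\<^esub> (H n))) (\<lambda>y. fiber n (y n))"
      by (rule continuous_discrete_map2[OF c c]) (rule mem)
    then show "continuous_map (Ztilde_inf_topology p) (discrete_topology (rcosets\<^bsub>GG\<^esub> (H n))) (\<lambda>y. thread y n)"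
      using n by (simp add: thread_def)
  qed
  moreover have "continuous_map (Ker_sigma_topology p \<alpha>) (Ztilde_inf_topology p) (\<lambda>x n. coset_exp n (x n))"
    unfolding Ztilde_inf_topology_def
  proof (rule continuous_map_into_proj_lim)
    show "(\<lambda>n. coset_exp n (x n)) \<in> carrier (proj_lim 0 (Ztilde p) (theta p))"
      if "x \<in> topspace (Ker_sigma_topology p \<alpha>)" for x
      using Ker_thread(1)[of x] that by (simp add: tK Ztilde_inf_def)
    fix n :: nat
    have one: "\<one>\<^bsub>Ztilde p 0\<^esub> \<in> carrier (Ztilde p 0)"
      by (rule monoid.one_closed[OF group.is_monoid[OF Ztilde_group]])
    have mem: "coset_exp n X \<in> carrier (Ztilde p n)" for X
      using one b_exp_carrier[of n] by (cases "n = 0") (auto simp: coset_exp_def)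
    show "continuous_map (Ker_sigma_topology p \<alpha>) (discrete_topology (carrier (Ztilde p n))) (\<lambda>x. coset_exp n (x n))"
    proof (cases "n = 0")
      case True
      then show ?thesis using one by (simp add: coset_exp_def)
    next
      case False
      then have c: "continuous_map (Ker_sigma_topology p \<alpha>) (discrete_topology (rcosets\<^bsub>GG\<^esub> (H n))) (\<lambda>x. x n)"
        unfolding Ker_sigma_topology_eq by (intro discrete_coordinate) simp
      show ?thesis by (rule continuous_discrete_map2[OF c c]) (rule mem)
    qed
  qed
  ultimately show ?thesis
    unfolding homeomorphic_maps_def using coset_exp_thread Ker_thread(2) by (auto simp: tZ tK)
qed

lemma thread_mult:
  assumes "x \<in> carrier (Ztilde_inf p)" "y \<in> carrier (Ztilde_inf p)"
  shows "thread (x \<otimes>\<^bsub>Ztilde_inf p\<^esub> y) = thread x \<otimes>\<^bsub>Ker_sigma p \<alpha>\<^esub> thread y"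
proof -
  have "fiber n ((x \<otimes>\<^bsub>Ztilde_inf p\<^esub> y) n) = fiber n (x n) <#>\<^bsub>GG\<^esub> fiber n (y n)" if n: "n \<in> {1..}" for n
  proof -
    have "fiber n (x n) <#>\<^bsub>GG\<^esub> fiber n (y n) = fiber n (\<lambda>v. (x n v + y n v) mod int p)"
      using n fiber_nonempty[OF _ Ztilde_infD(1)] assms by (intro fiber_set_mult) simp_all
    also have "\<dots> = fiber n ((x \<otimes>\<^bsub>Ztilde_inf p\<^esub> y) n)"
      by (rule fiber_cong) (use n in \<open>simp add: Ztilde_inf_def proj_lim_simps Ztilde_mult\<close>)
    finally show ?thesis by simp
  qed
  then show ?thesis
    unfolding Ker_sigma_simps thread_def by (intro restrict_ext) simp
qed

lemma thread_one: "thread \<one>\<^bsub>Ztilde_inf p\<^esub> = \<one>\<^bsub>Ker_sigma p \<alpha>\<^esub>"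
  unfolding Ker_sigma_simps thread_def
proof (rule restrict_ext)
  fix n :: nat assume "n \<in> {1..}"
  then show "fiber n (\<one>\<^bsub>Ztilde_inf p\<^esub> n) = H n"
    unfolding H_eq_fiber by (intro fiber_cong) (simp add: Ztilde_inf_def proj_lim_simps Ztilde_one)
qed

lemma Ker_sigma_structure:
  "\<exists>f. topological_group_iso (Ker_sigma p \<alpha>) (Ker_sigma_topology p \<alpha>) (Ztilde_inf p) (Ztilde_inf_topology p) f"
  "profinite_group (Ker_sigma p \<alpha>) (Ker_sigma_topology p \<alpha>)"
  "comm_group (Ker_sigma p \<alpha>)"
  "has_exponent (Ker_sigma p \<alpha>) p"
proof -
  have prof: "profinite_group (Ztilde_inf p) (Ztilde_inf_topology p)"
    by (rule Ztilde_inf_profinite[OF p_pos])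
  have top: "topspace (Ker_sigma_topology p \<alpha>) = carrier (Ker_sigma p \<alpha>)"
    unfolding Ker_sigma_topology_eq by (auto simp: Ker_sigma_simps)
  show K: "profinite_group (Ker_sigma p \<alpha>) (Ker_sigma_topology p \<alpha>)"
    by (rule profinite_group_transport(1)[OF prof thread_homeomorphic top]) (fact thread_mult thread_one)+
  have iso: "thread \<in> iso (Ztilde_inf p) (Ker_sigma p \<alpha>)"
    by (rule profinite_group_transport(2)[OF prof thread_homeomorphic top]) (fact thread_mult thread_one)+
  have gZ: "group (Ztilde_inf p)" using prof by (simp add: profinite_group_def topological_group_def)
  have gK: "group (Ker_sigma p \<alpha>)" using K by (simp add: profinite_group_def topological_group_def)
  show "comm_group (Ker_sigma p \<alpha>)"
    by (rule comm_group.iso_imp_comm_group[OF Ztilde_inf_comm[OF p_pos] _ group.is_monoid[OF gK]])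
      (use iso in \<open>auto simp: is_iso_def\<close>)
  show "has_exponent (Ker_sigma p \<alpha>) p"
    by (rule has_exponent_iso[OF gZ gK iso Ztilde_inf_exponent[OF p_pos]])
  define f where "f = inv_into (carrier (Ztilde_inf p)) thread"
  have f: "f \<in> iso (Ker_sigma p \<alpha>) (Ztilde_inf p)"
    unfolding f_def by (rule group.iso_set_sym[OF gZ iso])
  have f_eq: "f x = (\<lambda>n. coset_exp n (x n))" if "x \<in> carrier (Ker_sigma p \<alpha>)" for x
    unfolding f_def
    by (rule inv_into_f_eq) (use iso Ker_thread[OF that] in \<open>auto simp: iso_def bij_betw_def\<close>)
  have homeo: "homeomorphic_map (Ker_sigma_topology p \<alpha>) (Ztilde_inf_topology p) (\<lambda>x n. coset_exp n (x n))"
    unfolding homeomorphic_map_maps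
    by (rule exI[of _ thread]) (rule iffD1[OF homeomorphic_maps_sym thread_homeomorphic])
  have "homeomorphic_map (Ker_sigma_topology p \<alpha>) (Ztilde_inf_topology p) f"
    by (rule homeomorphic_map_eq[OF homeo]) (rule f_eq[symmetric], simp only: top)
  then show "\<exists>f. topological_group_iso (Ker_sigma p \<alpha>) (Ker_sigma_topology p \<alpha>) (Ztilde_inf p) (Ztilde_inf_topology p) f"
    using f by (auto simp: topological_group_iso_def)
qed

end

theorem theorem3p4:
  fixes p :: nat and \<alpha> :: "nat \<Rightarrow> nat"
  assumes "prime p" and "p \<ge> 3"
    and "GF_vector p \<alpha>"
    and "\<not> symmetric_vector p \<alpha>"
    and "(\<Sum>i=1..p-1. \<alpha> i) mod p = 0"
  shows "(\<exists>f. topological_group_iso (Ker_sigma p \<alpha>) (Ker_sigma_topology p \<alpha>)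
             (Ztilde_inf p) (Ztilde_inf_topology p) f) \<and>
         profinite_group (Ker_sigma p \<alpha>) (Ker_sigma_topology p \<alpha>) \<and>
         comm_group (Ker_sigma p \<alpha>) \<and>
         has_exponent (Ker_sigma p \<alpha>) p"
proof -
  interpret nonsymmetric_EGS p \<alpha> using assms(1-4) by unfold_locales
  show ?thesis using Ker_sigma_structure by blast
qed

end
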